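(* Let $G$ be a finite group. Then $\Gamma(G)$ is planar if and only if either $G$ is isomorphic to one of $C_2\times C_2$, $C_2\times C_4$, $D_4$, $Q_8$, $\mathrm{Sym}(3)$, or $G\cong C_n$ is cyclic of order $n$ and one of the following occurs: (1) $n$ is a prime power; (2) $n=p\cdot q$, where $p$ and $q$ are distinct primes and $p\leq 3$; (3) $n=4\cdot q$, where $q$ is an odd prime.
   Context: Let $G$ be a finite group. A generating set $X$ of $G$ is minimal if no proper subset of $X$ generates $G$. The independence graph $\Gamma(G)$ is the simple graph whose vertices are the elements of $G$ and in which $x$ and $y$ are joined by an edge if and only if $x\neq y$ and there exists a minimal generating set of $G$ containing both $x$ and $y$. $C_n$ is the cyclic group of order $n$, $D_4$ is the dihedral group of order $8$, $Q_8$ is the quaternion group of order $8$, and $\mathrm{Sym}(3)$ is the symmetric group of degree $3$. A graph is planar if it can be drawn in the plane so that its edges intersect only at their ends. The number $1$ is counted as a prime power. *)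

theory Defs
  imports
    "HOL-Algebra.Elementary_Groups"
    "HOL-Algebra.Sym_Groups"
    "HOL-Number_Theory.Prime_Powers"
    "HOL-Analysis.Path_Connected"
begin

definition minimal_generating_set :: "('a, 'b) monoid_scheme \<Rightarrow> 'a set \<Rightarrow> bool" where
  "minimal_generating_set G X \<longleftrightarrow>
     X \<subseteq> carrier G \<and> generate G X = carrier G \<and>
     (\<forall>Y. Y \<subset> X \<longrightarrow> generate G Y \<noteq> carrier G)"

(* A simple graph is a vertex set together with a set of two-element sets of vertices. *)
type_synonym 'a simple_graph = "'a set \<times> 'a set set"

definition independence_graph :: "('a, 'b) monoid_scheme \<Rightarrow> 'a simple_graph" where
  "independence_graph G =
     (carrier G,
      {{x, y} | x y. x \<in> carrier G \<and> y \<in> carrier G \<and> x \<noteq> y \<and>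
         (\<exists>X. minimal_generating_set G X \<and> x \<in> X \<and> y \<in> X)})"

(* The plane is the type complex.  Vertices are drawn as distinct points, and an edge as an
   arc (an injective path) joining the images of its two endpoints and passing through no
   other vertex; the arcs of two distinct edges meet only in common endpoints.  The
   parametrization of each arc may run in either direction. *)
definition plane_drawing ::
  "'a simple_graph \<Rightarrow> ('a \<Rightarrow> complex) \<Rightarrow> ('a set \<Rightarrow> real \<Rightarrow> complex) \<Rightarrow> bool" where
  "plane_drawing \<Gamma> f \<gamma> \<longleftrightarrow>
     (case \<Gamma> of (V, E) \<Rightarrow>
        inj_on f V \<and>
        (\<forall>e\<in>E. arc (\<gamma> e) \<and> {pathstart (\<gamma> e), pathfinish (\<gamma> e)} = f ` e \<and>
                path_image (\<gamma> e) \<inter> f ` V = f ` e) \<and>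
        (\<forall>e\<in>E. \<forall>e'\<in>E. e \<noteq> e' \<longrightarrow>
                path_image (\<gamma> e) \<inter> path_image (\<gamma> e') \<subseteq> f ` e \<inter> f ` e'))"

definition planar :: "'a simple_graph \<Rightarrow> bool" where
  "planar \<Gamma> \<longleftrightarrow> (\<exists>f \<gamma>. plane_drawing \<Gamma> f \<gamma>)"

(* The dihedral group of order 2 * n, for n > 0.  The pair (a, s) stands for r^a, followed by a factor f
   iff s holds, where r is the rotation of order n, f is a reflection, and f r = r^(-1) f. *)
definition dihedral_group :: "nat \<Rightarrow> (int \<times> bool) monoid" where
  "dihedral_group n =
     \<lparr>carrier = carrier (integer_mod_group n) \<times> UNIV,
      monoid.mult = (\<lambda>(a, s) (b, t). ((if s then a - b else a + b) mod int n, s \<noteq> t)),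
      one = (0, False)\<rparr>"

(* The group {1, -1, i, -i, j, -j, k, -k} of Hamilton quaternions; (a, b, c, d) stands for
   a + b i + c j + d k. *)
definition quaternion_group :: "(int \<times> int \<times> int \<times> int) monoid" where
  "quaternion_group =
     \<lparr>carrier = {(1, 0, 0, 0), (-1, 0, 0, 0), (0, 1, 0, 0), (0, -1, 0, 0),
                 (0, 0, 1, 0), (0, 0, -1, 0), (0, 0, 0, 1), (0, 0, 0, -1)},
      monoid.mult = (\<lambda>(a, b, c, d) (a', b', c', d').
        (a * a' - b * b' - c * c' - d * d',
         a * b' + b * a' + c * d' - d * c',
         a * c' - b * d' + c * a' + d * b',
         a * d' + b * c' - c * b' + d * a')),
      one = (1, 0, 0, 0)\<rparr>"

end

(* Nonplanarity of K_5 and K_{3,3} comes from one fact about theta curves: if a connected set avoids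
   three arcs with common ends and accumulates at interior points of two of them, then it and the third
   arc lie on different sides of the Jordan curve formed by these two.

   Let d be the least size of a generating set. If d > 2 and a, b, c are three of d generators, then
   a, b, ab, c, abc form a K_5. If d = 2 and {a, b} generates, then {a, a^-1, b} and
   {ab, a^-1 b, ba, b^-1 a^-1} are completely joined, so the second set has at most two elements when
   a^2 is not 1. Moreover {a^2, a^3, b a^j} generates, which forces a^2 or a^3 to be joined to b a^j, as
   a and a^-1 are; so a has order at most 4. The resulting relations b^2 = a^k, b a = a^e b determine
   the group. If d < 2, the group is cyclic, and the question is one about divisibility.

   Conversely, the groups of order 4 and 8 embed their graph in an octahedron, Sym(3) in K_5 minus an
   edge, and in the cyclic groups every edge has exactly one end among at most two hubs. *)
theory Submission
  imports Defs "HOL-Analysis.Jordan_Curve" "HOL-Algebra.Multiplicative_Group"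
begin

section \<open>Theta curves\<close>

text \<open>Minimal generating sets of every size contribute edges. Nonplanarity needs only some
  edges, so a few explicit sets do; planarity needs a bound on all of them, and it comes from
  redundancy: no element of a minimal generating set lies in the subgroup generated by the others.
  The fact about theta curves asks for accumulation points because a drawing does not tell which of
  the three arcs runs between the other two, and the conclusion is the same in all three positions.
  It is applied to edges from which ends have been removed: such a set avoids the theta curve but
  accumulates on it. The five noncyclic groups are identified without presentations. For words
  \<open>a^i b^j\<close> both the product and the test for equality are formulas in three numbers
  \<open>m\<close>, \<open>k\<close>, \<open>e\<close>, so equal numbers and the right order give an
  isomorphism.\<close>

lemma arc_subset_closure_endless:
  fixes g :: "real \<Rightarrow> 'a::t2_space"
  assumes "arc g"
  shows "path_image g \<subseteq> closure (path_image g - {pathstart g, pathfinish g})"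
proof -
  have "g ` closure {0<..<1} \<subseteq> closure (g ` {0<..<1})"
    using assms by (intro image_closure_subset) (auto simp: arc_def path_def closure_subset)
  then show ?thesis
    by (simp add: simple_path_endless[OF arc_imp_simple_path[OF assms]]) (simp add: path_image_def)
qed

text \<open>The facts below distinguish the roles of the three arcs; the remaining cases are reached
  by interpreting the locale again with the arcs permuted.\<close>

locale theta_curve =
  fixes c1 c2 c3 :: "real \<Rightarrow> complex" and a b :: complex
  assumes arcs: "arc c1" "arc c2" "arc c3"
    and starts: "pathstart c1 = a" "pathstart c2 = a" "pathstart c3 = a"
    and finishes: "pathfinish c1 = b" "pathfinish c2 = b" "pathfinish c3 = b"
    and meets: "path_image c1 \<inter> path_image c2 = {a, b}"
      "path_image c1 \<inter> path_image c3 = {a, b}"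
      "path_image c2 \<inter> path_image c3 = {a, b}"
begin

lemma rotate: "theta_curve c2 c3 c1 a b"
  using arcs starts finishes meets by unfold_locales auto

lemma swap: "theta_curve c2 c1 c3 a b"
  using arcs starts finishes meets by unfold_locales auto

lemma ends_distinct: "a \<noteq> b"
  using arc_distinct_ends[OF arcs(1)] starts finishes by auto

text \<open>The Jordan curve theorem for the simple loop \<open>c1 +++ reversepath c2\<close>; the
  last fact adds the frontier to the inside.\<close>

lemma Jordan:
  shows "inside (path_image c1 \<union> path_image c2) \<noteq> {}"
    and "open (inside (path_image c1 \<union> path_image c2))"
    and "connected (inside (path_image c1 \<union> path_image c2))"
    and "open (outside (path_image c1 \<union> path_image c2))"
    and "connected (outside (path_image c1 \<union> path_image c2))"
    and "inside (path_image c1 \<union> path_image c2) \<inter> outside (path_image c1 \<union> path_image c2) = {}"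
    and "inside (path_image c1 \<union> path_image c2) \<union> outside (path_image c1 \<union> path_image c2)
          = - (path_image c1 \<union> path_image c2)"
    and "closure (inside (path_image c1 \<union> path_image c2))
          = inside (path_image c1 \<union> path_image c2) \<union> (path_image c1 \<union> path_image c2)"
proof -
  have eq: "path_image (c1 +++ reversepath c2) = path_image c1 \<union> path_image c2"
    using starts finishes by (simp add: path_image_join)
  have sp: "simple_path (c1 +++ reversepath c2)"
    using arcs starts finishes meets by (simp add: simple_path_join_loop_eq arc_reversepath)
  have loop: "pathfinish (c1 +++ reversepath c2) = pathstart (c1 +++ reversepath c2)"
    using starts by simp
  note J = Jordan_inside_outside[OF sp loop, unfolded eq]
  show "inside (path_image c1 \<union> path_image c2) \<noteq> {}"
    "open (inside (path_image c1 \<union> path_image c2))"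
    "connected (inside (path_image c1 \<union> path_image c2))"
    "open (outside (path_image c1 \<union> path_image c2))"
    "connected (outside (path_image c1 \<union> path_image c2))"
    "inside (path_image c1 \<union> path_image c2) \<inter> outside (path_image c1 \<union> path_image c2) = {}"
    "inside (path_image c1 \<union> path_image c2) \<union> outside (path_image c1 \<union> path_image c2)
          = - (path_image c1 \<union> path_image c2)"
    using J by blast+
  show "closure (inside (path_image c1 \<union> path_image c2))
          = inside (path_image c1 \<union> path_image c2) \<union> (path_image c1 \<union> path_image c2)"
    using J by (simp add: closure_Un_frontier)
qed

lemma endless:
  shows "connected (path_image c3 - {a, b})" and "path_image c3 - {a, b} \<noteq> {}"
  using connected_simple_path_endless[of c3] nonempty_simple_path_endless[of c3] arcs(3) starts(3) finishes(3)
  by (auto simp: arc_imp_simple_path)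

lemma connected_inside_or_outside:
  assumes "connected S" "S \<inter> (path_image c1 \<union> path_image c2) = {}"
  shows "S \<subseteq> inside (path_image c1 \<union> path_image c2) \<or> S \<subseteq> outside (path_image c1 \<union> path_image c2)"
proof -
  have "S \<inter> inside (path_image c1 \<union> path_image c2) = {} \<or> S \<inter> outside (path_image c1 \<union> path_image c2) = {}"
    using connectedD[OF assms(1) Jordan(2,4)] Jordan(6,7) assms(2) by blast
  then show ?thesis using Jordan(7) assms(2) by blast
qed

text \<open>If the two insides met, the first one, being connected and missing \<open>c1\<close> and
  \<open>c3\<close>, would lie within the second. Its closure contains \<open>c2\<close>, which
  avoids the second inside and would have to run along \<open>c1\<close> and
  \<open>c3\<close>.\<close>

lemma inside_not_contained:
  assumes "path_image c3 \<inter> inside (path_image c1 \<union> path_image c2) = {}"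
    and "path_image c2 \<inter> inside (path_image c1 \<union> path_image c3) = {}"
  shows "inside (path_image c1 \<union> path_image c2) \<inter> inside (path_image c1 \<union> path_image c3) = {}"
proof (rule ccontr)
  interpret T: theta_curve c1 c3 c2 a b
    using arcs starts finishes meets by unfold_locales auto
  assume "\<not> ?thesis"
  moreover have "inside (path_image c1 \<union> path_image c2) \<inter> (path_image c1 \<union> path_image c3) = {}"
    using assms(1) Jordan(7) by blast
  ultimately have "inside (path_image c1 \<union> path_image c2) \<subseteq> inside (path_image c1 \<union> path_image c3)"
    using T.connected_inside_or_outside[OF Jordan(3)] T.Jordan(6) by blast
  then have "closure (inside (path_image c1 \<union> path_image c2)) \<subseteq> closure (inside (path_image c1 \<union> path_image c3))"
    by (rule closure_mono)
  then have "path_image c2 \<subseteq> path_image c1 \<union> path_image c3"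
    using assms(2) unfolding Jordan(8) T.Jordan(8) by blast
  then have "path_image c2 - {a, b} = {}" using meets by blast
  then show False using T.endless(2) by simp
qed

text \<open>If each arc avoided the inside of the other two, Janiszewski's theorem would connect a point
  inside the first two arcs to infinity.\<close>

lemma one_arc_inside:
  "path_image c3 \<inter> inside (path_image c1 \<union> path_image c2) \<noteq> {} \<or>
   path_image c1 \<inter> inside (path_image c2 \<union> path_image c3) \<noteq> {} \<or>
   path_image c2 \<inter> inside (path_image c1 \<union> path_image c3) \<noteq> {}"
proof (rule ccontr)
  let ?p = path_image
  assume "\<not> ?thesis"
  then have no: "?p c3 \<inter> inside (?p c1 \<union> ?p c2) = {}" "?p c1 \<inter> inside (?p c2 \<union> ?p c3) = {}"
    "?p c2 \<inter> inside (?p c1 \<union> ?p c3) = {}" by auto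
  interpret A: theta_curve c1 c3 c2 a b
    using arcs starts finishes meets by unfold_locales auto
  interpret B: theta_curve c2 c3 c1 a b by (rule rotate)
  interpret C: theta_curve c2 c1 c3 a b by (rule swap)
  obtain x where x: "x \<in> inside (?p c1 \<union> ?p c2)" using Jordan(1) by blast
  have comp: "compact (?p c1)" "compact (?p c2)" "compact (?p c3)"
    using arcs by (auto simp: compact_arc_image)
  \<comment> \<open>A point outside the whole theta curve is outside each of its three cycles; it
    stands for infinity.\<close>
  then have "outside (?p c1 \<union> ?p c2 \<union> ?p c3) \<noteq> {}"
    by (intro outside_bounded_nonempty) (auto simp: compact_imp_bounded)
  then obtain w where "w \<in> outside (?p c1 \<union> ?p c2 \<union> ?p c3)" by blast
  then have w: "w \<in> outside (?p c1 \<union> ?p c2)" "w \<in> outside (?p c1 \<union> ?p c3)" "w \<in> outside (?p c2 \<union> ?p c3)"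
    using outside_mono[of _ "?p c1 \<union> ?p c2 \<union> ?p c3"] by blast+
  have x': "x \<notin> ?p c1" "x \<notin> ?p c2" "x \<notin> ?p c3"
    using x no(1) Jordan(7) by blast+
  have "x \<notin> inside (?p c1 \<union> ?p c3)"
    using inside_not_contained x no by blast
  then have "x \<in> outside (?p c1 \<union> ?p c3)" using A.Jordan(7) x' by blast
  then have 1: "connected_component (- (?p c1 \<union> ?p c3)) x w"
    unfolding connected_component_def
    using w(2) A.Jordan(5,7) by blast
  have "x \<notin> inside (?p c2 \<union> ?p c3)"
    using C.inside_not_contained x no by (auto simp: Un_commute)
  then have "x \<in> outside (?p c2 \<union> ?p c3)" using B.Jordan(7) x' by blast
  then have 2: "connected_component (- (?p c2 \<union> ?p c3)) x w"
    unfolding connected_component_def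
    using w(3) B.Jordan(5,7) by blast
  \<comment> \<open>Janiszewski's theorem asks for a connected intersection of the two closed sets;
    here it is the arc \<open>c3\<close>.\<close>
  have "(?p c1 \<union> ?p c3) \<inter> (?p c2 \<union> ?p c3) = ?p c3"
    using meets starts finishes pathstart_in_path_image[of c3] pathfinish_in_path_image[of c3] by auto
  then have "connected ((?p c1 \<union> ?p c3) \<inter> (?p c2 \<union> ?p c3))"
    using arcs by (simp add: connected_arc_image)
  then have "connected_component (- ((?p c1 \<union> ?p c3) \<union> (?p c2 \<union> ?p c3))) x w"
    using comp by (intro Janiszewski[OF _ _ _ 1 2]) (auto intro: compact_imp_closed)
  then have "connected_component (- (?p c1 \<union> ?p c2)) x w"
    by (rule connected_component_of_subset) auto
  then have "w \<in> inside (?p c1 \<union> ?p c2)"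
    using x inside_same_component by blast
  then show False using w(1) Jordan(6) by blast
qed

lemma split:
  assumes "path_image c3 \<inter> inside (path_image c1 \<union> path_image c2) \<noteq> {}"
  shows "inside (path_image c1 \<union> path_image c3) \<inter> inside (path_image c2 \<union> path_image c3) = {}"
    and "inside (path_image c1 \<union> path_image c3) \<union> inside (path_image c2 \<union> path_image c3) \<union>
           (path_image c3 - {a, b}) = inside (path_image c1 \<union> path_image c2)"
  using split_inside_simple_closed_curve[of c1 a b c2 c3] assms arcs starts finishes meets ends_distinct
  by (auto simp: arc_imp_simple_path)

text \<open>\<open>c3\<close> cuts the inside of \<open>c1\<close> and \<open>c2\<close> in two, and
  the closure of the half between \<open>c1\<close> and \<open>c3\<close> meets \<open>c2\<close>
  only in the ends.\<close>

lemma not_touching_third: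
  assumes "S \<subseteq> inside (path_image c1 \<union> path_image c3)"
    and "path_image c3 \<inter> inside (path_image c1 \<union> path_image c2) \<noteq> {}"
  shows "closure S \<inter> (path_image c2 - {a, b}) = {}"
proof -
  interpret A: theta_curve c1 c3 c2 a b
    using arcs starts finishes meets by unfold_locales auto
  have "closure S \<subseteq> inside (path_image c1 \<union> path_image c3) \<union> (path_image c1 \<union> path_image c3)"
    using closure_mono[OF assms(1)] A.Jordan(8) by simp
  moreover have "inside (path_image c1 \<union> path_image c3) \<inter> path_image c2 = {}"
    using split(2)[OF assms(2)] Jordan(7) by blast
  ultimately show ?thesis using meets by blast
qed

text \<open>Here \<open>c1\<close> is the middle arc, a cut through the inside of the outer cycle of
  \<open>c2\<close> and \<open>c3\<close>. Touching the interior of \<open>c1\<close>, which lies in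
  that open region, forces \<open>S\<close> into one of the two halves; from the half between
  \<open>c1\<close> and \<open>c3\<close> the arc \<open>c2\<close> is out of reach.\<close>

lemma separated_by_middle:
  assumes S: "connected S" "S \<inter> (path_image c1 \<union> path_image c2 \<union> path_image c3) = {}"
    and touch: "closure S \<inter> (path_image c1 - {a, b}) \<noteq> {}" "closure S \<inter> (path_image c2 - {a, b}) \<noteq> {}"
    and mid: "path_image c1 \<inter> inside (path_image c2 \<union> path_image c3) \<noteq> {}"
  shows "S \<subseteq> inside (path_image c1 \<union> path_image c2)"
    and "path_image c3 \<inter> inside (path_image c1 \<union> path_image c2) = {}"
proof -
  let ?p = path_image
  interpret B: theta_curve c2 c3 c1 a b by (rule rotate)
  have sp: "inside (?p c1 \<union> ?p c2) \<union> inside (?p c1 \<union> ?p c3) \<union> (?p c1 - {a, b}) = inside (?p c2 \<union> ?p c3)"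
    using B.split(2)[OF mid] by (simp add: Un_commute)
  have dj: "inside (?p c1 \<union> ?p c2) \<inter> inside (?p c1 \<union> ?p c3) = {}"
    using B.split(1)[OF mid] by (simp add: Un_commute)
  show 3: "?p c3 \<inter> inside (?p c1 \<union> ?p c2) = {}"
    using sp B.Jordan(7) by blast
  have "?p c1 - {a, b} \<subseteq> inside (?p c2 \<union> ?p c3)" using sp by blast
  then have "closure S \<inter> inside (?p c2 \<union> ?p c3) \<noteq> {}" using touch by blast
  then have "S \<inter> inside (?p c2 \<union> ?p c3) \<noteq> {}"
    using open_Int_closure_eq_empty[OF B.Jordan(2)] by blast
  then have "S \<inter> inside (?p c1 \<union> ?p c2) \<noteq> {} \<or> S \<inter> inside (?p c1 \<union> ?p c3) \<noteq> {}"
    using sp S(2) by blast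
  moreover have "S \<inter> inside (?p c1 \<union> ?p c3) = {}"
  proof (rule ccontr)
    interpret A: theta_curve c1 c3 c2 a b
      using arcs starts finishes meets by unfold_locales auto
    assume "S \<inter> inside (?p c1 \<union> ?p c3) \<noteq> {}"
    then have "S \<subseteq> inside (?p c1 \<union> ?p c3)"
      using A.connected_inside_or_outside[OF S(1)] S(2) A.Jordan(6) by blast
    then have "closure S \<subseteq> inside (?p c1 \<union> ?p c3) \<union> (?p c1 \<union> ?p c3)"
      using closure_mono A.Jordan(8) by metis
    moreover have "inside (?p c1 \<union> ?p c3) \<inter> ?p c2 = {}"
      using sp B.Jordan(7) by blast
    ultimately show False using touch(2) meets by blast
  qed
  ultimately show "S \<subseteq> inside (?p c1 \<union> ?p c2)"
    using connected_inside_or_outside[OF S(1)] S(2) Jordan(6) by blast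
qed

text \<open>If \<open>c3\<close> is the middle arc, each half inside the cycle of \<open>c1\<close>
  and \<open>c2\<close> borders on only one of these arcs, so a set touching both stays outside.
  Otherwise \<open>c1\<close> or \<open>c2\<close> is in the middle, and \<open>S\<close> lies
  between the two while \<open>c3\<close> does not.\<close>

proposition separated:
  assumes S: "connected S" "S \<inter> (path_image c1 \<union> path_image c2 \<union> path_image c3) = {}"
    and touch: "closure S \<inter> (path_image c1 - {a, b}) \<noteq> {}" "closure S \<inter> (path_image c2 - {a, b}) \<noteq> {}"
  shows "S \<subseteq> inside (path_image c1 \<union> path_image c2) \<longleftrightarrow>
         \<not> path_image c3 - {a, b} \<subseteq> inside (path_image c1 \<union> path_image c2)"
proof -
  let ?p = path_image
  have ne: "S \<noteq> {}" using touch by auto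
  note S12 = connected_inside_or_outside[OF S(1)]
  consider "?p c3 \<inter> inside (?p c1 \<union> ?p c2) \<noteq> {}" | "?p c1 \<inter> inside (?p c2 \<union> ?p c3) \<noteq> {}"
    | "?p c2 \<inter> inside (?p c1 \<union> ?p c3) \<noteq> {}"
    using one_arc_inside by blast
  then show ?thesis
  proof cases
    case 1
    interpret A: theta_curve c1 c3 c2 a b
      using arcs starts finishes meets by unfold_locales auto
    interpret B: theta_curve c2 c1 c3 a b by (rule swap)
    interpret C: theta_curve c2 c3 c1 a b by (rule rotate)
    have "?p c3 - {a, b} \<subseteq> inside (?p c1 \<union> ?p c2)" using split(2)[OF 1] by blast
    moreover have False if "S \<subseteq> inside (?p c1 \<union> ?p c2)"
    proof -
      have "S \<subseteq> inside (?p c1 \<union> ?p c3) \<or> S \<subseteq> inside (?p c2 \<union> ?p c3)"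
        using that split(2)[OF 1] S(2) A.connected_inside_or_outside[OF S(1)]
          C.connected_inside_or_outside[OF S(1)] A.Jordan(6) C.Jordan(6) ne by blast
      then show False
        using not_touching_third[of S] B.not_touching_third[of S] 1 touch by (auto simp: Un_commute)
    qed
    ultimately show ?thesis by blast
  next
    case 2
    show ?thesis using separated_by_middle[OF S touch 2] endless(2) by blast
  next
    case 3
    interpret B: theta_curve c2 c1 c3 a b by (rule swap)
    show ?thesis
      using B.separated_by_middle[OF S(1) _ touch(2,1) 3] S(2) endless(2)
      by (auto simp: Un_commute Un_left_commute Int_Un_distrib)
  qed
qed

end


section \<open>Drawings of K_{3,3} and K_5\<close>

lemma Int_Diff_left: "(A - B) \<inter> C = (A \<inter> C) - B"
  by blast

locale planar_graph =
  fixes V :: "'v set" and E :: "'v set set" and f :: "'v \<Rightarrow> complex" and \<gamma> :: "'v set \<Rightarrow> real \<Rightarrow> complex"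
  assumes drawing: "plane_drawing (V, E) f \<gamma>"
begin

definition curve :: "'v \<Rightarrow> 'v \<Rightarrow> complex set" where
  "curve x y = path_image (\<gamma> {x, y})"

text \<open>The locale does not assume that the members of \<open>E\<close> are two-element subsets
  of \<open>V\<close>, so each use of an edge carries this along.\<close>

definition joined :: "'v \<Rightarrow> 'v \<Rightarrow> bool" where
  "joined x y \<longleftrightarrow> {x, y} \<in> E \<and> x \<noteq> y \<and> x \<in> V \<and> y \<in> V"

lemma curve_commute: "curve x y = curve y x"
  by (simp add: curve_def insert_commute)

lemma joined_commute: "joined x y \<Longrightarrow> joined y x"
  by (auto simp: joined_def insert_commute)

lemma f_eq: "x \<in> V \<Longrightarrow> y \<in> V \<Longrightarrow> f x = f y \<longleftrightarrow> x = y"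
  using drawing by (auto simp: plane_drawing_def inj_on_def)

text \<open>The drawing leaves the direction of each arc open; reversing the arc if necessary makes
  it start at \<open>f x\<close>.\<close>

lemma curve_arc:
  assumes "joined x y"
  shows "\<exists>g. arc g \<and> pathstart g = f x \<and> pathfinish g = f y \<and> path_image g = curve x y"
proof -
  have "arc (\<gamma> {x, y})" "{pathstart (\<gamma> {x, y}), pathfinish (\<gamma> {x, y})} = {f x, f y}"
    using drawing assms by (force simp: plane_drawing_def joined_def)+
  then show ?thesis
    unfolding curve_def doubleton_eq_iff
    by (metis arc_reversepath path_image_reversepath pathfinish_reversepath pathstart_reversepath)
qed

lemma curve_ends: "joined x y \<Longrightarrow> f x \<in> curve x y \<and> f y \<in> curve x y"
proof -
  assume "joined x y"
  then obtain g where "pathstart g = f x" "pathfinish g = f y" "path_image g = curve x y"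
    using curve_arc by blast
  then show ?thesis
    using pathfinish_in_path_image[of g] pathstart_in_path_image[of g] by simp
qed

lemma curve_meets:
  assumes "joined x y" "joined u v" "{x, y} \<noteq> {u, v}"
  shows "curve x y \<inter> curve u v = f ` ({x, y} \<inter> {u, v})"
proof
  have I: "path_image (\<gamma> e) \<inter> path_image (\<gamma> e') \<subseteq> f ` e \<inter> f ` e'"
    if "e \<in> E" "e' \<in> E" "e \<noteq> e'" for e e'
    using drawing that by (simp add: plane_drawing_def)
  have "curve x y \<inter> curve u v \<subseteq> f ` {x, y} \<inter> f ` {u, v}"
    unfolding curve_def by (rule I) (use assms in \<open>simp_all add: joined_def\<close>)
  also have "\<dots> = f ` ({x, y} \<inter> {u, v})"
    using drawing assms inj_on_image_Int[of f V "{x, y}" "{u, v}"]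
    by (simp add: plane_drawing_def joined_def)
  finally show "curve x y \<inter> curve u v \<subseteq> f ` ({x, y} \<inter> {u, v})" .
  show "f ` ({x, y} \<inter> {u, v}) \<subseteq> curve x y \<inter> curve u v"
    using curve_ends[OF assms(1)] curve_ends[OF assms(2)] by (intro subsetI IntI) auto
qed

lemma curve_disjoint:
  assumes "joined x y" "joined u v" "x \<noteq> u" "x \<noteq> v" "y \<noteq> u" "y \<noteq> v"
  shows "curve x y \<inter> curve u v = {}"
proof -
  have "{x, y} \<inter> {u, v} = {}" "{x, y} \<noteq> {u, v}" using assms by auto
  then show ?thesis using curve_meets[OF assms(1,2)] by simp
qed

text \<open>All four orders are listed because \<open>curve x y\<close> and \<open>curve y x\<close>
  are different terms for the simplifier.\<close>

lemma curve_common_end: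
  assumes "joined x y" "joined x z" "y \<noteq> z"
  shows "curve x y \<inter> curve x z = {f x}" "curve x y \<inter> curve z x = {f x}"
    "curve y x \<inter> curve x z = {f x}" "curve y x \<inter> curve z x = {f x}"
proof -
  have eq: "{x, y} \<inter> {x, z} = {x}" and ne: "{x, y} \<noteq> {x, z}"
    using assms by (auto simp: joined_def)
  show "curve x y \<inter> curve x z = {f x}"
    using curve_meets[OF assms(1,2) ne] unfolding eq by simp
  then show "curve x y \<inter> curve z x = {f x}" "curve y x \<inter> curve x z = {f x}"
    "curve y x \<inter> curve z x = {f x}"
    by (simp_all add: curve_commute)
qed

lemma curve_endless:
  assumes "joined x y"
  shows "connected (curve x y - {f x, f y})" "curve x y \<subseteq> closure (curve x y - {f x, f y})"
proof -
  obtain g where "arc g" "pathstart g = f x" "pathfinish g = f y" "path_image g = curve x y"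
    using curve_arc[OF assms] by auto
  then show "connected (curve x y - {f x, f y})" "curve x y \<subseteq> closure (curve x y - {f x, f y})"
    using connected_simple_path_endless[of g] arc_subset_closure_endless[of g]
    by (auto simp: arc_imp_simple_path)
qed

lemma curve_half_open:
  assumes "joined x y"
  shows "connected (curve x y - {f y})" "curve x y \<subseteq> closure (curve x y - {f y})"
proof -
  have "curve x y - {f x, f y} \<subseteq> curve x y - {f y}" by auto
  then show "curve x y \<subseteq> closure (curve x y - {f y})"
    by (rule order.trans[OF curve_endless(2)[OF assms] closure_mono])
  show "connected (curve x y - {f y})"
    by (rule connected_intermediate_closure[OF curve_endless(1)[OF assms]])
      (use curve_endless(2)[OF assms] in blast)+
qed

lemma curve_join:
  assumes "joined x y" "joined y z" "x \<noteq> z"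
  shows "\<exists>g. arc g \<and> pathstart g = f x \<and> pathfinish g = f z \<and> path_image g = curve x y \<union> curve y z"
proof -
  obtain g h where g: "arc g" "pathstart g = f x" "pathfinish g = f y" "path_image g = curve x y"
    and h: "arc h" "pathstart h = f y" "pathfinish h = f z" "path_image h = curve y z"
    using curve_arc assms by meson
  have eq: "{x, y} \<inter> {y, z} = {y}" and ne: "{x, y} \<noteq> {y, z}"
    using assms by (auto simp: joined_def)
  have "curve x y \<inter> curve y z = {f y}"
    using curve_meets[OF assms(1,2) ne] unfolding eq by simp
  then have "arc (g +++ h)"
    using g h by (intro arc_join) auto
  then show ?thesis
    using g h by (intro exI[of _ "g +++ h"]) (auto simp: path_image_join)
qed

text \<open>The far ends are removed so that the star misses every curve that meets these edges only
  at the vertices of \<open>B\<close>, yet still accumulates at those vertices.\<close>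

definition star :: "'v \<Rightarrow> 'v set \<Rightarrow> complex set" where
  "star v B = (\<Union>b\<in>B. curve v b - {f b})"

lemma star_connected:
  assumes "\<And>b. b \<in> B \<Longrightarrow> joined v b"
  shows "connected (star v B)"
  unfolding star_def
proof (rule connected_Union)
  show "\<And>S. S \<in> (\<lambda>b. curve v b - {f b}) ` B \<Longrightarrow> connected S"
    using curve_half_open(1) assms by blast
  have "f v \<in> curve v b - {f b}" if "b \<in> B" for b
    using assms[OF that] curve_ends[of v b] f_eq[of v b] by (simp add: joined_def)
  then show "\<Inter> ((\<lambda>b. curve v b - {f b}) ` B) \<noteq> {}" by blast
qed

lemma star_touches:
  assumes "joined v b" "b \<in> B"
  shows "f b \<in> closure (star v B)"
proof -
  have "curve v b - {f b} \<subseteq> star v B"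
    using assms(2) unfolding star_def by (rule UN_upper)
  then have "closure (curve v b - {f b}) \<subseteq> closure (star v B)"
    by (rule closure_mono)
  moreover have "f b \<in> closure (curve v b - {f b})"
    using curve_half_open(2)[OF assms(1)] curve_ends[OF assms(1)] by (simp add: subset_iff)
  ultimately show ?thesis by (rule subsetD)
qed

text \<open>The paths from \<open>a1\<close> to \<open>a2\<close> through \<open>b1\<close>,
  \<open>b2\<close>, \<open>b3\<close> form a theta curve, and the star of \<open>a3\<close> touches
  its arcs at the images of these three vertices. The first two contacts separate the star from the
  third arc; the third contact joins them.\<close>

theorem no_K33:
  assumes dist: "distinct [a1, a2, a3, b1, b2, b3]"
    and joined: "\<And>a b. a \<in> {a1, a2, a3} \<Longrightarrow> b \<in> {b1, b2, b3} \<Longrightarrow> joined a b"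
  shows False
proof -
  have j: "joined a1 b1" "joined a1 b2" "joined a1 b3" "joined b1 a2" "joined b2 a2" "joined b3 a2"
    "joined a3 b1" "joined a3 b2" "joined a3 b3"
    "joined b1 a1" "joined b2 a1" "joined b3 a1" "joined a2 b1" "joined a2 b2" "joined a2 b3"
    "joined b1 a3" "joined b2 a3" "joined b3 a3"
    using joined joined_commute by auto
  \<comment> \<open>The reversed list makes every inequality available in both orientations.\<close>
  have dist': "distinct [b3, b2, b1, a3, a2, a1]" using dist by auto
  have V: "a1 \<in> V" "a2 \<in> V" "a3 \<in> V" "b1 \<in> V" "b2 \<in> V" "b3 \<in> V"
    using j by (auto simp: joined_def)
  obtain c1 where c1: "arc c1" "pathstart c1 = f a1" "pathfinish c1 = f a2"
      "path_image c1 = curve a1 b1 \<union> curve b1 a2"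
    using curve_join[OF j(1) j(4)] dist by auto
  obtain c2 where c2: "arc c2" "pathstart c2 = f a1" "pathfinish c2 = f a2"
      "path_image c2 = curve a1 b2 \<union> curve b2 a2"
    using curve_join[OF j(2) j(5)] dist by auto
  obtain c3 where c3: "arc c3" "pathstart c3 = f a1" "pathfinish c3 = f a2"
      "path_image c3 = curve a1 b3 \<union> curve b3 a2"
    using curve_join[OF j(3) j(6)] dist by auto
  interpret theta_curve c1 c2 c3 "f a1" "f a2"
    using c1 c2 c3 dist dist' j by unfold_locales (simp_all add: Int_Un_distrib Int_Un_distrib2 curve_disjoint curve_common_end insert_commute)
  let ?S = "star a3 {b1, b2, b3}"
  have S: "connected ?S" using j by (intro star_connected) auto
  have clS: "f b1 \<in> closure ?S" "f b2 \<in> closure ?S" "f b3 \<in> closure ?S"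
    using j by (auto intro: star_touches)
  have dj: "?S \<inter> (path_image c1 \<union> path_image c2 \<union> path_image c3) = {}"
    using dist dist' j unfolding c1 c2 c3 star_def
    by (simp_all add: Int_Un_distrib Int_Un_distrib2 Int_Diff_left curve_disjoint curve_common_end)
  have on: "f b1 \<in> path_image c1 - {f a1, f a2}" "f b2 \<in> path_image c2 - {f a1, f a2}"
    "f b3 \<in> path_image c3 - {f a1, f a2}"
    using dist V curve_ends j unfolding c1 c2 c3 by (auto simp: f_eq)
  have sep: "?S \<subseteq> inside (path_image c1 \<union> path_image c2) \<longleftrightarrow>
         \<not> path_image c3 - {f a1, f a2} \<subseteq> inside (path_image c1 \<union> path_image c2)"
    using clS on by (intro separated S dj) blast+
  have "connected (insert (f b3) ?S)"
    by (rule connected_intermediate_closure[OF S]) (use clS closure_subset in auto)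
  then have con: "connected (insert (f b3) ?S \<union> (path_image c3 - {f a1, f a2}))"
    using endless(1) on by (intro connected_Un) auto
  have "(insert (f b3) ?S \<union> (path_image c3 - {f a1, f a2})) \<inter> (path_image c1 \<union> path_image c2) = {}"
    using dj meets on by blast
  from connected_inside_or_outside[OF con this]
  have "?S \<subseteq> inside (path_image c1 \<union> path_image c2) \<and> path_image c3 - {f a1, f a2} \<subseteq> inside (path_image c1 \<union> path_image c2)
    \<or> ?S \<subseteq> outside (path_image c1 \<union> path_image c2) \<and> path_image c3 - {f a1, f a2} \<subseteq> outside (path_image c1 \<union> path_image c2)"
    by (elim disjE) simp_all
  moreover have "?S \<noteq> {}" using clS by auto
  moreover note endless(2)
  ultimately show False using sep Jordan(6) by blast
qed

text \<open>The edges \<open>{v1, v2}\<close> and \<open>{v3, v4}\<close> are the diagonals of the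
  four-cycle \<open>v1\<close>, \<open>v3\<close>, \<open>v2\<close>, \<open>v4\<close>. Each
  completes it to a theta curve, and of the two diagonals and the star of \<open>v5\<close> any two
  lie on different sides of the cycle; but there are only two sides.\<close>

theorem no_K5:
  assumes dist: "distinct [v1, v2, v3, v4, v5]"
    and joined: "\<And>x y. x \<in> {v1, v2, v3, v4, v5} \<Longrightarrow> y \<in> {v1, v2, v3, v4, v5} \<Longrightarrow> x \<noteq> y \<Longrightarrow> joined x y"
  shows False
proof -
  have j: "joined v1 v2" "joined v1 v3" "joined v1 v4" "joined v2 v3" "joined v2 v4" "joined v3 v4"
    "joined v3 v1" "joined v4 v1" "joined v3 v2" "joined v4 v2"
    "joined v5 v1" "joined v5 v2" "joined v5 v3" "joined v5 v4" "joined v2 v1" "joined v4 v3"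
    "joined v1 v5" "joined v2 v5" "joined v3 v5" "joined v4 v5"
    using joined dist by auto
  have dist': "distinct [v5, v4, v3, v2, v1]" using dist by auto
  have V: "v1 \<in> V" "v2 \<in> V" "v3 \<in> V" "v4 \<in> V" "v5 \<in> V"
    using j by (auto simp: joined_def)
  obtain c1 where c1: "arc c1" "pathstart c1 = f v1" "pathfinish c1 = f v2"
      "path_image c1 = curve v1 v3 \<union> curve v3 v2"
    using curve_join[OF j(2) j(9)] dist by auto
  obtain c2 where c2: "arc c2" "pathstart c2 = f v1" "pathfinish c2 = f v2"
      "path_image c2 = curve v1 v4 \<union> curve v4 v2"
    using curve_join[OF j(3) j(10)] dist by auto
  obtain c3 where c3: "arc c3" "pathstart c3 = f v1" "pathfinish c3 = f v2" "path_image c3 = curve v1 v2"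
    using curve_arc[OF j(1)] by auto
  obtain d1 where d1: "arc d1" "pathstart d1 = f v3" "pathfinish d1 = f v4"
      "path_image d1 = curve v3 v1 \<union> curve v1 v4"
    using curve_join[OF j(7) j(3)] dist by auto
  obtain d2 where d2: "arc d2" "pathstart d2 = f v3" "pathfinish d2 = f v4"
      "path_image d2 = curve v3 v2 \<union> curve v2 v4"
    using curve_join[OF j(9) j(5)] dist by auto
  obtain d3 where d3: "arc d3" "pathstart d3 = f v3" "pathfinish d3 = f v4" "path_image d3 = curve v3 v4"
    using curve_arc[OF j(6)] by auto
  interpret C: theta_curve c1 c2 c3 "f v1" "f v2"
    using c1 c2 c3 dist dist' j by unfold_locales (simp_all add: Int_Un_distrib Int_Un_distrib2 curve_disjoint curve_common_end insert_commute)
  interpret D: theta_curve d1 d2 d3 "f v3" "f v4"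
    using d1 d2 d3 dist dist' j by unfold_locales (simp_all add: Int_Un_distrib Int_Un_distrib2 curve_disjoint curve_common_end insert_commute)
  let ?S = "star v5 {v1, v2, v3, v4}" and ?A = "curve v1 v2 - {f v1, f v2}" and ?B = "curve v3 v4 - {f v3, f v4}"
  let ?U = "inside (path_image c1 \<union> path_image c2)"
  have U: "?U = inside (path_image d1 \<union> path_image d2)"
    unfolding c1 c2 d1 d2 curve_commute[of v3 v1] curve_commute[of v4 v2]
    by (simp add: Un_ac)
  have S: "connected ?S" using j by (intro star_connected) auto
  have B: "connected ?B" by (rule curve_endless[OF j(6)])
  have clS: "f v1 \<in> closure ?S" "f v2 \<in> closure ?S" "f v3 \<in> closure ?S" "f v4 \<in> closure ?S"
    using j by (auto intro: star_touches)
  have clB: "f v3 \<in> closure ?B" "f v4 \<in> closure ?B"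
    using curve_endless[OF j(6)] curve_ends[OF j(6)] by auto
  have djC: "?S \<inter> (path_image c1 \<union> path_image c2 \<union> path_image c3) = {}"
    "?B \<inter> (path_image c1 \<union> path_image c2 \<union> path_image c3) = {}"
    "?S \<inter> (path_image d1 \<union> path_image d2 \<union> path_image d3) = {}"
    using dist dist' j unfolding c1 c2 c3 d1 d2 d3 star_def
    by (simp_all add: Int_Un_distrib Int_Un_distrib2 Int_Diff_left curve_disjoint curve_common_end)
  have on: "f v3 \<in> path_image c1 - {f v1, f v2}" "f v4 \<in> path_image c2 - {f v1, f v2}"
    "f v1 \<in> path_image d1 - {f v3, f v4}" "f v2 \<in> path_image d2 - {f v3, f v4}"
    using dist V curve_ends j unfolding c1 c2 d1 d2 by (auto simp: f_eq)
  have "?S \<subseteq> ?U \<longleftrightarrow> \<not> ?A \<subseteq> ?U"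
    using C.separated[OF S djC(1)] clS on unfolding c3 by blast
  moreover have "?B \<subseteq> ?U \<longleftrightarrow> \<not> ?A \<subseteq> ?U"
    using C.separated[OF B djC(2)] clB on unfolding c3 by blast
  moreover have "?S \<subseteq> ?U \<longleftrightarrow> \<not> ?B \<subseteq> ?U"
    using D.separated[OF S djC(3)] clS on unfolding d3 U by blast
  ultimately show False by blast
qed

end

section \<open>Drawings\<close>

definition adjacent :: "('a, 'b) monoid_scheme \<Rightarrow> 'a \<Rightarrow> 'a \<Rightarrow> bool" where
  "adjacent G x y \<longleftrightarrow> x \<in> carrier G \<and> y \<in> carrier G \<and> x \<noteq> y \<and>
     (\<exists>X. minimal_generating_set G X \<and> x \<in> X \<and> y \<in> X)"

lemma adjacent_commute: "adjacent G x y \<Longrightarrow> adjacent G y x"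
  by (auto simp: adjacent_def)

lemma independence_graph_adjacent:
  "independence_graph G = (carrier G, {{x, y} | x y. adjacent G x y})"
  by (simp add: independence_graph_def adjacent_def)

lemma planar_independence_graphE:
  assumes "planar (independence_graph G)"
  obtains f \<gamma> where "planar_graph (carrier G) {{x, y} | x y. adjacent G x y} f \<gamma>"
  using assms by (auto simp: planar_def independence_graph_adjacent planar_graph_def)

lemma planar_no_K33:
  assumes "planar (independence_graph G)" "distinct [a1, a2, a3]" "distinct [b1, b2, b3]"
    and "\<And>a b. a \<in> {a1, a2, a3} \<Longrightarrow> b \<in> {b1, b2, b3} \<Longrightarrow> adjacent G a b"
  shows False
proof -
  obtain f \<gamma> where "planar_graph (carrier G) {{x, y} | x y. adjacent G x y} f \<gamma>"
    using assms(1) by (rule planar_independence_graphE)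
  then interpret planar_graph "carrier G" "{{x, y} | x y. adjacent G x y}" f \<gamma> .
  \<comment> \<open>Adjacent elements differ, so completeness itself keeps the two sides
    apart.\<close>
  have "{a1, a2, a3} \<inter> {b1, b2, b3} = {}"
    using assms(4) unfolding disjoint_iff adjacent_def by blast
  then have dist: "distinct [a1, a2, a3, b1, b2, b3]"
    using assms(2,3) by auto
  show False
  proof (rule no_K33[OF dist])
    show "joined a b" if "a \<in> {a1, a2, a3}" "b \<in> {b1, b2, b3}" for a b
      using assms(4)[OF that] unfolding joined_def by (auto simp: adjacent_def)
  qed
qed

lemma planar_no_K5:
  assumes "planar (independence_graph G)"
    and "adjacent G v1 v2" "adjacent G v1 v3" "adjacent G v1 v4" "adjacent G v1 v5"
      "adjacent G v2 v3" "adjacent G v2 v4" "adjacent G v2 v5"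
      "adjacent G v3 v4" "adjacent G v3 v5" "adjacent G v4 v5"
  shows False
proof -
  obtain f \<gamma> where "planar_graph (carrier G) {{x, y} | x y. adjacent G x y} f \<gamma>"
    using assms(1) by (rule planar_independence_graphE)
  then interpret planar_graph "carrier G" "{{x, y} | x y. adjacent G x y}" f \<gamma> .
  have j: "joined x y" "joined y x" if "adjacent G x y" for x y
    using that adjacent_commute[OF that] unfolding joined_def by (auto simp: adjacent_def)
  have dist: "distinct [v1, v2, v3, v4, v5]"
    using assms(2-) by (simp add: adjacent_def)
  show False
  proof (rule no_K5[OF dist])
    show "joined x y" if "x \<in> {v1, v2, v3, v4, v5}" "y \<in> {v1, v2, v3, v4, v5}" "x \<noteq> y" for x y
      using that assms(2-) by (auto simp: j)
  qed
qed

text \<open>A drawing restricts along an embedding: each edge is drawn as the arc of its image under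
  \<open>h\<close>. Distinct edges get distinct arcs because \<open>h\<close> is injective on
  \<open>V\<close>.\<close>

lemma planar_embed:
  assumes "planar (V', E')" "inj_on h V" "h ` V \<subseteq> V'"
    and "\<And>e. e \<in> E \<Longrightarrow> e \<subseteq> V" "\<And>e. e \<in> E \<Longrightarrow> h ` e \<in> E'"
  shows "planar (V, E)"
proof -
  obtain f \<gamma> where "plane_drawing (V', E') f \<gamma>"
    using assms(1) by (auto simp: planar_def)
  then have inj: "inj_on f V'"
    and arcs: "\<And>e. e \<in> E' \<Longrightarrow> arc (\<gamma> e)" "\<And>e. e \<in> E' \<Longrightarrow> {pathstart (\<gamma> e), pathfinish (\<gamma> e)} = f ` e"
      "\<And>e. e \<in> E' \<Longrightarrow> path_image (\<gamma> e) \<inter> f ` V' = f ` e"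
    and meet: "\<And>e e'. e \<in> E' \<Longrightarrow> e' \<in> E' \<Longrightarrow> e \<noteq> e' \<Longrightarrow> path_image (\<gamma> e) \<inter> path_image (\<gamma> e') \<subseteq> f ` e \<inter> f ` e'"
    by (simp_all add: plane_drawing_def)
  have inj': "inj_on (f \<circ> h) V"
    using assms(2,3) inj by (meson comp_inj_on inj_on_subset)
  have img: "path_image (\<gamma> (h ` e)) \<inter> (f \<circ> h) ` V = (f \<circ> h) ` e" if e: "e \<in> E" for e
  proof -
    have "(f \<circ> h) ` V \<subseteq> f ` V'" "(f \<circ> h) ` e \<subseteq> (f \<circ> h) ` V"
      using assms(3) assms(4)[OF e] by auto
    moreover have "path_image (\<gamma> (h ` e)) \<inter> f ` V' = (f \<circ> h) ` e"
      using arcs(3)[OF assms(5)[OF e]] by (simp add: image_comp)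
    ultimately show ?thesis by blast
  qed
  have disj: "path_image (\<gamma> (h ` e)) \<inter> path_image (\<gamma> (h ` e')) \<subseteq> (f \<circ> h) ` e \<inter> (f \<circ> h) ` e'"
    if "e \<in> E" "e' \<in> E" "e \<noteq> e'" for e e'
  proof -
    have "h ` e \<noteq> h ` e'"
      using inj_on_image_eq_iff[OF assms(2) assms(4)[OF that(1)] assms(4)[OF that(2)]] that(3) by simp
    then show ?thesis
      using meet[OF assms(5)[OF that(1)] assms(5)[OF that(2)]] unfolding image_comp by simp
  qed
  have ends: "{pathstart (\<gamma> (h ` e)), pathfinish (\<gamma> (h ` e))} = (f \<circ> h) ` e" if "e \<in> E" for e
    using arcs(2)[OF assms(5)[OF that]] unfolding image_comp .
  have "plane_drawing (V, E) (f \<circ> h) (\<lambda>e. \<gamma> (h ` e))"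
    unfolding plane_drawing_def prod.case
  proof (intro conjI ballI impI)
    show "inj_on (f \<circ> h) V" by (rule inj')
    show "arc (\<gamma> (h ` e))" if "e \<in> E" for e using arcs(1)[OF assms(5)[OF that]] .
  qed (fact ends img disj)+
  then show ?thesis by (auto simp: planar_def)
qed

text \<open>A generating proper subset of the image would pull back to a generating proper subset of
  \<open>X\<close>.\<close>

lemma adjacent_iso:
  assumes "group G" "group H" "h \<in> iso G H" "adjacent G x y"
  shows "adjacent H (h x) (h y)"
proof -
  interpret group_hom G H h
    using assms by (simp add: group_hom_def group_hom_axioms_def iso_def)
  have bij: "bij_betw h (carrier G) (carrier H)" using assms(3) by (simp add: iso_def)
  then have inj: "inj_on h (carrier G)" and im: "h ` carrier G = carrier H"
    by (auto simp: bij_betw_def)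
  obtain X where X: "minimal_generating_set G X" "x \<in> X" "y \<in> X"
    and xy: "x \<in> carrier G" "y \<in> carrier G" "x \<noteq> y"
    using assms(4) by (auto simp: adjacent_def)
  have "generate H Y \<noteq> carrier H" if "Y \<subset> h ` X" for Y
  proof
    assume gen: "generate H Y = carrier H"
    have "Y \<subseteq> h ` X" using that by blast
    then obtain Z where Z: "Z \<subseteq> X" "Y = h ` Z" by (auto simp: subset_image_iff)
    then have ZX: "Z \<subset> X" using that by blast
    have sub: "Z \<subseteq> carrier G" using X(1) Z(1) by (auto simp: minimal_generating_set_def)
    have "h ` generate G Z = h ` carrier G"
      unfolding im using gen Z(2) generate_img[OF sub] by simp
    then have "generate G Z = carrier G"
      by (simp add: inj_on_image_eq_iff[OF inj] G.generate_incl[OF sub])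
    then show False using X(1) ZX by (simp add: minimal_generating_set_def)
  qed
  moreover have "h ` X \<subseteq> carrier H" "generate H (h ` X) = carrier H"
    using X(1) im generate_img[of X] by (auto simp: minimal_generating_set_def)
  ultimately have "minimal_generating_set H (h ` X)"
    by (simp add: minimal_generating_set_def)
  moreover have "h x \<noteq> h y" using inj xy by (auto dest: inj_onD)
  ultimately show ?thesis using X xy by (auto simp: adjacent_def)
qed

lemma planar_independence_graph_iso:
  assumes "group G" "group H" "G \<cong> H" "planar (independence_graph H)"
  shows "planar (independence_graph G)"
proof -
  obtain h where h: "h \<in> iso G H" using assms(3) by (auto simp: is_iso_def)
  then have bij: "bij_betw h (carrier G) (carrier H)" by (simp add: iso_def)
  show ?thesis
    unfolding independence_graph_adjacent[of G]
  proof (rule planar_embed[OF assms(4)[unfolded independence_graph_adjacent]])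
    show "inj_on h (carrier G)" "h ` carrier G \<subseteq> carrier H"
      using bij by (auto simp: bij_betw_def)
    show "e \<subseteq> carrier G" if "e \<in> {{x, y} | x y. adjacent G x y}" for e
      using that by (auto simp: adjacent_def)
    show "h ` e \<in> {{x, y} | x y. adjacent H x y}" if "e \<in> {{x, y} | x y. adjacent G x y}" for e
      using that adjacent_iso[OF assms(1,2) h] by auto
  qed
qed

text \<open>\<open>S\<close> may hold in one direction only, so that edge lists contain each edge
  once and a hub can always be named first.\<close>

lemma doubleton_graph_embed:
  fixes R :: "'a \<Rightarrow> 'a \<Rightarrow> bool" and S :: "'b \<Rightarrow> 'b \<Rightarrow> bool"
  assumes "planar (V', {{x, y} | x y. S x y})" "inj_on h V" "h ` V \<subseteq> V'"
    and "\<And>x y. R x y \<Longrightarrow> x \<in> V \<and> y \<in> V \<and> (S (h x) (h y) \<or> S (h y) (h x))"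
  shows "planar (V, {{x, y} | x y. R x y})"
proof (rule planar_embed[OF assms(1-3)])
  show "e \<subseteq> V" if "e \<in> {{x, y} | x y. R x y}" for e
    using that assms(4) by auto
  show "h ` e \<in> {{x, y} | x y. S x y}" if edge: "e \<in> {{x, y} | x y. R x y}" for e
  proof -
    obtain x y where e: "e = {x, y}" "R x y" using edge by blast
    then have "h ` e = {h x, h y}" "h ` e = {h y, h x}" by auto
    then show ?thesis using assms(4)[OF e(2)] by (metis (mono_tags, lifting) mem_Collect_eq)
  qed
qed

section \<open>Straight-line drawings, certified by signed areas of triangles\<close>

definition orientation :: "complex \<Rightarrow> complex \<Rightarrow> complex \<Rightarrow> real" where
  "orientation p q r = (Re q - Re p) * (Im r - Im p) - (Im q - Im p) * (Re r - Re p)"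

lemma orientation_on_segment:
  assumes "z \<in> closed_segment p q"
  shows "orientation p q z = 0"
proof -
  obtain u where u: "z = (1 - u) *\<^sub>R p + u *\<^sub>R q" using assms by (auto simp: closed_segment_def)
  show ?thesis unfolding u orientation_def by (simp add: algebra_simps)
qed

lemma orientation_convex_combination:
  "orientation p q ((1 - u) *\<^sub>R r + u *\<^sub>R s) = (1 - u) * orientation p q r + u * orientation p q s"
  by (simp add: orientation_def algebra_simps)

text \<open>\<open>orientation p q\<close> is affine in its last argument and vanishes on the line
  through \<open>p\<close> and \<open>q\<close>; values of one strict sign at \<open>r\<close> and
  \<open>s\<close> keep it from vanishing between them.\<close>

lemma segments_disjoint:
  assumes "orientation p q r * orientation p q s > 0"
  shows "closed_segment p q \<inter> closed_segment r s = {}"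
proof (rule ccontr)
  assume "\<not> ?thesis"
  then obtain z where z1: "z \<in> closed_segment p q" and z2: "z \<in> closed_segment r s" by blast
  obtain u where z: "z = (1 - u) *\<^sub>R r + u *\<^sub>R s" "0 \<le> u" "u \<le> 1"
    using z2 by (auto simp: closed_segment_def)
  have "(1 - u) * orientation p q r + u * orientation p q s = 0"
    using orientation_on_segment[OF z1] unfolding z(1) orientation_convex_combination .
  then have "orientation p q r * ((1 - u) * orientation p q r + u * orientation p q s) = 0" by simp
  then have "(1 - u) * (orientation p q r)\<^sup>2 + u * (orientation p q r * orientation p q s) = 0"
    by (simp add: algebra_simps power2_eq_square)
  moreover have "(1 - u) * (orientation p q r)\<^sup>2 \<ge> 0" using z by simp
  moreover have "u * (orientation p q r * orientation p q s) \<ge> 0" using z assms by simp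
  ultimately have "(1 - u) * (orientation p q r)\<^sup>2 = 0" "u * (orientation p q r * orientation p q s) = 0"
    by linarith+
  then show False using assms by auto
qed

text \<open>Along the segment from \<open>p\<close> to \<open>s\<close> the affine function
  \<open>orientation p q\<close> runs from zero to a nonzero value, so it vanishes only at
  \<open>p\<close>.\<close>

lemma segments_common_end:
  assumes "orientation p q s \<noteq> 0"
  shows "closed_segment p q \<inter> closed_segment p s = {p}"
proof -
  have "z = p" if z: "z \<in> closed_segment p q" "z \<in> closed_segment p s" for z
  proof -
    obtain u where u: "z = (1 - u) *\<^sub>R p + u *\<^sub>R s" using z(2) by (auto simp: closed_segment_def)
    have "(1 - u) * orientation p q p + u * orientation p q s = 0"
      using orientation_on_segment[OF z(1)] unfolding u orientation_convex_combination .
    moreover have "orientation p q p = 0" by (simp add: orientation_def)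
    ultimately have "u = 0" using assms by simp
    then show ?thesis using u by simp
  qed
  then show ?thesis by auto
qed

lemma straight_line_drawing:
  fixes f :: "'a \<Rightarrow> complex" and S :: "'a \<Rightarrow> 'a \<Rightarrow> bool"
  assumes inj: "inj_on f V"
    and edges: "\<And>x y. S x y \<Longrightarrow> x \<in> V \<and> y \<in> V \<and> x \<noteq> y"
    and vertex: "\<And>x y z. S x y \<Longrightarrow> z \<in> V \<Longrightarrow> z \<noteq> x \<Longrightarrow> z \<noteq> y \<Longrightarrow> f z \<notin> closed_segment (f x) (f y)"
    and adjacent_edges: "\<And>x y z. S x y \<or> S y x \<Longrightarrow> S x z \<or> S z x \<Longrightarrow> y \<noteq> z \<Longrightarrow>
          closed_segment (f x) (f y) \<inter> closed_segment (f x) (f z) \<subseteq> {f x}"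
    and disjoint_edges: "\<And>x y u v. S x y \<Longrightarrow> S u v \<Longrightarrow> {x, y} \<inter> {u, v} = {} \<Longrightarrow>
          closed_segment (f x) (f y) \<inter> closed_segment (f u) (f v) = {}"
  shows "planar (V, {{x, y} | x y. S x y})"
proof -
  let ?E = "{{x, y} | x y. S x y}"
  \<comment> \<open>Edges are unordered, but \<open>linepath\<close> needs a first and a last point:
    \<open>d\<close> fixes an order for which \<open>S\<close> holds.\<close>
  have "\<forall>e\<in>?E. \<exists>p. e = {fst p, snd p} \<and> S (fst p) (snd p)" by fastforce
  then obtain d where d: "\<And>e. e \<in> ?E \<Longrightarrow> e = {fst (d e), snd (d e)} \<and> S (fst (d e)) (snd (d e))"
    by (metis (no_types, lifting))
  define \<gamma> where "\<gamma> e = linepath (f (fst (d e))) (f (snd (d e)))" for e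
  have "plane_drawing (V, ?E) f \<gamma>"
    unfolding plane_drawing_def prod.case
  proof (intro conjI ballI impI)
    show "inj_on f V" by (rule inj)
  next
    fix e assume "e \<in> ?E"
    then obtain x y where e: "e = {x, y}" "S x y" "d e = (x, y)" using d[of e] by (metis prod.collapse)
    have xy: "x \<in> V" "y \<in> V" "x \<noteq> y" using edges[OF e(2)] by auto
    then have "f x \<noteq> f y" using inj by (auto dest: inj_onD)
    then show "arc (\<gamma> e)" by (simp add: \<gamma>_def e(3) arc_linepath)
    show "{pathstart (\<gamma> e), pathfinish (\<gamma> e)} = f ` e" by (simp add: \<gamma>_def e(3)) (simp add: e(1))
    have "path_image (\<gamma> e) = closed_segment (f x) (f y)" by (simp add: \<gamma>_def e(3))
    then show "path_image (\<gamma> e) \<inter> f ` V = f ` e"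
      using xy vertex[OF e(2)] by (auto simp: e(1))
  next
    fix e e' assume ee: "e \<in> ?E" "e' \<in> ?E" "e \<noteq> e'"
    obtain x y where e: "e = {x, y}" "S x y" "d e = (x, y)" using d[OF ee(1)] by (metis prod.collapse)
    obtain u v where e': "e' = {u, v}" "S u v" "d e' = (u, v)" using d[OF ee(2)] by (metis prod.collapse)
    have im: "path_image (\<gamma> e) = closed_segment (f x) (f y)" "path_image (\<gamma> e') = closed_segment (f u) (f v)"
      by (simp_all add: \<gamma>_def e(3) e'(3))
    have "closed_segment (f x) (f y) \<inter> closed_segment (f u) (f v) \<subseteq> f ` {x, y} \<inter> f ` {u, v}"
    proof (cases "{x, y} \<inter> {u, v} = {}")
      case True
      then show ?thesis using disjoint_edges[OF e(2) e'(2)] by simp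
    next
      case False
      then consider "x = u" "y \<noteq> v" | "x = v" "y \<noteq> u" | "y = u" "x \<noteq> v" | "y = v" "x \<noteq> u"
        using ee(3) unfolding e(1) e'(1) by auto
      then show ?thesis
      proof cases
        case 1
        then show ?thesis using adjacent_edges[of x y v] e(2) e'(2) by auto
      next
        case 2
        show ?thesis
          by (subst closed_segment_commute[of "f u"]) (use adjacent_edges[of x y u] 2 e(2) e'(2) in auto)
      next
        case 3
        show ?thesis
          by (subst closed_segment_commute[of "f x"]) (use adjacent_edges[of y x v] 3 e(2) e'(2) in auto)
      next
        case 4
        show ?thesis
          by (subst closed_segment_commute[of "f x"], subst closed_segment_commute[of "f u"])
            (use adjacent_edges[of y x u] 4 e(2) e'(2) in auto)
      qed
    qed
    then show "path_image (\<gamma> e) \<inter> path_image (\<gamma> e') \<subseteq> f ` e \<inter> f ` e'"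
      unfolding im by (simp only: e(1) e'(1))
  qed
  then show ?thesis by (auto simp: planar_def)
qed

text \<open>Integer coordinates allow the conditions on a drawing to be verified by
  evaluation.\<close>

definition int_orientation :: "int \<times> int \<Rightarrow> int \<times> int \<Rightarrow> int \<times> int \<Rightarrow> int" where
  "int_orientation p q r = (fst q - fst p) * (snd r - snd p) - (snd q - snd p) * (fst r - fst p)"

lemma orientation_of_int:
  "orientation (Complex (of_int (fst p)) (of_int (snd p))) (Complex (of_int (fst q)) (of_int (snd q)))
     (Complex (of_int (fst r)) (of_int (snd r))) = of_int (int_orientation p q r)"
  by (simp add: orientation_def int_orientation_def)

text \<open>Nonzero orientations keep vertices off the edges and prevent edges with a common end
  from overlapping; two disjoint edges are separated by the line through one of them.\<close>

definition straight_line_drawing_check :: "(int \<times> int) list \<Rightarrow> (nat \<times> nat) list \<Rightarrow> bool" where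
  "straight_line_drawing_check ps es \<longleftrightarrow> distinct ps \<and>
     list_all (\<lambda>(x, y). x < length ps \<and> y < length ps \<and> x \<noteq> y \<and>
       list_all (\<lambda>z. z = x \<or> z = y \<or> int_orientation (ps ! x) (ps ! y) (ps ! z) \<noteq> 0) [0..<length ps] \<and>
       list_all (\<lambda>(u, v). x = u \<or> x = v \<or> y = u \<or> y = v \<or>
         int_orientation (ps ! x) (ps ! y) (ps ! u) * int_orientation (ps ! x) (ps ! y) (ps ! v) > 0 \<or>
         int_orientation (ps ! u) (ps ! v) (ps ! x) * int_orientation (ps ! u) (ps ! v) (ps ! y) > 0) es) es"

lemma integer_straight_line_drawing:
  assumes check: "straight_line_drawing_check ps es"
  shows "planar ({..<length ps}, {{x, y} | x y. (x, y) \<in> set es})"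
proof -
  have "distinct ps"
    and position: "\<forall>(x, y)\<in>set es. x < length ps \<and> y < length ps \<and> x \<noteq> y \<and>
          (\<forall>z<length ps. z \<noteq> x \<longrightarrow> z \<noteq> y \<longrightarrow> int_orientation (ps ! x) (ps ! y) (ps ! z) \<noteq> 0)"
    and separate: "\<forall>(x, y)\<in>set es. \<forall>(u, v)\<in>set es. x \<noteq> u \<longrightarrow> x \<noteq> v \<longrightarrow> y \<noteq> u \<longrightarrow> y \<noteq> v \<longrightarrow>
          int_orientation (ps ! x) (ps ! y) (ps ! u) * int_orientation (ps ! x) (ps ! y) (ps ! v) > 0 \<or>
          int_orientation (ps ! u) (ps ! v) (ps ! x) * int_orientation (ps ! u) (ps ! v) (ps ! y) > 0"
    using check unfolding straight_line_drawing_check_def list_all_iff by fastforce+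
  define f where "f i = Complex (of_int (fst (ps ! i))) (of_int (snd (ps ! i)))" for i
  have f: "orientation (f x) (f y) (f z) = of_int (int_orientation (ps ! x) (ps ! y) (ps ! z))" for x y z
    unfolding f_def by (rule orientation_of_int)
  have edge: "x < length ps" "y < length ps" "x \<noteq> y" if "(x, y) \<in> set es" for x y
    using position that by auto
  have pos: "orientation (f x) (f y) (f z) \<noteq> 0"
    if "(x, y) \<in> set es" "z < length ps" "z \<noteq> x" "z \<noteq> y" for x y z
    using position that by (fastforce simp: f)
  have swap: "orientation p q r = - orientation q p r" for p q r
    by (simp add: orientation_def algebra_simps)
  show ?thesis
  proof (rule straight_line_drawing[where f = f])
    show "inj_on f {..<length ps}"
    proof (rule inj_onI)
      fix x y assume *: "x \<in> {..<length ps}" "y \<in> {..<length ps}" "f x = f y"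
      then have "ps ! x = ps ! y" by (simp add: f_def prod_eq_iff)
      then show "x = y" using * \<open>distinct ps\<close> by (simp add: nth_eq_iff_index_eq)
    qed
  next
    fix x y assume "(x, y) \<in> set es"
    then show "x \<in> {..<length ps} \<and> y \<in> {..<length ps} \<and> x \<noteq> y" using edge by simp
  next
    fix x y z assume *: "(x, y) \<in> set es" "z \<in> {..<length ps}" "z \<noteq> x" "z \<noteq> y"
    then have "orientation (f x) (f y) (f z) \<noteq> 0" by (intro pos) auto
    then show "f z \<notin> closed_segment (f x) (f y)" using orientation_on_segment by blast
  next
    fix x y z assume *: "(x, y) \<in> set es \<or> (y, x) \<in> set es" "(x, z) \<in> set es \<or> (z, x) \<in> set es" "y \<noteq> z"
    have z: "z < length ps" "z \<noteq> x" using *(2) edge[of x z] edge[of z x] by auto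
    have "orientation (f x) (f y) (f z) \<noteq> 0"
      using *(1)
    proof
      assume "(x, y) \<in> set es"
      then show ?thesis using pos z *(3) by auto
    next
      assume "(y, x) \<in> set es"
      then show ?thesis using pos[of y x z] z *(3) by (auto simp: swap[of "f x"])
    qed
    then show "closed_segment (f x) (f y) \<inter> closed_segment (f x) (f z) \<subseteq> {f x}"
      using segments_common_end by blast
  next
    fix x y u v assume *: "(x, y) \<in> set es" "(u, v) \<in> set es" "{x, y} \<inter> {u, v} = {}"
    then have "int_orientation (ps ! x) (ps ! y) (ps ! u) * int_orientation (ps ! x) (ps ! y) (ps ! v) > 0 \<or>
          int_orientation (ps ! u) (ps ! v) (ps ! x) * int_orientation (ps ! u) (ps ! v) (ps ! y) > 0"
      using separate by fastforce
    then have "orientation (f x) (f y) (f u) * orientation (f x) (f y) (f v) > 0 \<or>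
          orientation (f u) (f v) (f x) * orientation (f u) (f v) (f y) > 0"
      by (simp only: f of_int_0_less_iff flip: of_int_mult)
    then show "closed_segment (f x) (f y) \<inter> closed_segment (f u) (f v) = {}"
      using segments_disjoint by (metis inf_commute)
  qed
qed

text \<open>The vertices \<open>0\<close> and \<open>1\<close> are isolated; the antipodal pairs are \<open>{2, 3}\<close>, \<open>{4, 5}\<close> and \<open>{6, 7}\<close>.\<close>

lemma planar_octahedron:
  "planar ({..<8::nat}, {{x, y} | x y. (x, y) \<in> set [(2, 4), (2, 5), (2, 6), (2, 7), (3, 4), (3, 5), (3, 6), (3, 7), (4, 6), (4, 7), (5, 6), (5, 7)]})"
proof -
  \<comment> \<open>The cycle \<open>4\<close>, \<open>6\<close>, \<open>5\<close>, \<open>7\<close>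
    encloses \<open>2\<close> and leaves \<open>3\<close> outside; \<open>0\<close> and
    \<open>1\<close> are placed far to the right. No vertex lies on the line through an edge not
    ending in it.\<close>
  have "straight_line_drawing_check [(20, 0), (21, 3), (0, 1), (0, 10), (-6, 0), (1, 3), (-1, 2), (7, -1)] [(2, 4), (2, 5), (2, 6), (2, 7), (3, 4), (3, 5), (3, 6), (3, 7), (4, 6), (4, 7), (5, 6), (5, 7)]"
    by code_simp
  from integer_straight_line_drawing[OF this] show ?thesis by (simp add: numeral_eq_Suc)
qed

text \<open>The triangle \<open>3\<close>, \<open>4\<close>, \<open>5\<close> has \<open>1\<close>
  inside and \<open>2\<close> outside, the ends of the missing edge; \<open>0\<close> is isolated
  and will be the identity.\<close>

lemma planar_K5_minus_edge:
  "planar ({..<6::nat}, {{x, y} | x y. (x, y) \<in> set [(1, 3), (1, 4), (1, 5), (2, 3), (2, 4), (2, 5), (3, 4), (3, 5), (4, 5)]})"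
proof -
  have "straight_line_drawing_check [(20, 0), (0, 1), (0, 9), (-6, 0), (1, 4), (6, -1)] [(1, 3), (1, 4), (1, 5), (2, 3), (2, 4), (2, 5), (3, 4), (3, 5), (4, 5)]"
    by code_simp
  from integer_straight_line_drawing[OF this] show ?thesis by (simp add: numeral_eq_Suc)
qed

section \<open>Groups with planar independence graph\<close>

text \<open>Together with \<open>subgroup_mult_right_iff\<close> and
  \<open>subgroup_inv_iff\<close>, this rule lets the simplifier decide by cancelling whether a
  subgroup that contains some words in the generators contains the generators.\<close>

lemma (in group) subgroup_mult_left_iff:
  assumes "subgroup H G" "x \<in> H" "y \<in> carrier G"
  shows "x \<otimes> y \<in> H \<longleftrightarrow> y \<in> H"
proof
  assume "x \<otimes> y \<in> H"
  then have "inv x \<otimes> (x \<otimes> y) \<in> H"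
    using assms(1,2) by (simp add: subgroup.m_closed subgroup.m_inv_closed)
  then show "y \<in> H"
    using assms subgroup.mem_carrier[OF assms(1,2)] by (simp flip: m_assoc)
qed (use assms subgroup.m_closed in fast)

lemma (in group) subgroup_mult_right_iff:
  assumes "subgroup H G" "x \<in> H" "y \<in> carrier G"
  shows "y \<otimes> x \<in> H \<longleftrightarrow> y \<in> H"
proof
  assume "y \<otimes> x \<in> H"
  then have "y \<otimes> x \<otimes> inv x \<in> H"
    using assms(1,2) by (simp add: subgroup.m_closed subgroup.m_inv_closed)
  then show "y \<in> H"
    using assms subgroup.mem_carrier[OF assms(1,2)] by (simp add: m_assoc)
qed (use assms subgroup.m_closed in fast)

lemma (in group) subgroup_inv_iff:
  assumes "subgroup H G" "x \<in> carrier G"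
  shows "inv x \<in> H \<longleftrightarrow> x \<in> H"
  using assms subgroup.m_inv_closed[OF assms(1)] inv_inv by metis

text \<open>Generation is tested on subgroups instead of words: it is enough that the old generators
  can be recovered from the new ones.\<close>

lemma (in group) generate_eq_carrierI:
  assumes "X \<subseteq> carrier G" "generate G X = carrier G" "Y \<subseteq> carrier G"
    and "\<And>H. subgroup H G \<Longrightarrow> Y \<subseteq> H \<Longrightarrow> X \<subseteq> H"
  shows "generate G Y = carrier G"
proof -
  have "subgroup (generate G Y) G" by (rule generate_is_subgroup[OF assms(3)])
  moreover have "Y \<subseteq> generate G Y" by (auto intro: generate.incl)
  ultimately have "generate G X \<subseteq> generate G Y"
    by (intro generate_subgroup_incl assms(4))
  then show ?thesis using assms(2) generate_incl[OF assms(3)] by blast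
qed

lemma minimal_generating_set_of_card:
  assumes "finite Y" "Y \<subseteq> carrier G" "generate G Y = carrier G"
    and "\<And>Z. finite Z \<Longrightarrow> Z \<subseteq> carrier G \<Longrightarrow> generate G Z = carrier G \<Longrightarrow> card Y \<le> card Z"
  shows "minimal_generating_set G Y"
  unfolding minimal_generating_set_def
proof (intro conjI allI impI notI)
  fix Z assume Z: "Z \<subset> Y" "generate G Z = carrier G"
  then have "card Z < card Y" using assms(1) by (simp add: psubset_card_mono)
  moreover have "card Y \<le> card Z"
    using Z assms(1,2) by (intro assms(4)) (auto intro: finite_subset)
  ultimately show False by simp
qed (use assms in auto)

lemma (in group) planar_imp_rank_le_2:
  assumes "planar (independence_graph G)"
    and X: "finite X" "X \<subseteq> carrier G" "generate G X = carrier G"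
    and least: "\<And>Z. finite Z \<Longrightarrow> Z \<subseteq> carrier G \<Longrightarrow> generate G Z = carrier G \<Longrightarrow> card X \<le> card Z"
  shows "card X \<le> 2"
proof (rule ccontr)
  assume "\<not> card X \<le> 2"
  then have "3 \<le> card X" by simp
  then obtain T where "T \<subseteq> X" "card T = 3" by (rule obtain_subset_with_card_n)
  then obtain a b c where abc: "{a, b, c} \<subseteq> X" "a \<noteq> b" "a \<noteq> c" "b \<noteq> c"
    by (auto simp: card_3_iff)
  have carr: "a \<in> carrier G" "b \<in> carrier G" "c \<in> carrier G" using abc X(2) by auto
  define R where "R = X - {a, b, c}"
  have card_R: "card R + 3 = card X" and R: "finite R" "R \<subseteq> carrier G"
    using abc X(1,2) card_mono[OF X(1) abc(1)] by (auto simp: R_def card_Diff_subset)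
  \<comment> \<open>Three elements from which \<open>a\<close>, \<open>b\<close>, \<open>c\<close>
    can be recovered form, together with the remaining generators, a generating set no larger than
    \<open>X\<close>, hence a minimal one.\<close>
  have adj: "adjacent G x y"
    if xyz: "x \<in> carrier G" "y \<in> carrier G" "z \<in> carrier G"
      and sub: "\<And>H. subgroup H G \<Longrightarrow> x \<in> H \<Longrightarrow> y \<in> H \<Longrightarrow> z \<in> H \<Longrightarrow> a \<in> H \<and> b \<in> H \<and> c \<in> H"
    for x y z
  proof -
    let ?Y = "insert x (insert y (insert z R))"
    have gen: "generate G ?Y = carrier G"
    proof (rule generate_eq_carrierI[OF X(2,3)])
      show "?Y \<subseteq> carrier G" using xyz R by auto
      show "X \<subseteq> H" if "subgroup H G" "?Y \<subseteq> H" for H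
        using sub[OF that(1)] that(2) by (auto simp: R_def)
    qed
    have le: "card X \<le> card ?Y" using gen xyz R by (intro least) auto
    \<comment> \<open>Equal elements would leave a generating set of at most
      \<open>card X - 1\<close> elements.\<close>
    have "x \<noteq> y"
    proof
      assume "x = y"
      then have "card ?Y \<le> card R + 2"
        using R(1) card_insert_le_m1[of "card R + 2" "insert z R" x] card_insert_le_m1[of "card R + 1" R z]
        by (simp add: card_insert_if)
      then show False using le card_R by simp
    qed
    moreover have "minimal_generating_set G ?Y"
    proof (rule minimal_generating_set_of_card)
      have "card ?Y \<le> card X" using R(1) card_R by (simp add: card_insert_if)
      then show "card ?Y \<le> card Z" if "finite Z" "Z \<subseteq> carrier G" "generate G Z = carrier G" for Z
        using least[OF that] by simp
    qed (use xyz R gen in auto)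
    ultimately show ?thesis using xyz unfolding adjacent_def by blast
  qed
  note mem = subgroup_mult_left_iff subgroup_mult_right_iff
  show False
  proof (rule planar_no_K5[OF assms(1)])
    \<comment> \<open>The instantiated argument is the third element, chosen so that at most two
      cancellations give back \<open>a\<close>, \<open>b\<close>, \<open>c\<close>.\<close>
    show "adjacent G a b" by (rule adj[of _ _ c]) (use carr in \<open>auto simp: mem\<close>)
    show "adjacent G a c" by (rule adj[of _ _ b]) (use carr in \<open>auto simp: mem\<close>)
    show "adjacent G a (a \<otimes> b)" by (rule adj[of _ _ c]) (use carr in \<open>auto simp: mem\<close>)
    show "adjacent G a (a \<otimes> b \<otimes> c)" by (rule adj[of _ _ c]) (use carr in \<open>auto simp: mem\<close>)
    show "adjacent G b c" by (rule adj[of _ _ a]) (use carr in \<open>auto simp: mem\<close>)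
    show "adjacent G b (a \<otimes> b)" by (rule adj[of _ _ c]) (use carr in \<open>auto simp: mem\<close>)
    show "adjacent G b (a \<otimes> b \<otimes> c)" by (rule adj[of _ _ c]) (use carr in \<open>auto simp: mem\<close>)
    show "adjacent G c (a \<otimes> b)" by (rule adj[of _ _ a]) (use carr in \<open>auto simp: mem\<close>)
    show "adjacent G c (a \<otimes> b \<otimes> c)" by (rule adj[of _ _ b]) (use carr in \<open>auto simp: mem\<close>)
    show "adjacent G (a \<otimes> b) (a \<otimes> b \<otimes> c)" by (rule adj[of _ _ a]) (use carr in \<open>auto simp: mem\<close>)
  qed
qed

section \<open>Noncyclic groups with two generators\<close>

definition generating_pair :: "('a, 'b) monoid_scheme \<Rightarrow> 'a \<Rightarrow> 'a \<Rightarrow> bool" where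
  "generating_pair G x y \<longleftrightarrow> x \<in> carrier G \<and> y \<in> carrier G \<and> generate G {x, y} = carrier G"

lemma (in group) generating_pair_change:
  assumes "generating_pair G a b" "u \<in> carrier G" "v \<in> carrier G"
    and "\<And>H. subgroup H G \<Longrightarrow> u \<in> H \<Longrightarrow> v \<in> H \<Longrightarrow> a \<in> H \<and> b \<in> H"
  shows "generating_pair G u v"
proof -
  have "generate G {u, v} = carrier G"
    using assms by (intro generate_eq_carrierI[of "{a, b}" "{u, v}"]) (auto simp: generating_pair_def)
  then show ?thesis using assms(2,3) by (simp add: generating_pair_def)
qed

text \<open>The relations of an extension of the cyclic group generated by \<open>a\<close>, of
  order \<open>m\<close>, by an outside element \<open>b\<close> whose square is \<open>a^k\<close>
  and which conjugates \<open>a\<close> to \<open>a^e\<close>. The triples \<open>(2, 0, 1)\<close>,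
  \<open>(4, 0, 1)\<close>, \<open>(4, 0, 3)\<close>, \<open>(4, 2, 3)\<close>,
  \<open>(3, 0, 2)\<close> belong to C_2 x C_2, C_2 x C_4, D_4, Q_8 and Sym(3).\<close>

definition metacyclic_pair :: "('a, 'b) monoid_scheme \<Rightarrow> nat \<Rightarrow> nat \<Rightarrow> nat \<Rightarrow> 'a \<Rightarrow> 'a \<Rightarrow> bool" where
  "metacyclic_pair G m k e a b \<longleftrightarrow> a \<in> carrier G \<and> b \<in> carrier G \<and> group.ord G a = m \<and>
     (\<forall>i::nat. b \<noteq> a [^]\<^bsub>G\<^esub> i) \<and> b \<otimes>\<^bsub>G\<^esub> b = a [^]\<^bsub>G\<^esub> k \<and> b \<otimes>\<^bsub>G\<^esub> a = a [^]\<^bsub>G\<^esub> e \<otimes>\<^bsub>G\<^esub> b"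

locale noncyclic_group = group +
  assumes noncyclic: "x \<in> carrier G \<Longrightarrow> generate G {x} \<noteq> carrier G"
begin

lemma singleton_not_generating:
  assumes "x \<in> carrier G" "Y \<subseteq> generate G {x}"
  shows "generate G Y \<noteq> carrier G"
proof -
  have "generate G Y \<subseteq> generate G {x}"
    using assms generate_is_subgroup[of "{x}"] by (intro generate_subgroup_incl) auto
  then show ?thesis
    using noncyclic[OF assms(1)] generate_incl[of "{x}"] assms(1) by auto
qed

lemma generating_pair_not_in:
  assumes "generating_pair G x y"
  shows "y \<notin> generate G {x}"
  using assms singleton_not_generating[of x "{x, y}"] generate.incl[of x "{x}" G]
  by (auto simp: generating_pair_def)

text \<open>A proper subset of a generating pair has at most one element, and in a noncyclic group
  no single element generates.\<close>

lemma generating_pair_adjacent: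
  assumes "generating_pair G x y"
  shows "adjacent G x y"
proof -
  have xy: "x \<in> carrier G" "y \<in> carrier G" "generate G {x, y} = carrier G"
    using assms by (auto simp: generating_pair_def)
  have "generate G Y \<noteq> carrier G" if "Y \<subset> {x, y}" for Y
  proof -
    have "Y \<subseteq> {x} \<or> Y \<subseteq> {y}" using that by auto
    then have "Y \<subseteq> generate G {x} \<or> Y \<subseteq> generate G {y}" by (auto intro: generate.incl)
    then show ?thesis using singleton_not_generating xy by auto
  qed
  then have "minimal_generating_set G {x, y}"
    using xy by (simp add: minimal_generating_set_def)
  moreover have "x \<noteq> y"
    using generating_pair_not_in[OF assms] generate.incl[of x "{x}" G] by auto
  ultimately show ?thesis using xy by (auto simp: adjacent_def)
qed

text \<open>As \<open>a\<^sup>2\<close> and \<open>a\<^sup>3\<close> generate \<open>a\<close>, the set \<open>{a\<^sup>2, a\<^sup>3, y}\<close> generates the group, and it is minimal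
  unless \<open>{a\<^sup>2, y}\<close> or \<open>{a\<^sup>3, y}\<close> already generates.\<close>

lemma adjacent_square_or_cube:
  assumes pair: "generating_pair G a y"
  shows "adjacent G (a [^] (2::nat)) y \<or> adjacent G (a [^] (3::nat)) y"
proof (rule ccontr)
  let ?s = "a [^] (2::nat)" and ?t = "a [^] (3::nat)"
  assume non: "\<not> ?thesis"
  have carr: "a \<in> carrier G" "y \<in> carrier G" "?s \<in> carrier G" "?t \<in> carrier G"
    and gen: "generate G {a, y} = carrier G"
    using pair by (auto simp: generating_pair_def)
  have sub: "subgroup (generate G {a}) G" using carr by (intro generate_is_subgroup) auto
  have a_in: "a \<in> generate G {a}" by (auto intro: generate.incl)
  have st: "?s \<in> generate G {a}" "?t \<in> generate G {a}"
    using carr a_in by (auto simp: numeral_eq_Suc subgroup.m_closed[OF sub])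
  have t_eq: "?t = a \<otimes> ?s" using carr by (simp add: numeral_eq_Suc m_assoc)
  have "generate G {?s, ?t, y} = carrier G"
  proof (rule generate_eq_carrierI[OF _ gen])
    show "{a, y} \<subseteq> H" if H: "subgroup H G" "{?s, ?t, y} \<subseteq> H" for H
      using H(2) subgroup_mult_right_iff[OF H(1), of ?s a] carr t_eq by auto
  qed (use carr in auto)
  moreover have "generate G Z \<noteq> carrier G" if "Z \<subset> {?s, ?t, y}" for Z
  proof
    assume genZ: "generate G Z = carrier G"
    have "Z \<subseteq> {?s, ?t} \<or> Z \<subseteq> {?s, y} \<or> Z \<subseteq> {?t, y}" using that by auto
    \<comment> \<open>A generating set inside \<open>{u, y}\<close> would make \<open>u\<close> and
      \<open>y\<close> adjacent; this is used for the square and for the cube.\<close>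
    moreover have False if "Z \<subseteq> {u, y}" "u \<in> carrier G" "\<not> adjacent G u y" for u
    proof -
      have "carrier G \<subseteq> generate G {u, y}" using mono_generate[OF that(1)] genZ by simp
      then have "generating_pair G u y"
        using that(2) carr generate_incl[of "{u, y}"] by (auto simp: generating_pair_def)
      then show False using generating_pair_adjacent that(3) by blast
    qed
    moreover have "\<not> Z \<subseteq> {?s, ?t}"
      using singleton_not_generating[OF carr(1), of Z] st genZ by auto
    ultimately show False using non carr by blast
  qed
  ultimately have "minimal_generating_set G {?s, ?t, y}"
    using carr by (auto simp: minimal_generating_set_def)
  moreover have "?s \<noteq> y" using generating_pair_not_in[OF pair] st by auto
  ultimately have "adjacent G ?s y"
    unfolding adjacent_def using carr by blast
  then show False using non by blast
qed

lemma inverse_pair: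
  assumes "generating_pair G a b"
  shows "generating_pair G (inv a) b"
  using assms by (intro generating_pair_change[OF assms])
    (auto simp: generating_pair_def subgroup_inv_iff)

text \<open>The five elements \<open>b a^j\<close> with \<open>j < 5\<close> are distinct, and each
  is adjacent to \<open>a^2\<close> or to \<open>a^3\<close>. Three of them share the same one,
  which together with \<open>a\<close> and its inverse gives a K_{3,3}; order at least five also
  keeps these last three apart.\<close>

lemma planar_ord_le_4:
  assumes planar: "planar (independence_graph G)" and pair: "generating_pair G a b"
  shows "ord a \<le> 4 \<or> ord a = 0"
proof (rule ccontr)
  assume "\<not> ?thesis"
  then have ord: "5 \<le> ord a" by simp
  have carr: "a \<in> carrier G" "b \<in> carrier G" using pair by (auto simp: generating_pair_def)
  have pow_inj: "i = j" if "a [^] i = a [^] j" "i < 5" "j < 5" for i j :: nat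
    using that ord ord_inj[OF carr(1)] by (auto simp: inj_on_def)
  define y where "y j = b \<otimes> a [^] j" for j :: nat
  have y: "generating_pair G a (y j)" for j
  proof (rule generating_pair_change[OF pair])
    show "a \<in> H \<and> b \<in> H" if H: "subgroup H G" "a \<in> H" "y j \<in> H" for H
    proof -
      have "a [^] j \<in> H" by (induction j) (use H carr in \<open>auto simp: subgroup.one_closed subgroup.m_closed\<close>)
      then show ?thesis using H subgroup_mult_right_iff[OF H(1), of "a [^] j" b] carr by (simp add: y_def)
    qed
  qed (use carr in \<open>auto simp: y_def\<close>)
  have y_inj: "i = j" if "y i = y j" "i < 5" "j < 5" for i j
    using that carr by (auto simp: y_def intro: pow_inj)
  let ?T = "\<lambda>c. {j \<in> {..<5}. adjacent G c (y j)}"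
  have "{..<5} = ?T (a [^] (2::nat)) \<union> ?T (a [^] (3::nat))"
    using adjacent_square_or_cube[OF y] by auto
  then have "card {..<5::nat} = card (?T (a [^] (2::nat)) \<union> ?T (a [^] (3::nat)))"
    by (rule arg_cong)
  also have "\<dots> \<le> card (?T (a [^] (2::nat))) + card (?T (a [^] (3::nat)))"
    by (rule card_Un_le)
  finally have "5 \<le> card (?T (a [^] (2::nat))) + card (?T (a [^] (3::nat)))" by simp
  then have "3 \<le> card (?T (a [^] (2::nat))) \<or> 3 \<le> card (?T (a [^] (3::nat)))" by linarith
  then obtain l :: nat where l: "l = 2 \<or> l = 3" "3 \<le> card (?T (a [^] l))" by blast
  obtain J where "J \<subseteq> ?T (a [^] l)" "card J = 3" by (rule obtain_subset_with_card_n[OF l(2)])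
  then obtain i j k where ijk: "{i, j, k} \<subseteq> ?T (a [^] l)" "i \<noteq> j" "i \<noteq> k" "j \<noteq> k"
    by (auto simp: card_3_iff)
  show False
  proof (rule planar_no_K33[OF planar])
    have pow: "a [^] (1::nat) = a" "a [^] (0::nat) = \<one>" using carr by auto
    have "a \<noteq> inv a"
    proof
      assume "a = inv a"
      then have "a [^] (2::nat) = a [^] (0::nat)" using carr by (metis numeral_2_eq_2 nat_pow_0 nat_pow_Suc l_one r_inv)
      then show False using pow_inj[of 2 0] by simp
    qed
    moreover have "a \<noteq> a [^] l"
      using pow_inj[of 1 l] l(1) pow by auto
    moreover have "inv a \<noteq> a [^] l"
    proof
      assume *: "inv a = a [^] l"
      have "a [^] Suc l = inv a \<otimes> a" by (simp add: *)
      then have "a [^] Suc l = a [^] (0::nat)" using carr by simp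
      then show False using pow_inj[of "Suc l" 0] l(1) by auto
    qed
    ultimately show "distinct [a, inv a, a [^] l]" by auto
    show "distinct [y i, y j, y k]" using y_inj ijk by auto
    show "adjacent G c z" if "c \<in> {a, inv a, a [^] l}" "z \<in> {y i, y j, y k}" for c z
      using that ijk(1) y inverse_pair[OF y] generating_pair_adjacent by auto
  qed
qed

text \<open>Used for both values of \<open>c\<close>: with the bound on the order of
  \<open>a\<close>, the two resulting relations suffice to identify the group. That \<open>a\<close>
  is not an involution keeps \<open>a\<close> apart from its inverse, and hence \<open>a b\<close>
  from \<open>a^-1 b\<close>.\<close>

lemma planar_pair_relations:
  assumes planar: "planar (independence_graph G)" and pair: "generating_pair G a b" and ne: "a \<otimes> a \<noteq> \<one>"
    and c: "c \<in> {b \<otimes> a, inv b \<otimes> inv a}"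
  shows "c = a \<otimes> b \<or> c = inv a \<otimes> b"
proof (rule ccontr)
  assume non: "\<not> ?thesis"
  have carr: "a \<in> carrier G" "b \<in> carrier G" using pair by (auto simp: generating_pair_def)
  have "a \<noteq> inv a" using ne carr by (metis r_inv)
  note mem = subgroup_mult_left_iff subgroup_mult_right_iff subgroup_inv_iff
  let ?A = "{a, inv a, b}" and ?B = "{a \<otimes> b, inv a \<otimes> b, c}"
  have B: "generating_pair G u v" if "u \<in> ?A" "v \<in> ?B" for u v
  proof (rule generating_pair_change[OF pair])
    show "u \<in> carrier G" "v \<in> carrier G" using that c carr by auto
    show "a \<in> H \<and> b \<in> H" if H: "subgroup H G" "u \<in> H" "v \<in> H" for H
    proof (cases "u = b")
      case True
      then show ?thesis using H c \<open>v \<in> ?B\<close> carr by (auto simp: mem)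
    next
      case False
      then have "a \<in> H" using H \<open>u \<in> ?A\<close> carr by (auto simp: mem)
      then show ?thesis using H c \<open>v \<in> ?B\<close> carr by (auto simp: mem)
    qed
  qed
  show False
  proof (rule planar_no_K33[OF planar])
    have "a \<noteq> b" "inv a \<noteq> b"
      using generating_pair_adjacent[OF pair] generating_pair_adjacent[OF inverse_pair[OF pair]]
      by (auto simp: adjacent_def)
    then show "distinct [a, inv a, b]" using \<open>a \<noteq> inv a\<close> by auto
    show "distinct [a \<otimes> b, inv a \<otimes> b, c]" using non \<open>a \<noteq> inv a\<close> carr by auto
    show "adjacent G u v" if "u \<in> {a, inv a, b}" "v \<in> {a \<otimes> b, inv a \<otimes> b, c}" for u v
      using B that generating_pair_adjacent by blast
  qed
qed

text \<open>Noncyclicity supplies the remaining condition: \<open>b\<close> lies outside the cyclic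
  group generated by \<open>a\<close>.\<close>

lemma generating_pair_metacyclic:
  assumes pair: "generating_pair G a b"
    and "ord a = m" "b \<otimes> b = a [^] k" "b \<otimes> a = a [^] e \<otimes> b"
  shows "metacyclic_pair G m k e a b"
proof -
  have carr: "a \<in> carrier G" "b \<in> carrier G" using pair by (auto simp: generating_pair_def)
  have "a [^] i \<in> generate G {a}" for i :: nat
    using carr generate_pow[of a] by (auto simp flip: int_pow_int)
  then have "\<forall>i::nat. b \<noteq> a [^] i" using generating_pair_not_in[OF pair] by metis
  then show ?thesis using assms carr by (simp add: metacyclic_pair_def)
qed

text \<open>If all first members of generating pairs square to one, this holds for
  \<open>a0\<close>, \<open>b0\<close> and their product, which therefore commute. Otherwise
  \<open>a\<close> has order 3 or 4 and either commutes with \<open>b\<close> or is inverted by it;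
  the second relation then fixes the square of \<open>b\<close>, after a change of \<open>b\<close>
  in the commuting case.\<close>

theorem planar_metacyclic_pair:
  assumes planar: "planar (independence_graph G)" and pair: "generating_pair G a0 b0"
    and fin: "finite (carrier G)"
  shows "\<exists>a b m k e. generating_pair G a b \<and> metacyclic_pair G m k e a b \<and>
    (m, k, e) \<in> {(2, 0, 1), (4, 0, 1), (4, 0, 3), (4, 2, 3), (3, 0, 2)}"
proof (cases "\<exists>a b. generating_pair G a b \<and> a \<otimes> a \<noteq> \<one>")
  case False
  have carr: "a0 \<in> carrier G" "b0 \<in> carrier G" using pair by (auto simp: generating_pair_def)
  have "generating_pair G b0 a0" using pair by (simp add: generating_pair_def insert_commute)
  moreover have "generating_pair G (a0 \<otimes> b0) b0"
    using carr by (intro generating_pair_change[OF pair]) (auto simp: subgroup_mult_right_iff)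
  ultimately have sq: "a0 \<otimes> a0 = \<one>" "b0 \<otimes> b0 = \<one>" "(a0 \<otimes> b0) \<otimes> (a0 \<otimes> b0) = \<one>"
    using False pair by blast+
  then have "inv a0 = a0" "inv b0 = b0" "inv (a0 \<otimes> b0) = a0 \<otimes> b0"
    using carr by (auto intro: inv_equality)
  then have comm: "b0 \<otimes> a0 = a0 \<otimes> b0" using carr by (simp add: inv_mult_group)
  have "a0 \<noteq> \<one>"
    using generating_pair_not_in[OF \<open>generating_pair G b0 a0\<close>] by (auto intro: generate.one)
  moreover have "ord a0 dvd 2"
    using sq(1) carr by (simp add: numeral_2_eq_2 flip: pow_eq_id)
  ultimately have "ord a0 = 2"
    using carr two_is_prime_nat ord_eq_1[of a0] by (auto simp: prime_nat_iff)
  then have "metacyclic_pair G 2 0 1 a0 b0"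
    using sq comm carr by (intro generating_pair_metacyclic[OF pair]) auto
  then show ?thesis using pair by blast
next
  case True
  then obtain a b where pair: "generating_pair G a b" and ne: "a \<otimes> a \<noteq> \<one>" by blast
  have carr: "a \<in> carrier G" "b \<in> carrier G" using pair by (auto simp: generating_pair_def)
  have "ord a \<noteq> 1" using ne carr ord_eq_1[of a] by auto
  moreover have "ord a \<noteq> 2"
  proof
    assume "ord a = 2"
    then have "a [^] (2::nat) = \<one>" using pow_ord_eq_1[OF carr(1)] by metis
    then show False using ne carr by (simp add: numeral_2_eq_2)
  qed
  moreover have "ord a \<ge> 1" by (rule ord_ge_1[OF fin carr(1)])
  moreover have "ord a \<le> 4" using planar_ord_le_4[OF planar pair] calculation(3) by auto
  ultimately have ord: "ord a = 3 \<or> ord a = 4" by linarith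
  have inv_a: "inv a = a [^] (ord a - 1)"
  proof (rule inv_equality)
    have "a [^] (ord a - 1) \<otimes> a = a [^] Suc (ord a - 1)" by simp
    also have "\<dots> = \<one>" using \<open>ord a \<ge> 1\<close> carr by simp
    finally show "a [^] (ord a - 1) \<otimes> a = \<one>" .
  qed (use carr in auto)
  have R: "b \<otimes> a = a \<otimes> b \<or> b \<otimes> a = inv a \<otimes> b"
      "inv b \<otimes> inv a = a \<otimes> b \<or> inv b \<otimes> inv a = inv a \<otimes> b"
    using planar_pair_relations[OF planar pair ne] by auto
  show ?thesis
  proof (cases "b \<otimes> a = a \<otimes> b")
    case comm: True
    \<comment> \<open>When \<open>a\<close> and \<open>b\<close> commute, the second relation says
      that \<open>a b\<close> or \<open>b\<close> squares to one; that element takes the place of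
      \<open>b\<close>.\<close>
    have "\<exists>b'. generating_pair G a b' \<and> b' \<otimes> b' = \<one> \<and> b' \<otimes> a = a \<otimes> b'"
      using R(2)
    proof
      assume *: "inv b \<otimes> inv a = a \<otimes> b"
      have "inv (a \<otimes> b) = a \<otimes> b" using * carr by (simp add: inv_mult_group)
      then have "a \<otimes> b \<otimes> (a \<otimes> b) = \<one>" using carr by (metis m_closed r_inv)
      moreover have "generating_pair G a (a \<otimes> b)"
        using carr by (intro generating_pair_change[OF pair]) (auto simp: subgroup_mult_left_iff)
      moreover have "a \<otimes> b \<otimes> a = a \<otimes> (a \<otimes> b)" using carr comm by (simp add: m_assoc)
      ultimately show ?thesis by blast
    next
      assume *: "inv b \<otimes> inv a = inv a \<otimes> b"
      have "inv b \<otimes> inv a = inv a \<otimes> inv b" using carr comm by (metis inv_mult_group)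
      then have "inv b = b" using * carr by simp
      then have "b \<otimes> b = \<one>" using carr by (metis r_inv)
      then show ?thesis using pair comm by blast
    qed
    then obtain c where pc: "generating_pair G a c" and c: "c \<otimes> c = \<one>" "c \<otimes> a = a \<otimes> c" by blast
    have cc: "c \<in> carrier G" using pc by (auto simp: generating_pair_def)
    \<comment> \<open>In order 3 the cube of \<open>a c\<close> is \<open>c\<close>, so
      \<open>a c\<close> alone would generate the group.\<close>
    have "ord a \<noteq> 3"
    proof
      assume "ord a = 3"
      then have "a [^] (3::nat) = \<one>" using carr pow_ord_eq_1[of a] by simp
      then have "(a \<otimes> c) [^] (3::nat) = c [^] (3::nat)"
        using pow_mult_distrib[of a c 3] carr cc c(2) by simp
      also have "\<dots> = c" using c(1) cc by (simp add: numeral_3_eq_3)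
      finally have eq: "(a \<otimes> c) [^] (3::nat) = c" .
      let ?H = "generate G {a \<otimes> c}"
      have H: "subgroup ?H G" "a \<otimes> c \<in> ?H"
        using carr cc by (auto intro: generate_is_subgroup generate.incl)
      have "(a \<otimes> c) [^] (3::nat) \<in> ?H" 
        using carr cc generate_pow[of "a \<otimes> c"] by (auto simp flip: int_pow_int)
      then have "c \<in> ?H" using eq by simp
      moreover then have "a \<in> ?H" using H subgroup_mult_right_iff[OF H(1), of c a] carr by simp
      ultimately have "generate G {a, c} \<noteq> carrier G"
        using carr cc by (intro singleton_not_generating[of "a \<otimes> c"]) auto
      then show False using pc by (simp add: generating_pair_def)
    qed
    then have "metacyclic_pair G 4 0 1 a c"
      using ord c carr by (intro generating_pair_metacyclic[OF pc]) auto
    then show ?thesis using pc by blast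
  next
    case False
    then have anti: "b \<otimes> a = inv a \<otimes> b" using R(1) by blast
    then have anti': "a \<otimes> b = b \<otimes> inv a" using carr
      by (metis inv_closed inv_solve_left inv_solve_right' m_assoc m_closed)
    show ?thesis
      using R(2)
    proof
      assume "inv b \<otimes> inv a = a \<otimes> b"
      then have "inv b = b" using anti' carr by simp
      then have "b \<otimes> b = \<one>" using carr by (metis r_inv)
      then have "metacyclic_pair G (ord a) 0 (ord a - 1) a b"
        using anti inv_a by (intro generating_pair_metacyclic[OF pair]) auto
      then have "metacyclic_pair G 3 0 2 a b \<or> metacyclic_pair G 4 0 3 a b" using ord by auto
      then show ?thesis using pair by blast
    next
      assume "inv b \<otimes> inv a = inv a \<otimes> b"
      then have "inv b \<otimes> inv a = b \<otimes> a" using anti by simp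
      then have bb: "b \<otimes> b = inv a \<otimes> inv a"
        using carr by (metis inv_closed inv_inv inv_mult_group inv_solve_left inv_solve_right m_assoc m_closed)
      \<comment> \<open>The square of \<open>b\<close>, which equals \<open>a^-2\<close>, commutes
        with \<open>b\<close>, while \<open>b\<close> inverts \<open>a\<close>; hence
        \<open>a^-2 = a^2\<close>.\<close>
      have "b \<otimes> (inv a \<otimes> inv a) = (inv a \<otimes> inv a) \<otimes> b" 
        using carr by (simp add: m_assoc flip: bb)
      moreover have "b \<otimes> (inv a \<otimes> inv a) = (a \<otimes> a) \<otimes> b"
        using anti' carr by (metis inv_closed m_assoc)
      ultimately have aa: "inv a \<otimes> inv a = a \<otimes> a" using carr by simp
      then have "a \<otimes> a \<otimes> (a \<otimes> a) = \<one>"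
        using carr by (metis inv_mult_group m_closed r_inv)
      then have "a [^] (4::nat) = \<one>" using carr by (simp add: numeral_eq_Suc m_assoc)
      then have "ord a dvd 4" using carr by (simp add: pow_eq_id)
      then have "ord a = 4" using ord by auto
      then have "metacyclic_pair G 4 2 3 a b"
        using anti inv_a bb aa carr by (intro generating_pair_metacyclic[OF pair]) (auto simp: numeral_2_eq_2)
      then show ?thesis using pair by blast
    qed
  qed
qed

end

section \<open>Metacyclic groups of order 4, 6 and 8\<close>

context group begin

lemma pow_eq_pow_iff:
  assumes "a \<in> carrier G"
  shows "a [^] (i::nat) = a [^] (j::nat) \<longleftrightarrow> i mod ord a = j mod ord a"
proof -
  have "a [^] i = a [^] j \<longleftrightarrow> int (ord a) dvd int j - int i"
    using int_pow_eq[OF assms, of "int i" "int j"] by (simp add: int_pow_int)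
  also have "\<dots> \<longleftrightarrow> int j mod int (ord a) = int i mod int (ord a)"
    by (rule mod_eq_dvd_iff[symmetric])
  also have "\<dots> \<longleftrightarrow> i mod ord a = j mod ord a"
    by (metis of_nat_eq_iff of_nat_mod)
  finally show ?thesis .
qed

lemma finite_subgroupI:
  assumes "finite (carrier G)" "H \<subseteq> carrier G" "H \<noteq> {}" "\<And>x y. x \<in> H \<Longrightarrow> y \<in> H \<Longrightarrow> x \<otimes> y \<in> H"
  shows "subgroup H G"
proof (rule subgroupI)
  have pow: "x [^] Suc n \<in> H" if "x \<in> H" for x and n :: nat
    using that by (induction n) (use assms that in auto)
  show "inv x \<in> H" if "x \<in> H" for x
  proof -
    have x: "x \<in> carrier G" using that assms(2) by blast
    have ord: "ord x \<ge> 1" by (rule ord_ge_1[OF assms(1) x])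
    \<comment> \<open>The exponent \<open>2 * ord x - 1\<close>, unlike \<open>ord x - 1\<close>,
      stays positive when \<open>ord x = 1\<close>; only positive powers are known to lie in
      \<open>H\<close>.\<close>
    have "x [^] (2 * ord x - 1) \<otimes> x = x [^] Suc (2 * ord x - 1)" by simp
    also have "\<dots> = \<one>" using ord x by (simp add: pow_eq_id del: nat_pow_Suc)
    finally have "inv x = x [^] (2 * ord x - 1)" using x by (intro inv_equality) auto
    moreover have "2 * ord x - 1 = Suc (2 * ord x - 2)" using ord by simp
    ultimately show ?thesis using pow[OF that] by metis
  qed
qed (use assms in auto)

context
  fixes m k e :: nat and a b
  assumes pair: "metacyclic_pair G m k e a b" and m: "0 < m"
begin

lemma metacyclic_carrier: "a \<in> carrier G" "b \<in> carrier G"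
  using pair by (auto simp: metacyclic_pair_def)

text \<open>Each \<open>b\<close> passed multiplies the exponent of \<open>a\<close> by
  \<open>e\<close>. Exponents are natural numbers throughout; inverting \<open>a\<close> corresponds
  to \<open>e = m - 1\<close>.\<close>

lemma metacyclic_commute: "b [^] (j::nat) \<otimes> a [^] (i::nat) = a [^] (i * e ^ j) \<otimes> b [^] j"
proof -
  note carr = metacyclic_carrier
  have ba: "b \<otimes> a = a [^] e \<otimes> b" using pair by (simp add: metacyclic_pair_def)
  have 1: "b \<otimes> a [^] i = a [^] (e * i) \<otimes> b" for i :: nat
  proof (induction i)
    case (Suc i)
    have "b \<otimes> a [^] Suc i = (b \<otimes> a [^] i) \<otimes> a" using carr by (simp add: m_assoc)
    also have "\<dots> = a [^] (e * i) \<otimes> (a [^] e \<otimes> b)" using carr by (simp add: Suc m_assoc ba)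
    also have "\<dots> = a [^] (e * Suc i) \<otimes> b"
      using carr by (simp add: nat_pow_mult add.commute flip: m_assoc)
    finally show ?case .
  qed (use carr in simp)
  show ?thesis
  proof (induction j arbitrary: i)
    case (Suc j)
    have "b [^] Suc j \<otimes> a [^] i = b [^] j \<otimes> (b \<otimes> a [^] i)" using carr by (simp add: m_assoc)
    also have "\<dots> = (b [^] j \<otimes> a [^] (e * i)) \<otimes> b" using carr by (simp add: 1 m_assoc)
    also have "\<dots> = a [^] (i * e ^ Suc j) \<otimes> b [^] Suc j"
      using carr by (simp add: Suc m_assoc ac_simps)
    finally show ?case .
  qed (use carr in simp)
qed

text \<open>The formula involves only \<open>e\<close>, so words multiply alike in all groups
  sharing \<open>e\<close>.\<close>

lemma metacyclic_mult:
  "(a [^] (i::nat) \<otimes> b [^] (j::nat)) \<otimes> (a [^] (i'::nat) \<otimes> b [^] (j'::nat))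
     = a [^] (i + i' * e ^ j) \<otimes> b [^] (j + j')"
proof -
  note carr = metacyclic_carrier
  have "(a [^] i \<otimes> b [^] j) \<otimes> (a [^] i' \<otimes> b [^] j') = a [^] i \<otimes> (b [^] j \<otimes> a [^] i') \<otimes> b [^] j'"
    using carr by (simp add: m_assoc)
  also have "\<dots> = (a [^] i \<otimes> a [^] (i' * e ^ j)) \<otimes> (b [^] j \<otimes> b [^] j')"
    using carr by (simp add: metacyclic_commute m_assoc)
  finally show ?thesis using carr by (simp add: nat_pow_mult)
qed

lemma metacyclic_reduce:
  "a [^] (i::nat) \<otimes> b [^] (j::nat) = a [^] (i + k * (j div 2)) \<otimes> b [^] (j mod 2)"
proof -
  note carr = metacyclic_carrier
  have "b [^] (2::nat) = a [^] k"
    using pair by (simp add: metacyclic_pair_def numeral_2_eq_2)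
  then have "b [^] (2 * (j div 2)) = a [^] (k * (j div 2))"
    using carr by (simp flip: nat_pow_pow)
  then have "b [^] j = a [^] (k * (j div 2)) \<otimes> b [^] (j mod 2)"
    using carr nat_pow_mult[of b "2 * (j div 2)" "j mod 2"] by simp
  then show ?thesis using carr by (simp add: nat_pow_mult flip: m_assoc)
qed

text \<open>Only \<open>m\<close> and \<open>k\<close> decide when two words are equal: pairs of
  \<open>b\<close> turn into powers of \<open>a\<close>, and a leftover \<open>b\<close> is detected
  because \<open>b\<close> is no power of \<open>a\<close>.\<close>

lemma metacyclic_eq_iff:
  "a [^] (i::nat) \<otimes> b [^] (j::nat) = a [^] (i'::nat) \<otimes> b [^] (j'::nat) \<longleftrightarrow>
     j mod 2 = j' mod 2 \<and> (i + k * (j div 2)) mod m = (i' + k * (j' div 2)) mod m"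
proof -
  note carr = metacyclic_carrier
  have ord: "ord a = m" using pair by (simp add: metacyclic_pair_def)
  \<comment> \<open>The power \<open>a^(t (m - 1))\<close> inverts \<open>a^t\<close> with a natural
    exponent; multiplying by it would exhibit \<open>b\<close> as a power of
    \<open>a\<close>.\<close>
  have non: "a [^] s \<noteq> a [^] t \<otimes> b" for s t :: nat
  proof
    assume eq: "a [^] s = a [^] t \<otimes> b"
    have "a [^] (t * (m - 1)) \<otimes> a [^] t = a [^] (m * t)"
      using m carr by (simp add: nat_pow_mult algebra_simps flip: nat_pow_Suc)
    also have "\<dots> = \<one>" using carr ord by (simp add: pow_eq_id)
    finally have one: "a [^] (t * (m - 1)) \<otimes> a [^] t = \<one>" .
    have "a [^] (t * (m - 1) + s) = a [^] (t * (m - 1)) \<otimes> (a [^] t \<otimes> b)"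
      using carr eq by (simp flip: nat_pow_mult)
    also have "\<dots> = b" using carr one by (simp flip: m_assoc)
    finally show False using pair by (metis metacyclic_pair_def)
  qed
  define s t where "s = i + k * (j div 2)" and "t = i' + k * (j' div 2)"
  have "a [^] s \<otimes> b [^] (j mod 2) = a [^] t \<otimes> b [^] (j' mod 2) \<longleftrightarrow> j mod 2 = j' mod 2 \<and> s mod m = t mod m"
    using carr non[of s t] non[of t s] ord pow_eq_pow_iff[OF carr(1), of s t]
    by (cases "even j"; cases "even j'") (auto simp: odd_iff_mod_2_eq_one)
  then show ?thesis
    unfolding metacyclic_reduce[of i j] metacyclic_reduce[of i' j'] s_def t_def .
qed

lemma metacyclic_generate:
  assumes "finite (carrier G)"
  shows "generate G {a, b} \<subseteq> {a [^] (i::nat) \<otimes> b [^] (j::nat) | i j. True}" (is "_ \<subseteq> ?N")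
proof -
  note carr = metacyclic_carrier
  have N: "?N \<subseteq> carrier G" using carr by auto
  have one: "\<one> \<in> ?N" by (rule CollectI, rule exI[of _ 0], rule exI[of _ 0]) simp
  have mult: "x \<otimes> y \<in> ?N" if "x \<in> ?N" "y \<in> ?N" for x y
    using that metacyclic_mult by (smt (verit) mem_Collect_eq)
  have "subgroup ?N G"
    by (rule finite_subgroupI[OF assms N _ mult]) (use one in blast)
  moreover have "a \<in> ?N"
    by (rule CollectI, rule exI[of _ 1], rule exI[of _ 0]) (use carr in simp)
  moreover have "b \<in> ?N"
    by (rule CollectI, rule exI[of _ 0], rule exI[of _ 1]) (use carr in simp)
  ultimately show ?thesis by (intro generate_subgroup_incl) auto
qed

end

end

text \<open>Mapping words to words is well defined and injective by the common criterion for
  equality, and multiplicative by the common product formula. Surjectivity is a count: the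
  \<open>2 m\<close> reduced words are distinct in \<open>G\<close>, and \<open>H\<close> has just
  \<open>2 m\<close> elements.\<close>

theorem metacyclic_iso:
  assumes G: "group G" "metacyclic_pair G m k e a b" "generate G {a, b} = carrier G" "finite (carrier G)"
    and H: "group H" "metacyclic_pair H m k e c d" "card (carrier H) = 2 * m" and m: "0 < m"
  shows "G \<cong> H"
proof -
  interpret G: group G by fact
  interpret H: group H by fact
  let ?g = "\<lambda>(i::nat) (j::nat). a [^]\<^bsub>G\<^esub> i \<otimes>\<^bsub>G\<^esub> b [^]\<^bsub>G\<^esub> j"
  let ?h = "\<lambda>(i::nat) (j::nat). c [^]\<^bsub>H\<^esub> i \<otimes>\<^bsub>H\<^esub> d [^]\<^bsub>H\<^esub> j"
  note cG = G.metacyclic_carrier[OF G(2) m] and cH = H.metacyclic_carrier[OF H(2) m]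
  have eq: "?g i j = ?g i' j' \<longleftrightarrow> ?h i j = ?h i' j'" for i j i' j'
    using G.metacyclic_eq_iff[OF G(2) m, of i j i' j'] H.metacyclic_eq_iff[OF H(2) m, of i j i' j'] by simp
  have all: "\<exists>i j. x = ?g i j" if "x \<in> carrier G" for x
    using G.metacyclic_generate[OF G(2) m G(4)] that G(3) by auto
  define \<phi> where "\<phi> x = (THE y. \<exists>i j. x = ?g i j \<and> y = ?h i j)" for x
  have \<phi>: "\<phi> (?g i j) = ?h i j" for i j
    unfolding \<phi>_def
  proof (rule the_equality)
    fix y assume "\<exists>i' j'. ?g i j = ?g i' j' \<and> y = ?h i' j'"
    then obtain i' j' where *: "?g i j = ?g i' j'" "y = ?h i' j'" by blast
    show "y = ?h i j" unfolding *(2) using *(1) by (rule eq[THEN iffD1, symmetric])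
  qed blast
  have hom: "\<phi> \<in> hom G H"
  proof (rule homI)
    fix x y assume "x \<in> carrier G" "y \<in> carrier G"
    then obtain i j i' j' where xy: "x = ?g i j" "y = ?g i' j'" using all by meson
    show "\<phi> x \<in> carrier H" unfolding xy \<phi> using cH by simp
    show "\<phi> (x \<otimes>\<^bsub>G\<^esub> y) = \<phi> x \<otimes>\<^bsub>H\<^esub> \<phi> y"
      unfolding xy G.metacyclic_mult[OF G(2) m] \<phi> H.metacyclic_mult[OF H(2) m] ..
  qed
  have inj: "inj_on \<phi> (carrier G)"
  proof (rule inj_onI)
    fix x y assume "x \<in> carrier G" "y \<in> carrier G" and e: "\<phi> x = \<phi> y"
    then obtain i j i' j' where xy: "x = ?g i j" "y = ?g i' j'" using all by meson
    show "x = y" using e unfolding xy \<phi> by (rule eq[THEN iffD2])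
  qed
  have sub: "\<phi> ` carrier G \<subseteq> carrier H" using hom by (auto simp: hom_def)
  have "inj_on (\<lambda>(i, j). ?g i j) ({..<m} \<times> {..<2})"
    by (rule inj_onI) (auto simp: G.metacyclic_eq_iff[OF G(2) m])
  then have "card ((\<lambda>(i, j). ?g i j) ` ({..<m} \<times> {..<2})) = 2 * m"
    by (simp add: card_image card_cartesian_product)
  moreover have "(\<lambda>(i, j). ?g i j) ` ({..<m} \<times> {..<2}) \<subseteq> carrier G" using cG by auto
  ultimately have "2 * m \<le> card (carrier G)" using G(4) card_mono by metis
  then have "card (carrier H) \<le> card (\<phi> ` carrier G)" using inj H(3) by (simp add: card_image)
  moreover have "finite (carrier H)" using H(3) m by (intro card_ge_0_finite) simp
  ultimately have "\<phi> ` carrier G = carrier H" using sub by (meson card_seteq)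
  then show ?thesis using hom inj by (auto simp: is_iso_def iso_def bij_betw_def)
qed

lemma (in group) ord_eqI:
  assumes "a \<in> carrier G" "a [^] m = \<one>" "0 < m" "\<And>i. 0 < i \<Longrightarrow> i < m \<Longrightarrow> a [^] i \<noteq> \<one>"
  shows "ord a = m"
proof -
  have "ord a dvd m" using assms(1,2) by (simp add: pow_eq_id)
  then have "ord a \<le> m" "0 < ord a" using assms(3) by (auto intro: dvd_imp_le dvd_pos_nat)
  moreover have "a [^] ord a = \<one>" using assms(1) by simp
  ultimately show ?thesis using assms(4)[of "ord a"] by fastforce
qed

text \<open>Only exponents below \<open>m\<close> have to be inspected, which leaves finitely many
  evaluations in a concrete group.\<close>

lemma metacyclic_pairI:
  assumes "group G" "a \<in> carrier G" "b \<in> carrier G" "0 < m" "a [^]\<^bsub>G\<^esub> m = \<one>\<^bsub>G\<^esub>"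
    and "\<And>i. 0 < i \<Longrightarrow> i < m \<Longrightarrow> a [^]\<^bsub>G\<^esub> i \<noteq> \<one>\<^bsub>G\<^esub>" "\<And>i. i < m \<Longrightarrow> b \<noteq> a [^]\<^bsub>G\<^esub> i"
    and "b \<otimes>\<^bsub>G\<^esub> b = a [^]\<^bsub>G\<^esub> k" "b \<otimes>\<^bsub>G\<^esub> a = a [^]\<^bsub>G\<^esub> e \<otimes>\<^bsub>G\<^esub> b"
  shows "metacyclic_pair G m k e a b"
proof -
  interpret group G by fact
  have ord: "ord a = m" using assms by (intro ord_eqI) auto
  have "b \<noteq> a [^]\<^bsub>G\<^esub> i" for i :: nat
    using assms(4) assms(7)[of "i mod m"] pow_eq_pow_iff[OF assms(2), of i "i mod m"] ord by simp
  then show ?thesis using assms ord by (simp add: metacyclic_pair_def)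
qed

section \<open>The five noncyclic groups and their defining relations\<close>

lemma group_dihedral_group:
  assumes "0 < n"
  shows "group (dihedral_group n)"
proof (rule groupI)
  let ?D = "dihedral_group n"
  show "x \<otimes>\<^bsub>?D\<^esub> y \<otimes>\<^bsub>?D\<^esub> z = x \<otimes>\<^bsub>?D\<^esub> (y \<otimes>\<^bsub>?D\<^esub> z)" for x y z
    by (auto simp: dihedral_group_def mod_simps split: prod.splits) (simp_all add: algebra_simps)
  show "\<exists>y\<in>carrier ?D. y \<otimes>\<^bsub>?D\<^esub> x = \<one>\<^bsub>?D\<^esub>" if "x \<in> carrier ?D" for x
  proof -
    obtain i s where x: "x = (i, s)" by fastforce
    \<comment> \<open>Reflections are their own inverses; rotations are negated modulo
      \<open>n\<close>.\<close>
    let ?y = "((if s then i else - i) mod int n, s)"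
    have "?y \<in> carrier ?D"
      using assms by (simp add: dihedral_group_def carrier_integer_mod_group)
    moreover have "?y \<otimes>\<^bsub>?D\<^esub> x = \<one>\<^bsub>?D\<^esub>"
      by (cases s) (simp_all add: x dihedral_group_def mod_simps)
    ultimately show ?thesis by blast
  qed
qed (use assms in \<open>auto simp: dihedral_group_def carrier_integer_mod_group split: prod.splits\<close>)

lemma group_quaternion_group: "group quaternion_group"
proof (rule groupI)
  let ?Q = quaternion_group
  show "x \<otimes>\<^bsub>?Q\<^esub> y \<otimes>\<^bsub>?Q\<^esub> z = x \<otimes>\<^bsub>?Q\<^esub> (y \<otimes>\<^bsub>?Q\<^esub> z)" for x y z
    by (cases x; cases y; cases z) (simp add: quaternion_group_def algebra_simps)
  show "\<exists>y\<in>carrier ?Q. y \<otimes>\<^bsub>?Q\<^esub> x = \<one>\<^bsub>?Q\<^esub>" if x: "x \<in> carrier ?Q" for x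
  proof -
    obtain a b c d where abcd: "x = (a, b, c, d)" by (cases x)
    \<comment> \<open>The inverse is the conjugate, since all elements have norm one.\<close>
    have "(a, - b, - c, - d) \<in> carrier ?Q" "(a, - b, - c, - d) \<otimes>\<^bsub>?Q\<^esub> x = \<one>\<^bsub>?Q\<^esub>"
      using x unfolding abcd by (auto simp: quaternion_group_def)
    then show ?thesis by blast
  qed
  show "x \<otimes>\<^bsub>?Q\<^esub> y \<in> carrier ?Q" if "x \<in> carrier ?Q" "y \<in> carrier ?Q" for x y
    using that unfolding quaternion_group_def by (simp, elim disjE) simp_all
  show "\<one>\<^bsub>?Q\<^esub> \<otimes>\<^bsub>?Q\<^esub> x = x" for x
    by (cases x) (simp add: quaternion_group_def)
qed (simp add: quaternion_group_def)

lemma metacyclic_C2_C2: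
  defines "K \<equiv> integer_mod_group 2 \<times>\<times> integer_mod_group 2"
  shows "group K" "metacyclic_pair K 2 0 1 (1, 0) (0, 1)" "card (carrier K) = 2 * 2"
proof -
  show K: "group K" by (simp add: K_def DirProd_group)
  show "metacyclic_pair K 2 0 1 (1, 0) (0, 1)"
    by (rule metacyclic_pairI[OF K])
      (auto simp: K_def carrier_integer_mod_group DirProd_def numeral_2_eq_2 less_Suc_eq)
  show "card (carrier K) = 2 * 2"
    by (simp add: K_def DirProd_def carrier_integer_mod_group card_cartesian_product)
qed

lemma metacyclic_C2_C4:
  defines "K \<equiv> integer_mod_group 2 \<times>\<times> integer_mod_group 4"
  shows "group K" "metacyclic_pair K 4 0 1 (0, 1) (1, 0)" "card (carrier K) = 2 * 4"
proof -
  show K: "group K" by (simp add: K_def DirProd_group)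
  show "metacyclic_pair K 4 0 1 (0, 1) (1, 0)"
    by (rule metacyclic_pairI[OF K])
      (auto simp: K_def carrier_integer_mod_group DirProd_def numeral_eq_Suc less_Suc_eq)
  show "card (carrier K) = 2 * 4"
    by (simp add: K_def DirProd_def carrier_integer_mod_group card_cartesian_product)
qed

lemma metacyclic_D4:
  shows "metacyclic_pair (dihedral_group 4) 4 0 3 (1, False) (0, True)"
    "card (carrier (dihedral_group 4)) = 2 * 4"
proof -
  show "metacyclic_pair (dihedral_group 4) 4 0 3 (1, False) (0, True)"
    by (rule metacyclic_pairI[OF group_dihedral_group])
      (auto simp: dihedral_group_def carrier_integer_mod_group numeral_eq_Suc less_Suc_eq)
  show "card (carrier (dihedral_group 4)) = 2 * 4"
    by (simp add: dihedral_group_def carrier_integer_mod_group card_cartesian_product)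
qed

lemma metacyclic_Q8:
  shows "metacyclic_pair quaternion_group 4 2 3 (0, 1, 0, 0) (0, 0, 1, 0)"
    "card (carrier quaternion_group) = 2 * 4"
proof -
  show "metacyclic_pair quaternion_group 4 2 3 (0, 1, 0, 0) (0, 0, 1, 0)"
    by (rule metacyclic_pairI[OF group_quaternion_group])
      (auto simp: quaternion_group_def numeral_eq_Suc less_Suc_eq)
  show "card (carrier quaternion_group) = 2 * 4"
    by (simp add: quaternion_group_def)
qed

lemma metacyclic_S3:
  defines "s \<equiv> Transposition.transpose 1 (2::nat)" and "t \<equiv> Transposition.transpose 2 (3::nat)"
  shows "metacyclic_pair (sym_group 3) 3 0 2 (s \<circ> t) s" "card (carrier (sym_group 3)) = 2 * 3"
proof -
  have st: "s permutes {1..3}" "t permutes {1..3}"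
    unfolding s_def t_def by (auto intro: permutes_swap_id)
  have val: "s 1 = 2" "s 2 = 1" "s 3 = 3" "t 1 = 1" "t 2 = 3" "t 3 = 2"
    by (simp_all add: s_def t_def)
  \<comment> \<open>The powers of the three-cycle \<open>s \<circ> t\<close> and the transposition
    \<open>s\<close> already differ at \<open>1\<close> or \<open>2\<close>.\<close>
  have neq: "f \<noteq> g" if "f 1 \<noteq> g (1::nat) \<or> f 2 \<noteq> g 2" for f g :: "nat \<Rightarrow> nat"
    using that by auto
  have pow: "(s \<circ> t) [^]\<^bsub>sym_group 3\<^esub> (2::nat) = s \<circ> t \<circ> (s \<circ> t)"
    "(s \<circ> t) [^]\<^bsub>sym_group 3\<^esub> (1::nat) = s \<circ> t" "(s \<circ> t) [^]\<^bsub>sym_group 3\<^esub> (0::nat) = id"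
    by (simp_all add: sym_group_def numeral_2_eq_2)
  show "metacyclic_pair (sym_group 3) 3 0 2 (s \<circ> t) s"
  proof (rule metacyclic_pairI[OF sym_group_is_group])
    show "s \<circ> t \<in> carrier (sym_group 3)" "s \<in> carrier (sym_group 3)"
      using st by (auto simp: sym_group_def intro: permutes_compose)
    have "s \<circ> t \<circ> (s \<circ> t) \<circ> (s \<circ> t) = id"
      by (auto simp: s_def t_def fun_eq_iff Transposition.transpose_def)
    then show "(s \<circ> t) [^]\<^bsub>sym_group 3\<^esub> (3::nat) = \<one>\<^bsub>sym_group 3\<^esub>"
      by (simp add: sym_group_def numeral_3_eq_3)
    show "(s \<circ> t) [^]\<^bsub>sym_group 3\<^esub> i \<noteq> \<one>\<^bsub>sym_group 3\<^esub>" if "0 < i" "i < 3" for i :: nat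
    proof -
      have "i = 1 \<or> i = 2" using that by auto
      then show ?thesis
        by (auto simp del: One_nat_def simp add: pow sym_group_one intro!: neq) (simp_all add: val del: One_nat_def)
    qed
    show "s \<noteq> (s \<circ> t) [^]\<^bsub>sym_group 3\<^esub> i" if "i < 3" for i :: nat
    proof -
      have "i = 0 \<or> i = 1 \<or> i = 2" using that by auto
      then show ?thesis
        by (elim disjE) (simp_all only: pow, (rule neq, simp add: val del: One_nat_def)+)
    qed
    show "s \<otimes>\<^bsub>sym_group 3\<^esub> s = (s \<circ> t) [^]\<^bsub>sym_group 3\<^esub> (0::nat)"
      by (simp add: sym_group_def s_def)
    have "s \<circ> (s \<circ> t) = s \<circ> t \<circ> (s \<circ> t) \<circ> s"
      by (auto simp: s_def t_def fun_eq_iff Transposition.transpose_def)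
    then show "s \<otimes>\<^bsub>sym_group 3\<^esub> (s \<circ> t) = (s \<circ> t) [^]\<^bsub>sym_group 3\<^esub> (2::nat) \<otimes>\<^bsub>sym_group 3\<^esub> s"
      unfolding pow by (simp add: sym_group_mult)
  qed simp
  show "card (carrier (sym_group 3)) = 2 * 3"
    by (simp add: sym_group_card_carrier fact_numeral)
qed

section \<open>Planarity of the independence graphs in the list\<close>

text \<open>Otherwise the remaining elements would generate the group. This is how edges are
  excluded for the noncyclic groups.\<close>

lemma (in group) minimal_generating_set_not_in:
  assumes "minimal_generating_set G X" "x \<in> X"
  shows "x \<notin> generate G (X - {x})"
proof
  assume x: "x \<in> generate G (X - {x})"
  have X: "X \<subseteq> carrier G" "generate G X = carrier G"
    using assms(1) by (auto simp: minimal_generating_set_def)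
  have "generate G (X - {x}) = carrier G"
  proof (rule generate_eq_carrierI[OF X])
    show "X \<subseteq> H" if "subgroup H G" "X - {x} \<subseteq> H" for H
      using generate_subgroup_incl[OF that(2,1)] x that(2) by auto
  qed (use X in auto)
  moreover have "X - {x} \<subset> X" using assms(2) by auto
  ultimately show False using assms(1) by (simp add: minimal_generating_set_def)
qed

lemma (in group) adjacent_not_one:
  assumes "adjacent G x y"
  shows "x \<noteq> \<one>" "y \<noteq> \<one>"
  using assms minimal_generating_set_not_in generate.one unfolding adjacent_def by metis+

lemma (in group) adjacent_not_inv:
  assumes "adjacent G x y"
  shows "y \<noteq> inv x"
proof
  assume y: "y = inv x"
  obtain X where X: "minimal_generating_set G X" "x \<in> X" "y \<in> X" "x \<noteq> y"
    using assms by (auto simp: adjacent_def)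
  have "inv x \<in> generate G (X - {y})"
    using X by (intro generate.inv) auto
  then show False using minimal_generating_set_not_in[OF X(1,3)] y by simp
qed

lemma K5_minus_edge_edges:
  fixes i j :: nat
  assumes "0 < i" "i < 6" "0 < j" "j < 6" "i \<noteq> j" "\<not> (i = 1 \<and> j = 2)" "\<not> (i = 2 \<and> j = 1)"
  shows "(i, j) \<in> set [(1, 3), (1, 4), (1, 5), (2, 3), (2, 4), (2, 5), (3, 4), (3, 5), (4, 5)] \<or>
    (j, i) \<in> set [(1, 3), (1, 4), (1, 5), (2, 3), (2, 4), (2, 5), (3, 4), (3, 5), (4, 5)]"
proof -
  have "i \<in> {1, 2, 3, 4, 5}" "j \<in> {1, 2, 3, 4, 5}" using assms by auto
  then show ?thesis using assms(5-) unfolding insert_iff empty_iff by (elim disjE FalseE) simp_all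
qed

text \<open>The numbering makes \<open>i div 2\<close> the name of an antipodal pair, with
  \<open>0\<close> for the isolated vertices.\<close>

lemma octahedron_edges:
  fixes i j :: nat
  assumes "i < 8" "j < 8" "i div 2 \<noteq> 0" "j div 2 \<noteq> 0" "i div 2 \<noteq> j div 2"
  shows "(i, j) \<in> set [(2, 4), (2, 5), (2, 6), (2, 7), (3, 4), (3, 5), (3, 6), (3, 7), (4, 6), (4, 7), (5, 6), (5, 7)] \<or>
    (j, i) \<in> set [(2, 4), (2, 5), (2, 6), (2, 7), (3, 4), (3, 5), (3, 6), (3, 7), (4, 6), (4, 7), (5, 6), (5, 7)]"
proof -
  have "2 \<le> i" "2 \<le> j" using assms(3,4) by auto
  then have "i \<in> {2, 3, 4, 5, 6, 7}" "j \<in> {2, 3, 4, 5, 6, 7}" using assms(1,2) by auto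
  then show ?thesis using assms(5) unfolding insert_iff empty_iff by (elim disjE FalseE) simp_all
qed

text \<open>The identity is isolated and \<open>r\<close> is not adjacent to its inverse, so
  \<open>r\<close> and \<open>inv r\<close> can be the ends of the missing edge; at most three
  elements are left for the triangle.\<close>

lemma (in group) planar_of_card_le_6:
  assumes "finite (carrier G)" "card (carrier G) \<le> 6" and r: "r \<in> carrier G" "r \<noteq> inv r"
  shows "planar (independence_graph G)"
proof -
  let ?R = "{\<one>, r, inv r}"
  have r1: "r \<noteq> \<one>" using r by auto
  then have "inv r \<noteq> \<one>" using r(1) by (metis inv_inv inv_one)
  then have "card ?R = 3" using r(2) r1 by (auto simp: card_insert_if)
  then have "card (carrier G - ?R) = card (carrier G) - 3"
    using r(1) by (subst card_Diff_subset) auto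
  then have "card (carrier G - ?R) \<le> card {3, 4, 5::nat}" using assms(2) by simp
  then obtain g where g: "g ` (carrier G - ?R) \<subseteq> {3, 4, 5::nat}" "inj_on g (carrier G - ?R)"
    using card_le_inj[of "carrier G - ?R" "{3, 4, 5::nat}"] assms(1) by auto
  define h where "h x = (if x = \<one> then 0 else if x = r then 1 else if x = inv r then 2 else g x)" for x
  have h: "h x \<in> {3, 4, 5}" if "x \<in> carrier G - ?R" for x
    using that g(1) by (auto simp: h_def)
  have inj: "inj_on h (carrier G)"
  proof (rule inj_onI)
    fix x y assume xy: "x \<in> carrier G" "y \<in> carrier G" "h x = h y"
    show "x = y"
    proof (cases "x \<in> ?R \<or> y \<in> ?R")
      case True
      then show ?thesis using xy h[of x] h[of y] r1 \<open>inv r \<noteq> \<one>\<close> r(2)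
        by (auto simp: h_def split: if_splits)
    next
      case False
      then have "g x = g y" using xy by (auto simp: h_def)
      then show ?thesis using g(2) xy False by (auto dest: inj_onD)
    qed
  qed
  show ?thesis
    unfolding independence_graph_adjacent
  proof (rule doubleton_graph_embed[OF planar_K5_minus_edge, of h])
    show "h ` carrier G \<subseteq> {..<6}"
    proof safe
      fix x assume "x \<in> carrier G"
      then show "h x < 6" using h[of x] by (auto simp: h_def)
    qed
    fix x y assume adj: "adjacent G x y"
    then have xy: "x \<in> carrier G" "y \<in> carrier G" "x \<noteq> y" by (auto simp: adjacent_def)
    have pos: "0 < h z \<and> h z < 6" if "z \<in> carrier G" "z \<noteq> \<one>" for z
      using that h[of z] by (cases "z \<in> ?R") (auto simp: h_def)
    have "h x \<noteq> h y" using inj xy by (auto dest: inj_onD)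
    moreover have "\<not> (h x = 1 \<and> h y = 2)" "\<not> (h x = 2 \<and> h y = 1)"
    proof -
      have R: "z \<in> ?R" if "z \<in> carrier G" "h z = 1 \<or> h z = 2" for z
      proof (rule ccontr)
        assume "z \<notin> ?R"
        then have "h z \<in> {3, 4, 5}" using that(1) by (intro h) simp
        then show False using that(2) by auto
      qed
      have val: "h \<one> = 0" "h r = 1" "h (inv r) = 2"
        using r1 \<open>inv r \<noteq> \<one>\<close> r(2) by (auto simp: h_def)
      have z: "z = r" if "z \<in> carrier G" "h z = 1" for z
        using R[of z] that val by auto
      have z': "z = inv r" if "z \<in> carrier G" "h z = 2" for z
        using R[of z] that val by auto
      show "\<not> (h x = 1 \<and> h y = 2)"
        using z[OF xy(1)] z'[OF xy(2)] adjacent_not_inv[OF adj] by auto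
      show "\<not> (h x = 2 \<and> h y = 1)"
        using z[OF xy(2)] z'[OF xy(1)] adjacent_not_inv[OF adjacent_commute[OF adj]] by auto
    qed
    ultimately show "x \<in> carrier G \<and> y \<in> carrier G \<and>
       ((h x, h y) \<in> set [(1, 3), (1, 4), (1, 5), (2, 3), (2, 4), (2, 5), (3, 4), (3, 5), (4, 5)] \<or>
        (h y, h x) \<in> set [(1, 3), (1, 4), (1, 5), (2, 3), (2, 4), (2, 5), (3, 4), (3, 5), (4, 5)])"
      using pos adjacent_not_one[OF adj] xy by (intro conjI K5_minus_edge_edges) simp_all
  qed (fact inj)
qed

text \<open>Here \<open>c\<close> plays the role of the map onto the quotient by the Frattini subgroup, a Klein four-group
  with elements \<open>0\<close>, \<open>1\<close>, \<open>2\<close>, \<open>3\<close>.\<close>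

lemma (in group) planar_of_labelling:
  assumes "inj_on h (carrier G)" "h ` carrier G \<subseteq> {..<8::nat}"
    and c: "\<And>x. x \<in> carrier G \<Longrightarrow> c x = h x div 2"
    and sub: "\<And>k. subgroup {x \<in> carrier G. c x = 0 \<or> c x = k} G"
    and proper: "\<And>k. {x \<in> carrier G. c x = 0 \<or> c x = k} \<noteq> carrier G"
    and gen: "\<And>x y. x \<in> carrier G \<Longrightarrow> y \<in> carrier G \<Longrightarrow> c x \<noteq> 0 \<Longrightarrow> c y \<noteq> 0 \<Longrightarrow> c x \<noteq> c y \<Longrightarrow>
          generate G {x, y} = carrier G"
  shows "planar (independence_graph G)"
proof -
  have redundant: False
    if X: "minimal_generating_set G X" "x \<in> X" and x: "c x = 0 \<or> (\<exists>y\<in>X - {x}. c x = c y)" for X x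
  proof -
    have XG: "X \<subseteq> carrier G" "generate G X = carrier G"
      using X(1) by (auto simp: minimal_generating_set_def)
    have notin: "\<not> X \<subseteq> {x \<in> carrier G. c x = 0 \<or> c x = k}" for k
    proof
      assume XM: "X \<subseteq> {x \<in> carrier G. c x = 0 \<or> c x = k}"
      have "carrier G \<subseteq> {x \<in> carrier G. c x = 0 \<or> c x = k}"
        using generate_subgroup_incl[OF XM sub] unfolding XG(2) .
      then have "{x \<in> carrier G. c x = 0 \<or> c x = k} = carrier G" by (intro subset_antisym) auto
      then show False using proper[of k] by simp
    qed
    \<comment> \<open>The proper subgroups for \<open>k = 0\<close> and \<open>k = c s\<close> each
      miss some element of \<open>X\<close>.\<close>
    obtain s where s: "s \<in> X" "c s \<noteq> 0" using notin[of 0] XG(1) by auto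
    obtain t where t: "t \<in> X" "c t \<noteq> 0" "c t \<noteq> c s" using notin[of "c s"] XG(1) by auto
    have other: "\<exists>z\<in>X - {x}. c z = c u" if "u \<in> X" "c u \<noteq> 0" for u
      using that x by (cases "u = x") auto
    obtain s' t' where st: "s' \<in> X - {x}" "c s' = c s" "t' \<in> X - {x}" "c t' = c t"
      using other[OF s] other[OF t(1,2)] by blast
    then have "generate G {s', t'} = carrier G" using s t XG(1) by (intro gen) auto
    then have "carrier G \<subseteq> generate G (X - {x})"
      using mono_generate[of "{s', t'}" "X - {x}"] st by auto
    then show False using minimal_generating_set_not_in[OF X] X(2) XG(1) by blast
  qed
  show ?thesis
    unfolding independence_graph_adjacent
  proof (rule doubleton_graph_embed[OF planar_octahedron assms(1,2)])
    fix x y assume adj: "adjacent G x y"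
    then obtain X where X: "minimal_generating_set G X" "x \<in> X" "y \<in> X"
      and xy: "x \<in> carrier G" "y \<in> carrier G" "x \<noteq> y" by (auto simp: adjacent_def)
    have "c x \<noteq> 0" by (rule notI) (rule redundant[OF X(1,2)], simp)
    moreover have "c y \<noteq> 0" by (rule notI) (rule redundant[OF X(1,3)], simp)
    moreover have "c x \<noteq> c y"
    proof
      assume "c x = c y"
      then have "\<exists>z\<in>X - {x}. c x = c z" using X(3) xy(3) by (intro bexI[of _ y]) auto
      then show False by (intro redundant[OF X(1,2)] disjI2)
    qed
    ultimately have "h x div 2 \<noteq> 0" "h y div 2 \<noteq> 0" "h x div 2 \<noteq> h y div 2" using c xy by auto
    moreover have "h x < 8" "h y < 8" using assms(2) xy by auto
    ultimately show "x \<in> carrier G \<and> y \<in> carrier G \<and>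
       ((h x, h y) \<in> set [(2, 4), (2, 5), (2, 6), (2, 7), (3, 4), (3, 5), (3, 6), (3, 7), (4, 6), (4, 7), (5, 6), (5, 7)] \<or>
        (h y, h x) \<in> set [(2, 4), (2, 5), (2, 6), (2, 7), (3, 4), (3, 5), (3, 6), (3, 7), (4, 6), (4, 7), (5, 6), (5, 7)])"
      using xy by (intro conjI octahedron_edges) simp_all
  qed
qed

text \<open>As \<open>m\<close> and \<open>k\<close> are even and \<open>e\<close> is odd, the
  parities of \<open>i\<close> and \<open>j\<close> in \<open>a^i b^j\<close> define a homomorphism
  onto a Klein four-group; \<open>c\<close> writes them as two binary digits. The last digit of
  \<open>h\<close> is \<open>i div 2\<close>, which makes \<open>h\<close> injective.\<close>

lemma (in group) planar_of_metacyclic_pair: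
  assumes pair: "metacyclic_pair G m k e a b" and m: "m = 2 \<or> m = 4" and "odd e" "even k"
    and card: "card (carrier G) = 2 * m"
  shows "planar (independence_graph G)"
proof -
  let ?g = "\<lambda>p. a [^] (fst p::nat) \<otimes> b [^] (snd p::nat)"
  have m0: "0 < m" using m by auto
  note carr = metacyclic_carrier[OF pair m0] and eq_iff = metacyclic_eq_iff[OF pair m0]
  have fin: "finite (carrier G)" using card m0 by (intro card_ge_0_finite) simp
  have inj_g: "inj_on ?g ({..<m} \<times> {..<2})"
    by (rule inj_onI) (auto simp: eq_iff)
  have "?g ` ({..<m} \<times> {..<2}) \<subseteq> carrier G" using carr by auto
  moreover have "card (?g ` ({..<m} \<times> {..<2})) = card (carrier G)"
    using inj_g card by (simp add: card_image card_cartesian_product)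
  ultimately have im_g: "?g ` ({..<m} \<times> {..<2}) = carrier G"
    using fin by (simp add: card_subset_eq)
  define d where "d = inv_into ({..<m} \<times> {..<2}) ?g"
  have d: "fst (d x) < m" "snd (d x) < 2" "?g (d x) = x" if "x \<in> carrier G" for x
  proof -
    have "d x \<in> {..<m} \<times> {..<2}" unfolding d_def using that im_g by (intro inv_into_into) simp
    then show "fst (d x) < m" "snd (d x) < 2" by auto
    show "?g (d x) = x" unfolding d_def using that im_g by (intro f_inv_into_f) simp
  qed
  have d_div: "fst (d x) div 2 < 2" if "x \<in> carrier G" for x
  proof -
    have "fst (d x) < 4" using d(1)[OF that] m by auto
    then show ?thesis by simp
  qed
  define c where "c x = fst (d x) mod 2 + 2 * (snd (d x) mod 2)" for x
  have c4: "c x < 4" for x unfolding c_def by presburger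
  define h where "h x = 2 * c x + fst (d x) div 2" for x
  have c_g: "c (a [^] i \<otimes> b [^] j) = i mod 2 + 2 * (j mod 2)" for i j :: nat
  proof -
    let ?x = "a [^] i \<otimes> b [^] j"
    have "?g (d ?x) = ?x" using carr by (intro d) simp
    then have *: "snd (d ?x) mod 2 = j mod 2"
      "(fst (d ?x) + k * (snd (d ?x) div 2)) mod m = (i + k * (j div 2)) mod m"
      unfolding eq_iff by auto
    have "even m" using m by auto
    then have "(fst (d ?x) + k * (snd (d ?x) div 2)) mod 2 = (i + k * (j div 2)) mod 2"
      using arg_cong[OF *(2), of "\<lambda>n. n mod 2"] by (simp add: mod_mod_cancel)
    then have "fst (d ?x) mod 2 = i mod 2" using \<open>even k\<close> by (auto simp: mod2_eq_if)
    then show ?thesis using * by (simp add: c_def)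
  qed
  \<comment> \<open>The binary digits are added separately modulo 2, which is the law of the Klein
    four-group.\<close>
  have mult: "c (x \<otimes> y) = (c x + c y) mod 2 + 2 * ((c x div 2 + c y div 2) mod 2)"
    if xy: "x \<in> carrier G" "y \<in> carrier G" for x y
  proof -
    obtain i j i' j' where x: "x = a [^] (i::nat) \<otimes> b [^] (j::nat)" and y: "y = a [^] (i'::nat) \<otimes> b [^] (j'::nat)"
      using d(3)[OF xy(1)] d(3)[OF xy(2)] by metis
    have "odd (e ^ j)" using \<open>odd e\<close> by simp
    then show ?thesis
      unfolding x y metacyclic_mult[OF pair m0] c_g by (auto simp: mod2_eq_if)
  qed
  show ?thesis
  proof (rule planar_of_labelling[of h c])
    show "inj_on h (carrier G)"
    proof (rule inj_onI)
      fix x y assume xy: "x \<in> carrier G" "y \<in> carrier G" "h x = h y"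
      have lt: "fst (d x) div 2 < 2" "fst (d y) div 2 < 2" by (rule d_div[OF xy(1)], rule d_div[OF xy(2)])
      have cc: "c x = c y" "fst (d x) div 2 = fst (d y) div 2"
        using xy(3) lt unfolding h_def by arith+
      have "fst (d x) mod 2 = c x mod 2" "fst (d y) mod 2 = c y mod 2" by (simp_all add: c_def)
      then have "fst (d x) = fst (d y)" using cc by (metis div_mult_mod_eq)
      moreover have "snd (d x) = c x div 2" "snd (d y) = c y div 2"
        using d(2)[OF xy(1)] d(2)[OF xy(2)] by (simp_all add: c_def)
      ultimately show "x = y" using d(3)[OF xy(1)] d(3)[OF xy(2)] cc by metis
    qed
    show "h ` carrier G \<subseteq> {..<8}"
    proof safe
      fix x assume "x \<in> carrier G"
      then have "fst (d x) div 2 < 2" by (rule d_div)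
      then show "h x < 8" using c4[of x] by (simp add: h_def)
    qed
    show "c x = h x div 2" if "x \<in> carrier G" for x
      using d_div[OF that] by (simp add: h_def)
    have c_one: "c \<one> = 0" using c_g[of 0 0] by simp
    have c_a: "c a = 1" using c_g[of 1 0] carr by simp
    have c_b: "c b = 2" using c_g[of 0 1] carr by simp
    show "subgroup {x \<in> carrier G. c x = 0 \<or> c x = k'} G" for k'
    proof (rule finite_subgroupI[OF fin])
      fix x y assume "x \<in> {x \<in> carrier G. c x = 0 \<or> c x = k'}" "y \<in> {x \<in> carrier G. c x = 0 \<or> c x = k'}"
      then have xy: "x \<in> carrier G" "y \<in> carrier G" "c x = 0 \<or> c x = k'" "c y = 0 \<or> c y = k'" by auto
      have "c x \<in> {0, 1, 2, 3}" "c y \<in> {0, 1, 2, 3}"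
        using c4[of x] c4[of y] by auto
      then have "c (x \<otimes> y) = 0 \<or> c (x \<otimes> y) = k'" unfolding mult[OF xy(1,2)] using xy(3,4) by auto
      then show "x \<otimes> y \<in> {x \<in> carrier G. c x = 0 \<or> c x = k'}" using xy by auto
    qed (use c_one in auto)
    show "{x \<in> carrier G. c x = 0 \<or> c x = k'} \<noteq> carrier G" for k'
    proof
      assume eq: "{x \<in> carrier G. c x = 0 \<or> c x = k'} = carrier G"
      have "a \<in> {x \<in> carrier G. c x = 0 \<or> c x = k'}" "b \<in> {x \<in> carrier G. c x = 0 \<or> c x = k'}"
        unfolding eq using carr by auto
      then show False using c_a c_b by simp
    qed
  next
    fix x y assume xy: "x \<in> carrier G" "y \<in> carrier G" "c x \<noteq> 0" "c y \<noteq> 0" "c x \<noteq> c y"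
    have ab: "{a, b} \<subseteq> carrier G" using carr by simp
    have S: "subgroup (generate G {a, b}) G" by (rule generate_is_subgroup[OF ab])
    have pow: "u [^] (n::nat) \<in> generate G {a, b}" if "u \<in> {a, b}" for u n
    proof (induction n)
      case (Suc n)
      then show ?case
        unfolding nat_pow_Suc by (intro subgroup.m_closed[OF S] generate.incl[OF that])
    qed (simp add: generate.one)
    have "z \<in> generate G {a, b}" if "z \<in> carrier G" for z
    proof -
      have "a [^] fst (d z) \<otimes> b [^] snd (d z) \<in> generate G {a, b}"
        by (intro subgroup.m_closed[OF S] pow) simp_all
      then show ?thesis unfolding d(3)[OF that] .
    qed
    then have gen: "generate G {a, b} = carrier G"
      using generate_incl[OF ab] by (intro subset_antisym subsetI) auto
    show "generate G {x, y} = carrier G"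
    proof (rule generate_eq_carrierI[OF _ gen])
      show "{a, b} \<subseteq> H" if H: "subgroup H G" "{x, y} \<subseteq> H" for H
      proof -
        have pow: "u [^] (n::nat) \<in> H" if "u \<in> H" for u n
          using that by (induction n) (simp_all add: subgroup.one_closed[OF H(1)] subgroup.m_closed[OF H(1)])
        have c123: "c x \<in> {1, 2, 3}" "c y \<in> {1, 2, 3}"
          using xy(3,4) c4[of x] c4[of y] by auto
        have "x \<otimes> y \<in> H" using H by (simp add: subgroup.m_closed)
        \<comment> \<open>Two different nonzero colours and their sum are all three nonzero colours,
          so \<open>1\<close>, the colour of \<open>a\<close>, occurs.\<close>
        moreover have "c x = 1 \<or> c y = 1 \<or> c (x \<otimes> y) = 1"
          unfolding mult[OF xy(1,2)] using c123 xy(5) by auto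
        ultimately obtain z where z: "z \<in> H" "c z = 1" using H by blast
        then have "z \<in> carrier G" using subgroup.mem_carrier[OF H(1)] by blast
        define i where "i = fst (d z)"
        have "snd (d z) = 0" "odd i"
          using z(2) d(2)[OF \<open>z \<in> carrier G\<close>] by (auto simp: c_def i_def)
        then have zi: "z = a [^] i" using d(3)[OF \<open>z \<in> carrier G\<close>] carr by (simp add: i_def)
        \<comment> \<open>An odd \<open>i < 4\<close> is its own inverse modulo \<open>m\<close>, so
          the \<open>i\<close>-th power of \<open>z = a^i\<close> is \<open>a\<close>
          itself.\<close>
        have "i * i mod m = 1 mod m"
        proof -
          have "i < 4" using d(1)[OF \<open>z \<in> carrier G\<close>] m by (auto simp: i_def)
          then have "i = 1 \<or> i = 3" using \<open>odd i\<close> by presburger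
          then show ?thesis using m by auto
        qed
        then have "z [^] i = a [^] (1::nat)"
          unfolding zi using carr pow_eq_pow_iff[OF carr(1), of "i * i" 1] pair
          by (simp add: nat_pow_pow metacyclic_pair_def)
        then have aH: "a \<in> H" using pow[OF z(1), of i] carr by simp
        \<comment> \<open>An element whose colour is neither \<open>0\<close> nor \<open>1\<close>
          has the form \<open>a^i b\<close>; cancelling the power of \<open>a\<close> gives
          \<open>b\<close>.\<close>
        have "c x \<noteq> 1 \<or> c y \<noteq> 1" using xy(5) by auto
        then obtain v where v: "v \<in> H" "c v \<noteq> 1" "c v \<noteq> 0" using H xy by blast
        then have vG: "v \<in> carrier G" using subgroup.mem_carrier[OF H(1)] by blast
        have "snd (d v) = 1" using v(2,3) d(2)[OF vG] by (auto simp: c_def)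
        then have "v = a [^] fst (d v) \<otimes> b" using d(3)[OF vG] carr by simp
        then have "b \<in> H"
          using subgroup_mult_left_iff[OF H(1) pow[OF aH] carr(2)] v(1) by metis
        then show ?thesis using aH by simp
      qed
    qed (use xy carr in auto)
  qed
qed

text \<open>The hubs sit at the imaginary units, all other vertices on the positive real axis;
  \<open>Suc\<close> keeps them off the line through the hubs.\<close>

lemma planar_two_hubs:
  fixes r :: "'a \<Rightarrow> nat"
  assumes "inj_on r V" and S: "\<And>x y. S x y \<Longrightarrow> x \<in> V \<and> y \<in> V \<and> (x = p \<or> x = q) \<and> y \<noteq> p \<and> y \<noteq> q"
  shows "planar (V, {{x, y} | x y. S x y})"
proof -
  define f where "f v = (if v = p then Complex 0 1 else if v = q then Complex 0 (-1)
      else Complex (real (Suc (r v))) 0)" for v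
  have leaf: "f y = Complex (real (Suc (r y))) 0" if "y \<noteq> p" "y \<noteq> q" for y
    using that by (simp add: f_def)
  have hub: "f x = Complex 0 1 \<or> f x = Complex 0 (-1)" if "x = p \<or> x = q" for x
    using that by (auto simp: f_def)
  have r_eq: "r x = r y \<longleftrightarrow> x = y" if "x \<in> V" "y \<in> V" for x y
    using assms(1) that by (auto simp: inj_on_def)
  have inj: "inj_on f V"
  proof (rule inj_onI)
    fix x y assume "x \<in> V" "y \<in> V" "f x = f y"
    then show "x = y" using r_eq[of x y] by (auto simp: f_def split: if_splits)
  qed
  show ?thesis
  proof (rule straight_line_drawing[OF inj])
    show "x \<in> V \<and> y \<in> V \<and> x \<noteq> y" if "S x y" for x y using S[OF that] by auto
  next
    fix x y z assume *: "S x y" "z \<in> V" "z \<noteq> x" "z \<noteq> y"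
    have "orientation (f x) (f y) (f z) \<noteq> 0"
    proof (cases "z = p \<or> z = q")
      case True
      have "f z \<noteq> f x" using inj * S[OF *(1)] by (auto dest: inj_onD)
      then show ?thesis using hub[OF True] hub[of x] leaf[of y] S[OF *(1)] by (auto simp: orientation_def)
    next
      case False
      have "r z \<noteq> r y" using r_eq * S[OF *(1)] by simp
      then show ?thesis using leaf[of z] False hub[of x] leaf[of y] S[OF *(1)] by (auto simp: orientation_def)
    qed
    then show "f z \<notin> closed_segment (f x) (f y)" using orientation_on_segment by blast
  next
    fix x y z assume *: "S x y \<or> S y x" "S x z \<or> S z x" "y \<noteq> z"
    have "orientation (f x) (f y) (f z) \<noteq> 0"
    proof (cases "x = p \<or> x = q")
      case True
      then have "S x y" "S x z" using * S by blast+
      then have "r y \<noteq> r z" using r_eq *(3) S by metis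
      then show ?thesis using hub[OF True] leaf[of y] leaf[of z] S[OF \<open>S x y\<close>] S[OF \<open>S x z\<close>]
        by (auto simp: orientation_def)
    next
      case False
      then have "S y x" "S z x" using * S by blast+
      then have "f y \<noteq> f z" using inj *(3) S by (metis inj_onD)
      then show ?thesis using hub[of y] hub[of z] leaf[of x] S[OF \<open>S y x\<close>] S[OF \<open>S z x\<close>]
        by (auto simp: orientation_def)
    qed
    then show "closed_segment (f x) (f y) \<inter> closed_segment (f x) (f z) \<subseteq> {f x}"
      using segments_common_end by simp
  next
    fix x y u v assume *: "S x y" "S u v" "{x, y} \<inter> {u, v} = {}"
    have "x \<noteq> u" "y \<noteq> v" using *(3) by auto
    then have "f x \<noteq> f u" "r y \<noteq> r v"
      using inj r_eq S[OF *(1)] S[OF *(2)] by (auto dest: inj_onD)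
    \<comment> \<open>The edge with the leaf nearer to the origin lies strictly on one side of the
      line through the other edge.\<close>
    then have "orientation (f x) (f y) (f u) * orientation (f x) (f y) (f v) > 0 \<or>
        orientation (f u) (f v) (f x) * orientation (f u) (f v) (f y) > 0"
      using hub[of x] hub[of u] leaf[of y] leaf[of v] S[OF *(1)] S[OF *(2)]
      by (auto simp: orientation_def zero_less_mult_iff)
    then show "closed_segment (f x) (f y) \<inter> closed_segment (f u) (f v) = {}"
    proof
      assume "orientation (f u) (f v) (f x) * orientation (f u) (f v) (f y) > 0"
      from segments_disjoint[OF this] show ?thesis by (simp add: Int_commute)
    qed (rule segments_disjoint)
  qed
qed

section \<open>Generation and adjacency in cyclic groups\<close>

context
  fixes n :: nat
  assumes n: "1 < n"
begin

lemma Zn_carrier: "carrier (integer_mod_group n) = {0..<int n}"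
  using n by (simp add: carrier_integer_mod_group)

text \<open>Bezout, applied twice, writes 1 modulo \<open>n\<close> as a combination of
  \<open>s\<close> and \<open>t\<close>; multiplying by \<open>x\<close> gives the
  exponents.\<close>

lemma Zn_generate:
  assumes "s \<in> carrier (integer_mod_group n)" "t \<in> carrier (integer_mod_group n)" "gcd (gcd s t) (int n) = 1"
  shows "generate (integer_mod_group n) {s, t} = carrier (integer_mod_group n)" (is "generate ?Z _ = _")
proof -
  interpret group ?Z by simp
  have sub: "{s, t} \<subseteq> carrier ?Z" using assms by simp
  have H: "subgroup (generate ?Z {s, t}) ?Z" by (rule generate_is_subgroup[OF sub])
  obtain u v where uv: "u * s + v * t = gcd s t" using bezout_int by blast
  obtain u' v' where uv': "u' * gcd s t + v' * int n = 1" using bezout_int[of "gcd s t" "int n"] assms(3) by auto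
  have "x \<in> generate ?Z {s, t}" if x: "x \<in> carrier ?Z" for x
  proof -
    have "s [^]\<^bsub>?Z\<^esub> (x * u' * u) \<in> generate ?Z {s, t}" "t [^]\<^bsub>?Z\<^esub> (x * u' * v) \<in> generate ?Z {s, t}"
      by (auto intro: subgroup_int_pow_closed[OF H] generate.incl)
    then have "s [^]\<^bsub>?Z\<^esub> (x * u' * u) \<otimes>\<^bsub>?Z\<^esub> t [^]\<^bsub>?Z\<^esub> (x * u' * v) \<in> generate ?Z {s, t}"
      by (rule subgroup.m_closed[OF H])
    moreover have "s [^]\<^bsub>?Z\<^esub> (x * u' * u) \<otimes>\<^bsub>?Z\<^esub> t [^]\<^bsub>?Z\<^esub> (x * u' * v) = x"
    proof -
      have "s [^]\<^bsub>?Z\<^esub> (x * u' * u) \<otimes>\<^bsub>?Z\<^esub> t [^]\<^bsub>?Z\<^esub> (x * u' * v) = (x * u' * u * s + x * u' * v * t) mod int n"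
        using assms(1,2) by (simp add: int_pow_integer_mod_group mod_simps)
      also have "x * u' * u * s + x * u' * v * t = x * (u' * gcd s t)"
        unfolding uv[symmetric] by (simp add: algebra_simps)
      also have "u' * gcd s t = 1 - v' * int n" using uv' by simp
      also have "x * (1 - v' * int n) mod int n = x mod int n"
        by (simp add: algebra_simps mod_diff_eq[symmetric])
      also have "\<dots> = x" using x by (simp add: Zn_carrier)
      finally show ?thesis .
    qed
    ultimately show ?thesis by simp
  qed
  then show ?thesis using generate_incl[OF sub] by auto
qed

text \<open>The multiples of \<open>d\<close> form a subgroup because \<open>d\<close> divides
  \<open>n\<close>, and \<open>1\<close> is not among them.\<close>

lemma Zn_not_generate:
  assumes "X \<subseteq> carrier (integer_mod_group n)" "d dvd int n" "\<bar>d\<bar> \<noteq> 1" "\<And>x. x \<in> X \<Longrightarrow> d dvd x"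
  shows "generate (integer_mod_group n) X \<noteq> carrier (integer_mod_group n)" (is "generate ?Z _ \<noteq> _")
proof
  interpret group ?Z by simp
  let ?M = "{x \<in> carrier ?Z. d dvd x}"
  assume gen: "generate ?Z X = carrier ?Z"
  have "subgroup ?M ?Z"
  proof (rule subgroupI)
    show "?M \<noteq> {}" by (auto intro!: exI[of _ 0])
    show "inv\<^bsub>?Z\<^esub> x \<in> ?M" if "x \<in> ?M" for x
      using that assms(2) inv_closed[of x] by (auto simp: dvd_mod)
    show "x \<otimes>\<^bsub>?Z\<^esub> y \<in> ?M" if "x \<in> ?M" "y \<in> ?M" for x y
      using that assms(2) m_closed[of x y] by (auto simp: dvd_mod)
  qed auto
  then have "generate ?Z X \<subseteq> ?M" using assms(1,4) by (intro generate_subgroup_incl) auto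
  moreover have "1 \<in> carrier ?Z" using n by (simp add: Zn_carrier)
  ultimately have "d dvd 1" unfolding gen by blast
  then show False using assms(3) by simp
qed

lemma Zn_adjacentI:
  assumes "s \<in> carrier (integer_mod_group n)" "t \<in> carrier (integer_mod_group n)"
    and st: "gcd (gcd s t) (int n) = 1" and s: "gcd s (int n) \<noteq> 1" and t: "gcd t (int n) \<noteq> 1"
  shows "adjacent (integer_mod_group n) s t"
proof -
  let ?Z = "integer_mod_group n"
  have "generate ?Z Y \<noteq> carrier ?Z" if "Y \<subset> {s, t}" for Y
  proof -
    have "Y \<subseteq> {s} \<or> Y \<subseteq> {t}" using that by auto
    then show ?thesis
    proof
      assume Y: "Y \<subseteq> {s}"
      show ?thesis
        by (rule Zn_not_generate[of _ "gcd s (int n)"]) (use Y assms in auto)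
    next
      assume Y: "Y \<subseteq> {t}"
      show ?thesis
        by (rule Zn_not_generate[of _ "gcd t (int n)"]) (use Y assms in auto)
    qed
  qed
  then have "minimal_generating_set ?Z {s, t}"
    using Zn_generate[OF assms(1-3)] assms(1,2) by (simp add: minimal_generating_set_def)
  moreover have "s \<noteq> t" using st s by auto
  ultimately show ?thesis using assms(1,2) unfolding adjacent_def by blast
qed

text \<open>A minimal generating set contains some \<open>s\<close> prime to \<open>p\<close> and
  some \<open>t\<close> prime to \<open>q\<close>; these generate, so nothing else is in it. If one
  of them served for both primes it would be the whole set, which has at least two elements. For
  \<open>p = q\<close> the conclusion says that there are no edges.\<close>

lemma Zn_adjacent_two_primes:
  assumes p: "prime p" and q: "prime q" and pn: "p dvd n" and qn: "q dvd n"
    and only: "\<And>r. prime r \<Longrightarrow> r dvd n \<Longrightarrow> r = p \<or> r = q"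
    and adj: "adjacent (integer_mod_group n) x y"
  shows "p \<noteq> q \<and> (int q dvd x \<and> \<not> int p dvd x \<and> int p dvd y \<and> \<not> int q dvd y \<or>
         int q dvd y \<and> \<not> int p dvd y \<and> int p dvd x \<and> \<not> int q dvd x)"
proof -
  let ?Z = "integer_mod_group n"
  obtain X where X: "minimal_generating_set ?Z X" "x \<in> X" "y \<in> X" "x \<noteq> y"
    using adj by (auto simp: adjacent_def)
  have XZ: "X \<subseteq> carrier ?Z" "generate ?Z X = carrier ?Z"
    using X(1) by (auto simp: minimal_generating_set_def)
  have outside: "\<exists>s\<in>X. \<not> int r dvd s" if "prime r" "r dvd n" for r
    using Zn_not_generate[OF XZ(1), of "int r"] XZ(2) that by (auto simp: prime_nat_iff)
  have gen: "generate ?Z {s, t} = carrier ?Z"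
    if "s \<in> X" "t \<in> X" "\<not> int p dvd s" "\<not> int q dvd t" for s t
  proof (rule Zn_generate)
    show "s \<in> carrier ?Z" "t \<in> carrier ?Z" using that XZ(1) by auto
    show "gcd (gcd s t) (int n) = 1"
    proof (rule ccontr)
      assume "gcd (gcd s t) (int n) \<noteq> 1"
      then have "nat (gcd (gcd s t) (int n)) \<noteq> 1" by simp
      then obtain r where r: "prime r" "r dvd nat (gcd (gcd s t) (int n))" using prime_factor_nat by blast
      have "int r dvd int (nat (gcd (gcd s t) (int n)))"
        using r(2) unfolding of_nat_dvd_iff .
      then have "int r dvd gcd (gcd s t) (int n)" by simp
      then have "int r dvd s" "int r dvd t" "r dvd n" by auto
      then show False using only[OF r(1)] that by auto
    qed
  qed
  obtain s where s: "s \<in> X" "\<not> int p dvd s" using outside[OF p pn] by blast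
  obtain t where t: "t \<in> X" "\<not> int q dvd t" using outside[OF q qn] by blast
  have eq: "X = {u, v}" if "u \<in> X" "v \<in> X" "generate ?Z {u, v} = carrier ?Z" for u v
  proof (rule ccontr)
    assume "X \<noteq> {u, v}"
    then have "{u, v} \<subset> X" using that(1,2) by auto
    then show False using X(1) that(3) by (simp add: minimal_generating_set_def)
  qed
  have "int q dvd s"
  proof (rule ccontr)
    assume "\<not> int q dvd s"
    then have "X = {s, s}" by (rule eq[OF s(1) s(1) gen[OF s(1) s(1) s(2)]])
    then show False using X by auto
  qed
  moreover have "int p dvd t"
  proof (rule ccontr)
    assume "\<not> int p dvd t"
    then have "X = {t, t}" by (intro eq[OF t(1) t(1) gen[OF t(1) t(1) _ t(2)]])
    then show False using X by auto
  qed
  moreover have "X = {s, t}" by (rule eq[OF s(1) t(1) gen[OF s(1) t(1) s(2) t(2)]])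
  ultimately show ?thesis using s t X by auto
qed

end

text \<open>The hubs are the residues divisible by \<open>q\<close> but not by \<open>p\<close>, at
  most two by hypothesis. The other end of every edge is divisible by \<open>p\<close>, hence no
  hub.\<close>

lemma planar_Zn_two_primes:
  assumes p: "prime p" and q: "prime q" and pn: "p dvd n" and qn: "q dvd n" and n: "0 < n"
    and only: "\<And>r. prime r \<Longrightarrow> r dvd n \<Longrightarrow> r = p \<or> r = q"
    and hubs: "\<And>s. 0 \<le> s \<Longrightarrow> s < int n \<Longrightarrow> int q dvd s \<Longrightarrow> \<not> int p dvd s \<Longrightarrow> s = h \<or> s = h'"
    and ph: "\<not> int p dvd h" "\<not> int p dvd h'"
  shows "planar (independence_graph (integer_mod_group n))"
proof -
  let ?Z = "integer_mod_group n"
  have n1: "1 < n" using prime_gt_1_nat[OF p] dvd_imp_le[OF pn n] by linarith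
  let ?S = "\<lambda>x y. adjacent ?Z x y \<and> (x = h \<or> x = h') \<and> y \<noteq> h \<and> y \<noteq> h'"
  have "inj_on nat (carrier ?Z)" using n by (auto simp: carrier_integer_mod_group inj_on_def)
  then have "planar (carrier ?Z, {{x, y} | x y. ?S x y})"
    by (rule planar_two_hubs[of _ _ _ h h']) (auto simp: adjacent_def)
  then show ?thesis
    unfolding independence_graph_adjacent
  proof (rule doubleton_graph_embed[where h = "\<lambda>x. x"])
    fix x y assume adj: "adjacent ?Z x y"
    then have xy: "x \<in> carrier ?Z" "y \<in> carrier ?Z" by (auto simp: adjacent_def)
    have "int q dvd x \<and> \<not> int p dvd x \<and> int p dvd y \<or> int q dvd y \<and> \<not> int p dvd y \<and> int p dvd x"
      using Zn_adjacent_two_primes[OF n1 p q pn qn only adj] by blast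
    then have "?S x y \<or> ?S y x"
      using hubs[of x] hubs[of y] xy ph adj adjacent_commute[OF adj] n
      by (auto simp: carrier_integer_mod_group)
    then show "x \<in> carrier ?Z \<and> y \<in> carrier ?Z \<and> (?S x y \<or> ?S y x)" using xy by blast
  qed auto
qed

text \<open>\<open>primepow\<close> excludes 1, so the trivial group is treated by itself.\<close>

lemma planar_Z1: "planar (independence_graph (integer_mod_group 1))"
proof -
  have "planar (carrier (integer_mod_group 1), {{x, y} | x y. False})"
    by (rule planar_two_hubs[of nat]) (auto simp: carrier_integer_mod_group inj_on_def)
  then show ?thesis
    unfolding independence_graph_adjacent
    by (rule doubleton_graph_embed[where h = "\<lambda>x. x"])
      (auto simp: adjacent_def carrier_integer_mod_group)
qed

lemma planar_Zn_primepow: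
  assumes "primepow n"
  shows "planar (independence_graph (integer_mod_group n))"
proof -
  let ?Z = "integer_mod_group n"
  obtain p k where p: "prime p" "0 < k" "n = p ^ k" using assms by (auto simp: primepow_def)
  then have n1: "1 < n" by (metis one_less_power prime_gt_1_nat)
  have pn: "p dvd n" using p by simp
  have only: "r = p \<or> r = p" if "prime r" "r dvd n" for r
    using that p by (metis prime_dvd_power primes_dvd_imp_eq)
  have non: "\<not> adjacent ?Z x y" for x y
    using Zn_adjacent_two_primes[OF n1 p(1) p(1) pn pn only] by blast
  have "planar (carrier ?Z, {{x, y} | x y. False})"
    by (rule planar_two_hubs[of nat]) (use n1 in \<open>auto simp: carrier_integer_mod_group inj_on_def\<close>)
  then show ?thesis
    unfolding independence_graph_adjacent
    by (rule doubleton_graph_embed[where h = "\<lambda>x. x"]) (auto simp: non)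
qed

text \<open>The hubs are the multiples \<open>t q\<close> with \<open>0 < t < p\<close>; the bound
  on \<open>p\<close> leaves only \<open>t = 1\<close> and \<open>t = p - 1\<close>, which coincide
  for \<open>p = 2\<close>.\<close>

lemma planar_Zpq:
  assumes p: "prime p" and q: "prime q" and "p \<noteq> q" and "p \<le> 3"
  shows "planar (independence_graph (integer_mod_group (p * q)))"
proof (rule planar_Zn_two_primes[OF p q, of _ "int q" "int (p - 1) * int q"])
  have nq: "\<not> p dvd q" using assms by (metis primes_dvd_imp_eq)
  have p23: "p = 2 \<or> p = 3" using prime_ge_2_nat[OF p] assms(4) by auto
  have p0: "0 < p" "0 < q" using p q by (auto simp: prime_gt_0_nat)
  then show "0 < p * q" by simp
  show "r = p \<or> r = q" if "prime r" "r dvd p * q" for r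
    using that p q by (metis prime_dvd_mult_iff primes_dvd_imp_eq)
  show "\<not> int p dvd int q" using nq by simp
  have "\<not> p dvd p - 1" using p23 by auto
  then have "\<not> p dvd (p - 1) * q" using nq p by (simp add: prime_dvd_mult_iff)
  then show "\<not> int p dvd int (p - 1) * int q" by (metis of_nat_dvd_iff of_nat_mult)
  fix s assume s: "0 \<le> s" "s < int (p * q)" "int q dvd s" "\<not> int p dvd s"
  then obtain t where t: "s = int q * t" by auto
  have "0 \<le> t" using s(1) p0 by (simp add: t zero_le_mult_iff)
  have "int q * t < int q * int p" using s(2) by (simp add: t mult.commute)
  then have "t < int p" using p0 by simp
  have "t \<noteq> 0" using s(4) by (auto simp: t)
  then have "t = 1 \<or> t = int (p - 1)" using \<open>0 \<le> t\<close> \<open>t < int p\<close> p23 by auto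
  then show "s = int q \<or> s = int (p - 1) * int q" by (auto simp: t)
qed auto

text \<open>With 2 in the role of \<open>p\<close>, the hubs are the odd multiples of
  \<open>q\<close> below \<open>4 q\<close>.\<close>

lemma planar_Z4q:
  assumes q: "prime q" and "odd q"
  shows "planar (independence_graph (integer_mod_group (4 * q)))"
proof (rule planar_Zn_two_primes[OF two_is_prime_nat q, of _ "int q" "3 * int q"])
  have q0: "0 < q" using q by (simp add: prime_gt_0_nat)
  then show "0 < 4 * q" by simp
  show "r = 2 \<or> r = q" if "prime r" "r dvd 4 * q" for r
  proof -
    have "r dvd 2 * (2 * q)" using that by simp
    then show ?thesis using that(1) q by (metis prime_dvd_mult_iff primes_dvd_imp_eq two_is_prime_nat)
  qed
  show "\<not> int 2 dvd int q" "\<not> int 2 dvd 3 * int q" using assms by auto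
  fix s assume s: "0 \<le> s" "s < int (4 * q)" "int q dvd s" "\<not> int 2 dvd s"
  then obtain t where t: "s = int q * t" by auto
  have "0 \<le> t" using s(1) q0 by (simp add: t zero_le_mult_iff)
  have "int q * t < int q * 4" using s(2) by (simp add: t mult.commute)
  then have "t < 4" using q0 by simp
  have "odd t" using s(4) by (auto simp: t)
  then have "t = 1 \<or> t = 3" using \<open>0 \<le> t\<close> \<open>t < 4\<close> by presburger
  then show "s = int q \<or> s = 3 * int q" by (auto simp: t)
qed auto

section \<open>The classification\<close>

text \<open>\<open>p\<close> divides no \<open>x\<close>, and no other prime divisor of
  \<open>n\<close> divides a \<open>y\<close>, so each pair is jointly prime to \<open>n\<close>;
  neither member is so alone.\<close>

lemma Zn_K33:
  assumes planar: "planar (independence_graph (integer_mod_group n))"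
    and n: "1 < n" and p: "prime p" "p dvd n"
    and X: "distinct [x1, x2, x3]"
      "\<And>x. x \<in> {x1, x2, x3} \<Longrightarrow> x < n \<and> \<not> p dvd x \<and> (\<exists>q. prime q \<and> q dvd n \<and> q dvd x)"
    and Y: "distinct [y1, y2, y3]"
      "\<And>y. y \<in> {y1, y2, y3} \<Longrightarrow> y < n \<and> p dvd y \<and> (\<forall>r. prime r \<longrightarrow> r dvd n \<longrightarrow> r \<noteq> p \<longrightarrow> \<not> r dvd y)"
  shows False
proof (rule planar_no_K33[OF planar])
  show "distinct [int x1, int x2, int x3]" "distinct [int y1, int y2, int y3]"
    using X(1) Y(1) by auto
  fix a b assume "a \<in> {int x1, int x2, int x3}" "b \<in> {int y1, int y2, int y3}"
  then obtain x y where ab: "a = int x" "b = int y" and xy: "x \<in> {x1, x2, x3}" "y \<in> {y1, y2, y3}" by auto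
  have x: "x < n" "\<not> p dvd x" and y: "y < n" "p dvd y" "\<And>r. prime r \<Longrightarrow> r dvd n \<Longrightarrow> r \<noteq> p \<Longrightarrow> \<not> r dvd y"
    using X(2)[OF xy(1)] Y(2)[OF xy(2)] by auto
  obtain q where q: "prime q" "q dvd n" "q dvd x" using X(2)[OF xy(1)] by auto
  have xyn: "gcd (gcd x y) n = 1"
  proof (rule ccontr)
    assume "gcd (gcd x y) n \<noteq> 1"
    then obtain r where "prime r" "r dvd gcd (gcd x y) n" using prime_factor_nat by blast
    then show False using x(2) y(3)[of r] by auto
  qed
  have xn: "gcd x n \<noteq> 1"
    using q by (metis gcd_greatest_iff nat_dvd_1_iff_1 not_prime_1)
  have yn: "gcd y n \<noteq> 1"
    using p y(2) by (metis gcd_greatest_iff nat_dvd_1_iff_1 not_prime_1)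
  show "adjacent (integer_mod_group n) a b"
    unfolding ab
  proof (rule Zn_adjacentI[OF n])
    show "int x \<in> carrier (integer_mod_group n)" "int y \<in> carrier (integer_mod_group n)"
      using x(1) y(1) by (simp_all add: Zn_carrier[OF n])
    show "gcd (gcd (int x) (int y)) (int n) = 1" unfolding gcd_int_int_eq xyn by simp
    show "gcd (int x) (int n) \<noteq> 1" unfolding gcd_int_int_eq using xn by (simp only: of_nat_eq_1_iff not_False_eq_True)
    show "gcd (int y) (int n) \<noteq> 1" unfolding gcd_int_int_eq using yn by (simp only: of_nat_eq_1_iff not_False_eq_True)
  qed
qed

text \<open>Write \<open>n = p\<^sup>a * w\<close> with \<open>w\<close> odd and prime to \<open>p\<close>. Nongenerators prime to \<open>p\<close> are adjacent to all
  multiples of \<open>p\<close> that are prime to \<open>w\<close>; unless \<open>n\<close> has the stated form, there are three of each.\<close>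

lemma planar_Zn_imp:
  assumes planar: "planar (independence_graph (integer_mod_group n))" and n0: "0 < n"
  shows "(n = 1 \<or> primepow n) \<or>
    (\<exists>p q. prime p \<and> prime q \<and> p \<noteq> q \<and> p \<le> 3 \<and> n = p * q) \<or>
    (\<exists>q. prime q \<and> odd q \<and> n = 4 * q)"
proof (rule ccontr)
  assume non: "\<not> ?thesis"
  then have n1: "1 < n" and not_pp: "\<not> primepow n" using n0 by auto
  \<comment> \<open>Taking 2 whenever possible makes the cofactor \<open>w\<close> odd, so that 2 is
    prime to it.\<close>
  obtain p where p: "prime p" "p dvd n" "even n \<Longrightarrow> p = 2"
  proof (cases "even n")
    case True
    then show ?thesis using that[of 2] by auto
  next
    case False
    then show ?thesis using that prime_factor_nat[of n] n1 by auto
  qed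
  define a where "a = multiplicity p n"
  obtain w where w: "n = p ^ a * w" "\<not> p dvd w"
    using multiplicity_decompose'[of n p] n0 p(1) unfolding a_def by (metis not_prime_unit less_numeral_extra(3))
  have a: "0 < a" using p(2) w by (cases a) auto
  have "w \<noteq> 1"
  proof
    assume "w = 1"
    then have "primepow n"
      unfolding primepow_def using p(1) a w(1) by (intro exI[of _ p] exI[of _ a]) simp
    then show False using not_pp by blast
  qed
  have "odd w"
  proof
    assume "even w"
    then have "p = 2" using p(3) w(1) by auto
    then show False using \<open>even w\<close> w(2) by simp
  qed
  then have w3: "3 \<le> w" using \<open>w \<noteq> 1\<close> by (cases "w = 0 \<or> w = 2") auto
  define u where "u = p ^ a"
  have nu: "n = u * w" using w(1) by (simp add: u_def)
  have p2: "2 \<le> p" using p(1) by (rule prime_ge_2_nat)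
  have up: "p \<le> u" using a p2 by (simp add: u_def self_le_power)
  have u_pow: "u = p \<or> p * p \<le> u"
  proof (cases "a = 1")
    case False
    then have "p ^ 2 \<le> u" unfolding u_def using a p2 by (intro power_increasing) auto
    then show ?thesis by (simp add: power2_eq_square)
  qed (simp add: u_def)
  have primes_w: "r dvd w" if "prime r" "r dvd n" "r \<noteq> p" for r
    using that p(1) nu unfolding u_def by (metis prime_dvd_mult_iff prime_dvd_power primes_dvd_imp_eq)
  have q_not_p: "\<not> p dvd q" if "prime q" "q dvd w" for q
    using that w(2) p(1) by (metis primes_dvd_imp_eq)
  have not_3p: "\<not> (w = 3 \<and> u = p)"
  proof
    assume *: "w = 3 \<and> u = p"
    then have "p \<noteq> 3" using w(2) by auto
    then have "prime (3::nat) \<and> prime p \<and> 3 \<noteq> p \<and> (3::nat) \<le> 3 \<and> n = 3 * p"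
      using p(1) * nu by auto
    then show False using non by blast
  qed
  let ?Y = "\<lambda>y. y < n \<and> p dvd y \<and> (\<forall>r. prime r \<longrightarrow> r dvd n \<longrightarrow> r \<noteq> p \<longrightarrow> \<not> r dvd y)"
  have YI: "?Y (p * k)" if "p * k < n" "\<And>r. prime r \<Longrightarrow> r dvd w \<Longrightarrow> \<not> r dvd k" for k
  proof (intro conjI allI impI)
    fix r assume r: "prime r" "r dvd n" "r \<noteq> p"
    have "\<not> r dvd p" using r p(1) primes_dvd_imp_eq by blast
    then show "\<not> r dvd p * k" using that(2)[OF r(1) primes_w[OF r]] r(1) by (simp add: prime_dvd_mult_iff)
  qed (use that in auto)
  \<comment> \<open>Multiples \<open>p k\<close> with \<open>k\<close> prime to \<open>w\<close>:
    for \<open>w \<ge> 5\<close> the odd \<open>w\<close> is prime to 1, 2 and \<open>w - 1\<close>,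
    and \<open>p w \<le> n\<close> leaves room; for \<open>w = 3\<close> the factors 1, 2, 4 need
    \<open>4 p < 3 u\<close>, which is where \<open>n = 3 p\<close> must be excluded.\<close>
  obtain k1 k2 k3 where Y: "distinct [k1, k2, k3]" "\<And>k. k \<in> {k1, k2, k3} \<Longrightarrow> ?Y (p * k)"
  proof (cases "5 \<le> w")
    case True
    have le: "p * w \<le> n" unfolding nu using up by simp
    have lt: "p * k < n" if "k < w" for k
      using that p2 le by (meson less_le_trans mult_less_mono2 pos2 less_le_trans)
    have Y: "?Y (p * k)" if "k \<in> {1, 2, w - 1}" for k
    proof (rule YI)
      show "p * k < n" using that True by (intro lt) auto
      fix r assume r: "prime r" "r dvd w"
      have "\<not> r dvd 1" using r(1) by auto
      moreover have "\<not> r dvd 2"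
      proof
        assume "r dvd 2"
        then have "r = 2" using r(1) two_is_prime_nat primes_dvd_imp_eq by blast
        then show False using r(2) \<open>odd w\<close> by simp
      qed
      moreover have "\<not> r dvd w - 1"
      proof
        assume "r dvd w - 1"
        with r(2) have "r dvd w - (w - 1)" by (rule dvd_diff_nat)
        moreover have "w - (w - 1) = 1" using True by simp
        ultimately show False using \<open>\<not> r dvd 1\<close> by simp
      qed
      ultimately show "\<not> r dvd k" using that by auto
    qed
    show ?thesis by (rule that[OF _ Y]) (use True in auto)
  next
    case False
    have "w \<noteq> 4" using \<open>odd w\<close> by auto
    then have w_eq: "w = 3" using False w3 by linarith
    then have "p * p \<le> u" using not_3p u_pow by auto
    then have "2 * p \<le> u" using p2 by (meson le_trans mult_le_mono1)
    then have "4 * p < n" unfolding nu w_eq using p2 by linarith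
    have Y: "?Y (p * k)" if "k \<in> {1, 2, 4}" for k
    proof (rule YI)
      show "p * k < n" using that \<open>4 * p < n\<close> by auto
      fix r assume r: "prime r" "r dvd w"
      have "r = 2 \<or> r = 3"
        using prime_ge_2_nat[OF r(1)] dvd_imp_le[OF r(2)] unfolding w_eq by auto
      then have "r = 3" using r(2) unfolding w_eq by auto
      then show "\<not> r dvd k" using that by auto
    qed
    show ?thesis by (rule that[OF _ Y]) auto
  qed
  let ?X = "\<lambda>x. x < n \<and> \<not> p dvd x \<and> (\<exists>q. prime q \<and> q dvd n \<and> q dvd x)"
  have XI: "?X (q * k)" if "prime q" "q dvd w" "q * k < n" "\<not> p dvd k" for q k
    using that q_not_p[OF that(1,2)] p(1) nu by (auto simp: prime_dvd_mult_iff intro!: exI[of _ q])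
  \<comment> \<open>For prime \<open>w\<close> the multiples \<open>w k\<close> with
    \<open>k < u\<close> prime to \<open>p\<close> are available. There are three of them unless
    \<open>u\<close> is 2, 3 or 4, which gives the listed orders \<open>2 w\<close>,
    \<open>3 w\<close> and \<open>4 w\<close>.\<close>
  obtain x1 x2 x3 where X: "distinct [x1, x2, x3]" "\<And>x. x \<in> {x1, x2, x3} \<Longrightarrow> ?X x"
  proof (cases "prime w")
    case True
    have X: "?X (w * k)" if "k < u" "\<not> p dvd k" for k
      using that w3 True by (intro XI) (auto simp: nu)
    note obtained = that
    have triple: thesis if k: "k1 < k2" "k2 < k3" "k3 < u" "\<not> p dvd k1" "\<not> p dvd k2" "\<not> p dvd k3" for k1 k2 k3
    proof (rule obtained)
      show "distinct [w * k1, w * k2, w * k3]" using k w3 by auto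
      have "?X (w * k1)" "?X (w * k2)" "?X (w * k3)" using k by (intro X; simp)+
      then show "?X x" if "x \<in> {w * k1, w * k2, w * k3}" for x using that by blast
    qed
    consider "p = 2" | "p = 3" | "5 \<le> p"
    proof -
      have "p \<noteq> 4" using p(1) by auto
      then show ?thesis using that p2 by linarith
    qed
    then show thesis
    proof cases
      case 1
      have "a \<noteq> 1"
      proof
        assume "a = 1"
        then have "prime (2::nat) \<and> prime w \<and> 2 \<noteq> w \<and> (2::nat) \<le> 3 \<and> n = 2 * w"
          using True w3 1 w(1) by auto
        then show False using non by blast
      qed
      moreover have "a \<noteq> 2"
      proof
        assume "a = 2"
        then have "prime w \<and> odd w \<and> n = 4 * w" using True \<open>odd w\<close> 1 w(1) by auto
        then show False using non by blast
      qed
      ultimately have "3 \<le> a" using a by linarith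
      then have "2 ^ 3 \<le> u" unfolding u_def 1 by (intro power_increasing) auto
      then show thesis using 1 by (intro triple[of 1 3 5]) auto
    next
      case 2
      have "u \<noteq> p"
      proof
        assume "u = p"
        then have "prime (3::nat) \<and> prime w \<and> 3 \<noteq> w \<and> (3::nat) \<le> 3 \<and> n = 3 * w"
          using True 2 w(2) nu p(1) by auto
        then show False using non by blast
      qed
      then have "9 \<le> u" using u_pow 2 by auto
      then show thesis using 2 by (intro triple[of 1 2 4]) auto
    next
      case 3
      then show thesis using up by (intro triple[of 1 2 3]) (auto dest: dvd_imp_le)
    qed
  next
    case False
    obtain q where q: "prime q" "q dvd w" using prime_factor_nat \<open>w \<noteq> 1\<close> by blast
    then obtain c where c: "w = q * c" by blast
    have "c \<noteq> 0" "c \<noteq> 1" "c \<noteq> 2" using c w3 False q(1) \<open>odd w\<close> by auto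
    then have "3 \<le> c" by linarith
    have "p * 3 \<le> u * c" using up \<open>3 \<le> c\<close> by (rule mult_le_mono)
    then have lt: "2 * p + 1 < u * c" using p2 by linarith
    have n_eq: "n = q * (u * c)" by (simp add: nu c)
    have q0: "0 < q" using q(1) by (rule prime_gt_0_nat)
    \<comment> \<open>These factors are 1 modulo \<open>p\<close>, and the cofactor
      \<open>c \<ge> 3\<close> makes them small enough.\<close>
    have X: "?X (q * k)" if "k \<in> {1, p + 1, 2 * p + 1}" for k
    proof (rule XI[OF q])
      have "k < u * c" using that lt by auto
      then show "q * k < n" unfolding n_eq using q0 by simp
      show "\<not> p dvd k"
        using that p2 dvd_add_right_iff[of p p 1] dvd_add_right_iff[of p "2 * p" 1] by auto
    qed
    show thesis
    proof (rule that)
      show "distinct [q * 1, q * (p + 1), q * (2 * p + 1)]" using q0 p2 by auto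
      show "?X x" if "x \<in> {q * 1, q * (p + 1), q * (2 * p + 1)}" for x using that X by blast
    qed
  qed
  show False
  proof (rule Zn_K33[OF planar n1 p(1,2) X])
    show "distinct [p * k1, p * k2, p * k3]" using Y(1) p2 by auto
    show "?Y y" if "y \<in> {p * k1, p * k2, p * k3}" for y using that Y(2) by blast
  qed
qed

lemma (in group) cyclic_iso:
  assumes x: "x \<in> carrier G" "generate G {x} = carrier G" and fin: "finite (carrier G)"
  shows "0 < ord x" "G \<cong> integer_mod_group (ord x)"
proof -
  let ?n = "ord x"
  show n: "0 < ?n" using ord_ge_1[OF fin x(1)] by linarith
  let ?\<phi> = "\<lambda>i::int. x [^] i"
  have mod_n: "x [^] (i mod int ?n) = x [^] i" for i :: int
    by (simp add: int_pow_eq[OF x(1)])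
  have "?\<phi> \<in> hom (integer_mod_group ?n) G"
    by (rule homI) (simp_all add: x mod_n int_pow_mult)
  moreover have "inj_on ?\<phi> {0..<int ?n}"
  proof (rule inj_onI)
    fix i j assume ij: "i \<in> {0..<int ?n}" "j \<in> {0..<int ?n}" "x [^] i = x [^] j"
    then have "int ?n dvd j - i" using int_pow_eq[OF x(1)] by blast
    then have "j mod int ?n = i mod int ?n" by (simp only: mod_eq_dvd_iff)
    moreover have "i mod int ?n = i" "j mod int ?n = j" using ij by simp_all
    ultimately show "i = j" by simp
  qed
  moreover have "?\<phi> ` {0..<int ?n} = carrier G"
  proof
    show "carrier G \<subseteq> ?\<phi> ` {0..<int ?n}"
    proof
      fix y assume "y \<in> carrier G"
      then obtain k :: int where "y = x [^] k" using generate_pow[OF x(1)] x(2) by auto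
      then have "y = x [^] (k mod int ?n)" by (simp add: mod_n)
      then show "y \<in> ?\<phi> ` {0..<int ?n}" using n by auto
    qed
  qed (use x in auto)
  ultimately have "?\<phi> \<in> iso (integer_mod_group ?n) G"
    using n by (simp add: iso_def bij_betw_def carrier_integer_mod_group)
  then show "G \<cong> integer_mod_group ?n"
    using group.iso_sym[OF group_integer_mod_group] is_isoI by blast
qed

text \<open>A generating set of least size has at most two elements by planarity and at least two by
  noncyclicity.\<close>

lemma (in group) noncyclic_generating_pair:
  assumes fin: "finite (carrier G)" and planar: "planar (independence_graph G)"
    and noncyclic: "\<And>x. x \<in> carrier G \<Longrightarrow> generate G {x} \<noteq> carrier G"
  shows "\<exists>a b. generating_pair G a b"
proof -
  let ?P = "\<lambda>X. finite X \<and> X \<subseteq> carrier G \<and> generate G X = carrier G"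
  have "?P (carrier G)" using fin generate_incl[of "carrier G"] by (auto intro: generate.incl)
  from ex_has_least_nat[of ?P, OF this, of card] obtain X where X: "?P X" and least: "\<And>Z. ?P Z \<Longrightarrow> card X \<le> card Z"
    by blast
  have "card X \<le> 2" using X by (intro planar_imp_rank_le_2[OF planar]) (auto intro: least)
  moreover have "\<not> X \<subseteq> {x}" if "x \<in> carrier G" for x
  proof
    assume "X \<subseteq> {x}"
    then have "carrier G \<subseteq> generate G {x}" using X mono_generate by metis
    then show False using noncyclic[OF that] generate_incl[of "{x}"] that by auto
  qed
  then have "X \<noteq> {}" "\<And>x. X \<noteq> {x}" using X by auto
  then have "card X \<noteq> 0" "card X \<noteq> 1" using X by (auto simp: card_1_singleton_iff)
  ultimately have "card X = 2" by linarith
  then obtain a b where "X = {a, b}" by (auto simp: card_2_iff)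
  then show ?thesis using X by (auto simp: generating_pair_def)
qed

lemma planar_S3: "planar (independence_graph (sym_group 3))"
proof -
  interpret group "sym_group 3" by (rule sym_group_is_group)
  obtain r s where pair: "metacyclic_pair (sym_group 3) 3 0 2 r s" using metacyclic_S3(1) by blast
  then have r: "r \<in> carrier (sym_group 3)" "ord r = 3" by (auto simp: metacyclic_pair_def)
  have "r \<noteq> inv\<^bsub>sym_group 3\<^esub> r"
  proof
    assume "r = inv\<^bsub>sym_group 3\<^esub> r"
    then have "r [^]\<^bsub>sym_group 3\<^esub> (2::nat) = \<one>\<^bsub>sym_group 3\<^esub>"
      using r(1) r_inv[OF r(1)] by (simp add: numeral_2_eq_2)
    then show False using r by (simp add: pow_eq_id)
  qed
  moreover have "card (carrier (sym_group 3)) = 6" using metacyclic_S3(2) by simp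
  ultimately show ?thesis
    using r(1) by (intro planar_of_card_le_6) (auto intro: card_ge_0_finite)
qed

theorem theorem3:
  fixes G :: "('a, 'b) monoid_scheme"
  assumes "group G" and "finite (carrier G)"
  shows "planar (independence_graph G) \<longleftrightarrow>
     (G \<cong> integer_mod_group 2 \<times>\<times> integer_mod_group 2 \<or>
      G \<cong> integer_mod_group 2 \<times>\<times> integer_mod_group 4 \<or>
      G \<cong> dihedral_group 4 \<or>
      G \<cong> quaternion_group \<or>
      G \<cong> sym_group 3) \<or>
     (\<exists>n::nat. G \<cong> integer_mod_group n \<and>
        ((n = 1 \<or> primepow n) \<or>
         (\<exists>p q. Factorial_Ring.prime p \<and> Factorial_Ring.prime q \<and> p \<noteq> q \<and> p \<le> 3 \<and> n = p * q) \<or>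
         (\<exists>q. Factorial_Ring.prime q \<and> odd q \<and> n = 4 * q)))"
    (is "?planar \<longleftrightarrow> ?small \<or> (\<exists>n. G \<cong> integer_mod_group n \<and> ?N n)")
proof
  interpret group G by fact
  assume planar: ?planar
  show "?small \<or> (\<exists>n. G \<cong> integer_mod_group n \<and> ?N n)"
  proof (cases "\<exists>x\<in>carrier G. generate G {x} = carrier G")
    case True
    then obtain x where x: "x \<in> carrier G" "generate G {x} = carrier G" by blast
    note iso = cyclic_iso[OF x assms(2)]
    have "integer_mod_group (ord x) \<cong> G" by (rule iso_sym[OF iso(2)])
    from planar_independence_graph_iso[OF group_integer_mod_group assms(1) this planar]
    have "planar (independence_graph (integer_mod_group (ord x)))" .
    then have "?N (ord x)" using iso(1) by (rule planar_Zn_imp)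
    then show ?thesis using iso(2) by blast
  next
    case False
    interpret noncyclic_group G by unfold_locales (use False in blast)
    obtain a0 b0 where "generating_pair G a0 b0"
      using noncyclic_generating_pair[OF assms(2) planar noncyclic] by blast
    from planar_metacyclic_pair[OF planar this assms(2)] obtain a b m k e where
      gen: "generating_pair G a b" and pair: "metacyclic_pair G m k e a b" and
      mke: "(m, k, e) \<in> {(2, 0, 1), (4, 0, 1), (4, 0, 3), (4, 2, 3), (3, 0, 2)}" by blast
    have gen': "generate G {a, b} = carrier G" using gen by (simp add: generating_pair_def)
    have iso: "G \<cong> H" if "group H" "metacyclic_pair H m k e c d" "card (carrier H) = 2 * m" "0 < m" for H c d
      by (rule metacyclic_iso[OF assms(1) pair gen' assms(2) that])
    from mke consider "m = 2" "k = 0" "e = 1" | "m = 4" "k = 0" "e = 1" | "m = 4" "k = 0" "e = 3"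
      | "m = 4" "k = 2" "e = 3" | "m = 3" "k = 0" "e = 2" by auto
    then have ?small
    proof cases
      case 1
      then have "G \<cong> integer_mod_group 2 \<times>\<times> integer_mod_group 2"
        using metacyclic_C2_C2 by (intro iso) auto
      then show ?thesis by blast
    next
      case 2
      then have "G \<cong> integer_mod_group 2 \<times>\<times> integer_mod_group 4"
        using metacyclic_C2_C4 by (intro iso) auto
      then show ?thesis by blast
    next
      case 3
      then have "G \<cong> dihedral_group 4"
        using metacyclic_D4 by (intro iso group_dihedral_group) auto
      then show ?thesis by blast
    next
      case 4
      then have "G \<cong> quaternion_group"
        using metacyclic_Q8 by (intro iso group_quaternion_group) auto
      then show ?thesis by blast
    next
      case 5
      then have "G \<cong> sym_group 3"
        using metacyclic_S3 by (intro iso sym_group_is_group) auto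
      then show ?thesis by blast
    qed
    then show ?thesis by blast
  qed
next
  assume "?small \<or> (\<exists>n. G \<cong> integer_mod_group n \<and> ?N n)"
  then consider "G \<cong> integer_mod_group 2 \<times>\<times> integer_mod_group 2" | "G \<cong> integer_mod_group 2 \<times>\<times> integer_mod_group 4"
    | "G \<cong> dihedral_group 4" | "G \<cong> quaternion_group" | "G \<cong> sym_group 3"
    | n where "G \<cong> integer_mod_group n" "?N n" by blast
  then show ?planar
  proof cases
    \<comment> \<open>The four groups of order 4 and 8 have \<open>e\<close> odd and
      \<open>k\<close> even; Sym(3), with \<open>m = 3\<close> and \<open>e = 2\<close>, is handled
      through its order instead.\<close>
    case 1
    show ?thesis
      by (rule planar_independence_graph_iso[OF assms(1) metacyclic_C2_C2(1) 1])
        (rule group.planar_of_metacyclic_pair[OF metacyclic_C2_C2(1,2) _ _ _ metacyclic_C2_C2(3)]; simp)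
  next
    case 2
    show ?thesis
      by (rule planar_independence_graph_iso[OF assms(1) metacyclic_C2_C4(1) 2])
        (rule group.planar_of_metacyclic_pair[OF metacyclic_C2_C4(1,2) _ _ _ metacyclic_C2_C4(3)]; simp)
  next
    case 3
    have D: "group (dihedral_group 4)" by (rule group_dihedral_group) simp
    show ?thesis
      by (rule planar_independence_graph_iso[OF assms(1) D 3])
        (rule group.planar_of_metacyclic_pair[OF D metacyclic_D4(1) _ _ _ metacyclic_D4(2)]; simp)
  next
    case 4
    show ?thesis
      by (rule planar_independence_graph_iso[OF assms(1) group_quaternion_group 4])
        (rule group.planar_of_metacyclic_pair[OF group_quaternion_group metacyclic_Q8(1) _ _ _ metacyclic_Q8(2)]; simp)
  next
    case 5
    show ?thesis
      by (rule planar_independence_graph_iso[OF assms(1) sym_group_is_group 5 planar_S3])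
  next
    case 6
    have "planar (independence_graph (integer_mod_group n))"
      using 6(2) planar_Z1 planar_Zn_primepow planar_Zpq planar_Z4q by auto
    then show ?thesis
      by (rule planar_independence_graph_iso[OF assms(1) group_integer_mod_group 6(1)])
  qed
qed

end
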